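(* Let $H$ be an LI set and let $\mathbf X=(X(t))_{t\in\mathbb R}$ be a stochastic process having paths in $H$ with probability $1$. Then the following are equivalent. (1) The process $\mathbf X$ has stationary increments. (2) For some (equivalently, any) $\Delta>0$: for any doubly intrinsic location functional $L:H\times\mathcal I\to\mathbb R\cup\{\infty\}$, the law of $L(\mathbf X,[a,a+\Delta])-a$ does not depend on $a\in\mathbb R$. (3) For any doubly intrinsic location functional $L:H\times\mathcal I\to\mathbb R\cup\{\infty\}$ and any interval $I=[a,b]\in\mathcal I$, the law of $L(\mathbf X,I)$ is absolutely continuous on $(a,b)$ and has a density there satisfying the total variation constraints on $[a,b]$.
   Context: $\mathcal I$ is the set of all compact non-degenerate intervals $[a,b]$, $a<b$, of $\mathbb R$. For a function $f:\mathbb R\to\mathbb R$ and $c\in\mathbb R$, $\theta_cf(x)=f(x+c)$. $\mathbb R\cup\{\infty\}$ carries the $\sigma$-field generated by the Borel sets of $\mathbb R$ and the singleton $\{\infty\}$; $\infty+c=\infty$. LI set: a set $H$ of real functions on $\mathbb R$ such that $H$ is invariant under shifts ($\theta_cf\in H$ for $f\in H$, $c\in\mathbb R$); $H$ is equipped with its cylindrical $\sigma$-field; the map $H\times\mathbb R\to\mathbb R$, $(f,t)\mapsto f(t)$, is measurable; every $f\in H$ is locally integrable. It is understood that $f+c\in H$ for $f\in H$ and constants $c\in\mathbb R$. Intrinsic location functional: a map $L:H\times\mathcal I\to\mathbb R\cup\{\infty\}$ such that (1) for every $I\in\mathcal I$, $L(\cdot,I)$ is measurable; (2) $L(f,I)\in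 I\cup\{\infty\}$ for all $f\in H$, $I\in\mathcal I$; (3) $L(f,I)=L(\theta_cf,I-c)+c$ for all $f\in H$, $I\in\mathcal I$, $c\in\mathbb R$; (4) for $f\in H$ and $I_2\subseteq I_1$ in $\mathcal I$, if $L(f,I_1)\in I_2$ then $L(f,I_2)=L(f,I_1)$; (5) for $f\in H$ and $I_2\subseteq I_1$ in $\mathcal I$, if $L(f,I_2)\ne\infty$ then $L(f,I_1)\neq\infty$. It is doubly intrinsic if moreover $L(f,I)=L(f+c,I)$ for all $f\in H$, $I\in\mathcal I$, $c\in\mathbb R$. Total variation constraints on $[a,b]$: for a density $f$ on $(a,b)$ (taken right continuous with left limits $f(t-)$, and for which $f(a+)=\lim_{t\downarrow a}f(t)$ and $f(b-)=\lim_{t\uparrow b}f(t)$ exist in $[0,\infty]$), and $a\le u<v\le b$, put $TV_{(u,v)}(f)=\sup\sum_{i=1}^{n-1}|f(s_{i+1})-f(s_i)|$ and $TV^{\pm}_{(u,v)}(f)=\sup\sum_{i=1}^{n-1}(f(s_{i+1})-f(s_i))_{\pm}$ (positive/negative parts), suprema over all $u<s_1<\dots<s_n<v$. The constraints are: (i) for all $a<t_1<t_2<b$, $TV_{(t_1,t_2)}(f)\le\min(f(t_1),f(t_1-))+\min(f(t_2),f(t_2-))$; (ii) for all $0<\varepsilon<b-a$, $TV^+_{(a,a+\varepsilon)}(f)\le\min(f(a+\varepsilon),f((a+\varepsilon)-))$ and $TV^-_{(b-\varepsilon,b)}(f)\le\min(f(b-\varepsilon),f((b-\varepsilon)-))$;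 (iii) $f(a+)<\infty$ if and only if $TV_{(a,a+\varepsilon)}(f)<\infty$ for some (equivalently, any) $0<\varepsilon<b-a$, in which case $TV_{(a,a+\varepsilon)}(f)\le f(a+)+\min(f(a+\varepsilon),f((a+\varepsilon)-))$; and $f(b-)<\infty$ if and only if $TV_{(b-\varepsilon,b)}(f)<\infty$ for some (equivalently, any) $0<\varepsilon<b-a$, in which case $TV_{(b-\varepsilon,b)}(f)\le\min(f(b-\varepsilon),f((b-\varepsilon)-))+f(b-)$. *)

theory Defs
  imports "HOL-Probability.Probability"
begin

definition intervals :: "real set set" where
  "intervals = {I. \<exists>a b. a < b \<and> I = {a..b}}"

definition shift :: "real \<Rightarrow> (real \<Rightarrow> real) \<Rightarrow> real \<Rightarrow> real" where
  "shift c f = (\<lambda>x. f (x + c))"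

text \<open>The set \<open>\<real> \<union> {\<infinity>}\<close> is realised inside \<^typ>\<open>ereal\<close>, without \<open>-\<infinity>\<close>.\<close>

definition ext_line :: "ereal measure" where
  "ext_line = sigma (insert \<infinity> (range ereal)) (insert {\<infinity>} ((\<lambda>B. ereal ` B) ` sets borel))"

definition path_space :: "(real \<Rightarrow> real) measure" where
  "path_space = PiM UNIV (\<lambda>_. borel)"

definition cylindrical :: "(real \<Rightarrow> real) set \<Rightarrow> (real \<Rightarrow> real) measure" where
  "cylindrical H = restrict_space path_space H"

definition LI_set :: "(real \<Rightarrow> real) set \<Rightarrow> bool" where
  "LI_set H \<longleftrightarrow>
     (\<forall>f\<in>H. \<forall>c. shift c f \<in> H) \<and>
     (\<forall>f\<in>H. \<forall>c. (\<lambda>x. f x + c) \<in> H) \<and>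
     (\<lambda>(f, t). f t) \<in> borel_measurable (cylindrical H \<Otimes>\<^sub>M borel) \<and>
     (\<forall>f\<in>H. \<forall>a b. set_integrable lborel {a..b} f)"

definition intrinsic_location ::
  "(real \<Rightarrow> real) set \<Rightarrow> ((real \<Rightarrow> real) \<Rightarrow> real set \<Rightarrow> ereal) \<Rightarrow> bool" where
  "intrinsic_location H L \<longleftrightarrow>
     (\<forall>I\<in>intervals. (\<lambda>f. L f I) \<in> cylindrical H \<rightarrow>\<^sub>M ext_line) \<and>
     (\<forall>f\<in>H. \<forall>I\<in>intervals. L f I \<in> ereal ` I \<union> {\<infinity>}) \<and>
     (\<forall>f\<in>H. \<forall>I\<in>intervals. \<forall>c. L f I = L (shift c f) ((\<lambda>x. x - c) ` I) + ereal c) \<and>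
     (\<forall>f\<in>H. \<forall>I1\<in>intervals. \<forall>I2\<in>intervals.
        I2 \<subseteq> I1 \<and> L f I1 \<in> ereal ` I2 \<longrightarrow> L f I2 = L f I1) \<and>
     (\<forall>f\<in>H. \<forall>I1\<in>intervals. \<forall>I2\<in>intervals.
        I2 \<subseteq> I1 \<and> L f I2 \<noteq> \<infinity> \<longrightarrow> L f I1 \<noteq> \<infinity>)"

definition doubly_intrinsic_location ::
  "(real \<Rightarrow> real) set \<Rightarrow> ((real \<Rightarrow> real) \<Rightarrow> real set \<Rightarrow> ereal) \<Rightarrow> bool" where
  "doubly_intrinsic_location H L \<longleftrightarrow>
     intrinsic_location H L \<and>
     (\<forall>f\<in>H. \<forall>I\<in>intervals. \<forall>c. L f I = L (\<lambda>x. f x + c) I)"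

definition stationary_increments :: "'a measure \<Rightarrow> (real \<Rightarrow> 'a \<Rightarrow> real) \<Rightarrow> bool" where
  "stationary_increments M X \<longleftrightarrow>
     (\<forall>h. distr M path_space (\<lambda>\<omega> t. X (t + h) \<omega> - X h \<omega>) =
          distr M path_space (\<lambda>\<omega> t. X t \<omega> - X 0 \<omega>))"

text \<open>
  The path lies in \<open>H\<close> only almost surely, and the exceptional set is contained in a null set
  but need not be an event. The location is therefore given the arbitrary value \<open>\<infinity>\<close> there,
  and its law is taken under the completed probability.
\<close>

definition path_location ::
  "(real \<Rightarrow> real) set \<Rightarrow> ((real \<Rightarrow> real) \<Rightarrow> real set \<Rightarrow> ereal) \<Rightarrow> (real \<Rightarrow> 'a \<Rightarrow> real)
    \<Rightarrow> real set \<Rightarrow> 'a \<Rightarrow> ereal" where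
  "path_location H L X I \<omega> =
     (if (\<lambda>t. X t \<omega>) \<in> H then L (\<lambda>t. X t \<omega>) I else \<infinity>)"

definition ext_law :: "'a measure \<Rightarrow> ('a \<Rightarrow> ereal) \<Rightarrow> ereal measure" where
  "ext_law M Y = distr (completion M) ext_line Y"

definition law_inside :: "ereal measure \<Rightarrow> real \<Rightarrow> real \<Rightarrow> real measure" where
  "law_inside \<mu> a b =
     distr (restrict_space \<mu> (ereal ` {a<..<b})) (restrict_space borel {a<..<b}) real_of_ereal"

definition variation ::
  "(real \<Rightarrow> real) \<Rightarrow> (real \<Rightarrow> real) \<Rightarrow> real \<Rightarrow> real \<Rightarrow> ennreal" where
  "variation \<phi> f u v =
     (SUP (n, s) \<in> {(n :: nat, s). strict_mono_on {1..n} s \<and> s ` {1..n} \<subseteq> {u<..<v}}.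
        ennreal (\<Sum>i = 1..<n. \<phi> (f (s (i + 1)) - f (s i))))"

definition TV :: "(real \<Rightarrow> real) \<Rightarrow> real \<Rightarrow> real \<Rightarrow> ennreal" where
  "TV f u v = variation abs f u v"

definition TV_pos :: "(real \<Rightarrow> real) \<Rightarrow> real \<Rightarrow> real \<Rightarrow> ennreal" where
  "TV_pos f u v = variation (\<lambda>x. max x 0) f u v"

definition TV_neg :: "(real \<Rightarrow> real) \<Rightarrow> real \<Rightarrow> real \<Rightarrow> ennreal" where
  "TV_neg f u v = variation (\<lambda>x. max (- x) 0) f u v"

definition min_left :: "(real \<Rightarrow> real) \<Rightarrow> real \<Rightarrow> ennreal" where
  "min_left f t = ennreal (min (f t) (Lim (at_left t) f))"

text \<open>Nonnegativity makes \<^const>\<open>ennreal\<close> lossless, here and in \<^const>\<open>min_left\<close>.\<close>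

definition regular_density :: "(real \<Rightarrow> real) \<Rightarrow> real \<Rightarrow> real \<Rightarrow> bool" where
  "regular_density f a b \<longleftrightarrow>
     (\<forall>t\<in>{a<..<b}. 0 \<le> f t \<and> continuous (at_right t) f \<and> (\<exists>l. (f \<longlongrightarrow> l) (at_left t))) \<and>
     (\<exists>l. ((\<lambda>t. ennreal (f t)) \<longlongrightarrow> l) (at_right a)) \<and>
     (\<exists>l. ((\<lambda>t. ennreal (f t)) \<longlongrightarrow> l) (at_left b))"

text \<open>
  Finiteness of the variation near an endpoint for some \<open>\<epsilon>\<close> and for all \<open>\<epsilon>\<close> are equivalent given
  the first constraint; both versions are imposed.
\<close>

definition TV_constraints :: "(real \<Rightarrow> real) \<Rightarrow> real \<Rightarrow> real \<Rightarrow> bool" where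
  "TV_constraints f a b \<longleftrightarrow>
    (let fa = Lim (at_right a) (\<lambda>t. ennreal (f t));
         fb = Lim (at_left b) (\<lambda>t. ennreal (f t));
         E = {0<..<b - a}
     in
      (\<forall>t1 t2. a < t1 \<and> t1 < t2 \<and> t2 < b \<longrightarrow> TV f t1 t2 \<le> min_left f t1 + min_left f t2) \<and>
      (\<forall>\<epsilon>\<in>E. TV_pos f a (a + \<epsilon>) \<le> min_left f (a + \<epsilon>)) \<and>
      (\<forall>\<epsilon>\<in>E. TV_neg f (b - \<epsilon>) b \<le> min_left f (b - \<epsilon>)) \<and>
      (fa < \<infinity> \<longleftrightarrow> (\<exists>\<epsilon>\<in>E. TV f a (a + \<epsilon>) < \<infinity>)) \<and>
      (fa < \<infinity> \<longleftrightarrow> (\<forall>\<epsilon>\<in>E. TV f a (a + \<epsilon>) < \<infinity>)) \<and>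
      (fa < \<infinity> \<longrightarrow> (\<forall>\<epsilon>\<in>E. TV f a (a + \<epsilon>) \<le> fa + min_left f (a + \<epsilon>))) \<and>
      (fb < \<infinity> \<longleftrightarrow> (\<exists>\<epsilon>\<in>E. TV f (b - \<epsilon>) b < \<infinity>)) \<and>
      (fb < \<infinity> \<longleftrightarrow> (\<forall>\<epsilon>\<in>E. TV f (b - \<epsilon>) b < \<infinity>)) \<and>
      (fb < \<infinity> \<longrightarrow> (\<forall>\<epsilon>\<in>E. TV f (b - \<epsilon>) b \<le> min_left f (b - \<epsilon>) + fb)))"

definition shift_free_laws ::
  "'a measure \<Rightarrow> (real \<Rightarrow> 'a \<Rightarrow> real) \<Rightarrow> (real \<Rightarrow> real) set \<Rightarrow> real \<Rightarrow> bool" where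
  "shift_free_laws M X H \<Delta> \<longleftrightarrow>
     (\<forall>L. doubly_intrinsic_location H L \<longrightarrow>
        (\<forall>a a'. ext_law M (\<lambda>\<omega>. path_location H L X {a..a + \<Delta>} \<omega> - ereal a) =
                ext_law M (\<lambda>\<omega>. path_location H L X {a'..a' + \<Delta>} \<omega> - ereal a')))"

definition TV_laws ::
  "'a measure \<Rightarrow> (real \<Rightarrow> 'a \<Rightarrow> real) \<Rightarrow> (real \<Rightarrow> real) set \<Rightarrow> bool" where
  "TV_laws M X H \<longleftrightarrow>
     (\<forall>L a b. doubly_intrinsic_location H L \<and> a < b \<longrightarrow>
        (let \<nu> = law_inside (ext_law M (path_location H L X {a..b})) a b;
             leb = restrict_space lborel {a<..<b}
         in absolutely_continuous leb \<nu> \<and>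
            (\<exists>f \<in> borel_measurable leb.
               \<nu> = density leb (\<lambda>x. ennreal (f x)) \<and>
               regular_density f a b \<and> TV_constraints f a b)))"

end

theory Submission imports Defs begin

text \<open>
  If the increments are stationary and \<open>L\<close> is doubly intrinsic, let \<open>q l r w\<close> be the probability
  that \<open>L\<close> on \<open>[-l, w + r]\<close> falls into \<open>[0, w)\<close>. Then \<open>q\<close> decreases in \<open>l\<close> and \<open>r\<close>, increases in
  \<open>w\<close>, and \<open>q l r (w + d) = q l (r + d) w + q (l + w) r d\<close>. Hence \<open>q\<close> is subadditive in \<open>w\<close>, so
  \<open>q l r w / w\<close> converges as \<open>w \<rightarrow> 0\<close> dyadically. On a grid of mesh \<open>e\<close> the quotients \<open>q (x - a) (b - x) e / e\<close>
  have positive variation at most their last value and negative variation at most their first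
  value; these bounds survive the limit and give a right-continuous density with the
  constraints.

  Conversely, for an event \<open>A\<close> of normalised paths let \<open>U t\<close> be the time that the path, shifted by
  \<open>s\<close> and recentred at \<open>0\<close>, spends in \<open>A\<close> for \<open>s\<close> in \<open>[t, t + h]\<close>. The first point of the closed
  set \<open>{U \<ge> c}\<close> in an interval is a doubly intrinsic location. Shift-free laws say directly that \<open>P(U t \<ge> c)\<close> does not
  depend on \<open>t\<close>. Under the variation constraints the first point of any such random closed set after \<open>a\<close> has
  a decreasing density on \<open>(a, \<infinity>)\<close>; applied to the points preceded by a gap of given length, and to the
  last point of the set, this makes \<open>P(U t \<ge> c)\<close> increasing in \<open>t\<close>, and passing to the
  complement of \<open>A\<close> makes the mean of \<open>U t\<close> constant. Therefore the pairs \<open>(s, X(s + \<cdot>) - X(s))\<close> and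
  \<open>(s, X(s + b + \<cdot>) - X(s + b))\<close> with \<open>s\<close> Lebesgue distributed have the same law; shifting back by
  \<open>s\<close>, which is measurable because evaluation is jointly measurable on \<open>H\<close>, yields
  stationary increments for every \<open>b\<close> and not only almost every one.
\<close>

text \<open>The two halves meet different obstacles. A location may have atoms at the ends of its
  interval and at infinity, and no density is given in advance: the quotients are estimated only at
  points of one common grid, so their limit is controlled on dyadic points alone and becomes a
  function on the whole interval by taking right limits. In the converse, the times at which a
  recentred path lies in an event form a mere Borel set, which need not have first points; the
  occupation time of a window is 1-Lipschitz in the position of the window, so its superlevel sets
  are closed and their hitting events are measurable. The variation constraints say nothing about
  atoms, whereas the probability that a belongs to the set is the atom of its first point at the
  left end of the interval. It is reached through the complement: a first point strictly after a, or
  no point from a on. The former is compared through gaps, the latter through the last point. A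
  one-sided inequality suffices because the occupation times of an event and of its complement add
  up to h.\<close>

subsection \<open>Variation along finite lists\<close>

text \<open>Upper variation along a list instead of along the index sequences of
  \<open>variation\<close>, so that estimates go by structural induction. Repeated entries
  contribute 0, hence weakly sorted lists suffice throughout.\<close>

fun posvar :: "('a \<Rightarrow> real) \<Rightarrow> 'a list \<Rightarrow> real" where
  "posvar h (x # y # zs) = max 0 (h y - h x) + posvar h (y # zs)"
| "posvar h [x] = 0"
| "posvar h [] = 0"

abbreviation negvar :: "('a \<Rightarrow> real) \<Rightarrow> 'a list \<Rightarrow> real" where
  "negvar h \<equiv> posvar (\<lambda>x. - h x)"

lemma posvar_nonneg [simp]: "0 \<le> posvar h xs"
  by (induction h xs rule: posvar.induct) auto

lemma posvar_map: "posvar h (map g xs) = posvar (\<lambda>x. h (g x)) xs"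
  by (induction "\<lambda>x. h (g x)" xs rule: posvar.induct) auto

lemma posvar_snoc:
  "posvar h (xs @ [y]) = posvar h xs + (if xs = [] then 0 else max 0 (h y - h (last xs)))"
  by (induction h xs rule: posvar.induct) auto

lemma posvar_Cons:
  "posvar h (x # xs) = posvar h xs + (if xs = [] then 0 else max 0 (h (hd xs) - h x))"
  by (cases xs) auto

lemma posvar_le_snoc: "posvar h xs \<le> posvar h (xs @ [y])"
  by (simp add: posvar_snoc)

lemma posvar_le_Cons: "posvar h xs \<le> posvar h (x # xs)"
  by (simp add: posvar_Cons)

text \<open>Reading a list backwards turns rises into falls; this transports statements about right
  limits to left limits.\<close>

lemma posvar_rev: "posvar h (rev xs) = negvar h xs"
proof (induction h xs rule: posvar.induct)
  case (1 h x y zs)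
  have "posvar h (rev (x # y # zs)) = posvar h (rev (y # zs)) + max 0 (h x - h y)"
    using posvar_snoc[of h "rev (y # zs)" x] by simp
  then show ?case using 1 by simp
qed auto

lemma tendsto_posvar:
  assumes "\<And>x. x \<in> set xs \<Longrightarrow> ((\<lambda>k. h k x) \<longlongrightarrow> h' x) F"
  shows "((\<lambda>k. posvar (h k) xs) \<longlongrightarrow> posvar h' xs) F"
  using assms
proof (induction h' xs rule: posvar.induct)
  case (1 h' x y zs)
  have "((\<lambda>k. posvar (h k) (y # zs)) \<longlongrightarrow> posvar h' (y # zs)) F"
    using 1 by auto
  moreover have "((\<lambda>k. h k x) \<longlongrightarrow> h' x) F" "((\<lambda>k. h k y) \<longlongrightarrow> h' y) F"
    using 1 by auto
  ultimately show ?case by (auto intro!: tendsto_intros)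
qed auto

lemma antimono_right_limit:
  fixes h :: "real \<Rightarrow> ereal"
  assumes anti: "\<And>s t. s \<in> S \<Longrightarrow> t \<in> S \<Longrightarrow> s \<le> t \<Longrightarrow> h t \<le> h s"
  shows "(h \<longlongrightarrow> (SUP t\<in>S \<inter> {x<..}. h t)) (at x within S \<inter> {x<..})"
proof (rule order_tendstoI)
  have inS: "eventually (\<lambda>y. y \<in> S \<inter> {x<..}) (at x within S \<inter> {x<..})"
    by (simp add: eventually_at_filter)
  fix l assume "l < (SUP t\<in>S \<inter> {x<..}. h t)"
  then obtain t where t: "t \<in> S" "x < t" "l < h t" by (auto simp: less_SUP_iff)
  have "eventually (\<lambda>y. y < t) (at x within S \<inter> {x<..})"
    by (rule order_tendstoD(2)[OF tendsto_ident_at t(2)])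
  with inS show "eventually (\<lambda>y. l < h y) (at x within S \<inter> {x<..})"
  proof eventually_elim
    case (elim y)
    then have "h t \<le> h y" using anti[of y t] t by auto
    then show ?case using t by auto
  qed
next
  have inS: "eventually (\<lambda>y. y \<in> S \<inter> {x<..}) (at x within S \<inter> {x<..})"
    by (simp add: eventually_at_filter)
  fix u assume u: "(SUP t\<in>S \<inter> {x<..}. h t) < u"
  from inS show "eventually (\<lambda>y. h y < u) (at x within S \<inter> {x<..})"
  proof eventually_elim
    case (elim y)
    then have "h y \<le> (SUP t\<in>S \<inter> {x<..}. h t)" by (intro SUP_upper) auto
    then show ?case using u by auto
  qed
qed

text \<open>With the upper variation \<open>P t\<close> over the part of \<open>S\<close> to the right of \<open>t\<close>, both \<open>P\<close> and
  \<open>f + P\<close> are decreasing.\<close>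

lemma posvar_right_limit:
  fixes f :: "real \<Rightarrow> real"
  assumes K: "\<And>xs. sorted xs \<Longrightarrow> set xs \<subseteq> S \<Longrightarrow> posvar f xs \<le> K"
  shows "\<exists>l. ((\<lambda>t. ereal (f t)) \<longlongrightarrow> l) (at x within S \<inter> {x<..})"
proof -
  define A where "A t = {xs. sorted xs \<and> set xs \<subseteq> S \<inter> {t..}}" for t
  define P where "P t = (SUP xs\<in>A t. posvar f xs)" for t
  have ne: "[] \<in> A t" for t by (auto simp: A_def)
  have bdd: "bdd_above (posvar f ` A t)" for t
    unfolding bdd_above_def by (rule exI[of _ K]) (use K in \<open>auto simp: A_def\<close>)
  have P_le: "P t \<le> K" for t
    unfolding P_def
  proof (rule cSUP_least)
    show "A t \<noteq> {}" using ne by blast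
  qed (use K in \<open>auto simp: A_def\<close>)
  have P_ge0: "0 \<le> P t" for t
    unfolding P_def using cSUP_upper[OF ne[of t] bdd[of t]] by simp
  \<comment> \<open>Prefixing \<open>s, t\<close> to a list to the right of \<open>t\<close> adds
    the rise from \<open>s\<close> to \<open>t\<close>. Dropping that rise shows that
    \<open>P\<close> decreases, keeping it that \<open>f + P\<close> does.\<close>
  have step: "P t + max 0 (f t - f s) \<le> P s" if "s \<in> S" "t \<in> S" "s \<le> t" for s t
  proof -
    have "posvar f xs \<le> P s - max 0 (f t - f s)" if "xs \<in> A t" for xs
    proof -
      have "s # t # xs \<in> A s"
        using that \<open>s \<in> S\<close> \<open>t \<in> S\<close> \<open>s \<le> t\<close> by (auto simp: A_def)
      then have "posvar f (s # t # xs) \<le> P s"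
        unfolding P_def by (intro cSUP_upper bdd)
      moreover have "posvar f xs \<le> posvar f (t # xs)" by (rule posvar_le_Cons)
      ultimately show ?thesis by simp
    qed
    then have "P t \<le> P s - max 0 (f t - f s)"
      unfolding P_def[of t] using ne by (intro cSUP_least) auto
    then show ?thesis by simp
  qed
  let ?F = "at x within S \<inter> {x<..}"
  have 1: "((\<lambda>t. ereal (P t)) \<longlongrightarrow> (SUP t\<in>S \<inter> {x<..}. ereal (P t))) ?F"
    by (rule antimono_right_limit) (use step in force)
  have 2: "((\<lambda>t. ereal (f t + P t)) \<longlongrightarrow> (SUP t\<in>S \<inter> {x<..}. ereal (f t + P t))) ?F"
    by (rule antimono_right_limit) (use step in force)
  show ?thesis
  proof (cases "S \<inter> {x<..} = {}")
    case True
    then have "?F = bot" by simp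
    then show ?thesis by (auto simp: tendsto_bot)
  next
    case False
    then obtain t0 where t0: "t0 \<in> S \<inter> {x<..}" by auto
    \<comment> \<open>Only the limit of \<open>P\<close> is known to be finite; that is enough to
      subtract it from the possibly infinite limit of \<open>f + P\<close>.\<close>
    have "(SUP t\<in>S \<inter> {x<..}. ereal (P t)) \<le> ereal K"
      using P_le by (intro SUP_least) auto
    moreover have "0 \<le> (SUP t\<in>S \<inter> {x<..}. ereal (P t))"
      by (rule order_trans[OF _ SUP_upper[OF t0]]) (use P_ge0 in auto)
    ultimately have fin: "\<bar>SUP t\<in>S \<inter> {x<..}. ereal (P t)\<bar> \<noteq> \<infinity>" by auto
    have "((\<lambda>t. ereal (f t + P t) - ereal (P t)) \<longlongrightarrow>
        (SUP t\<in>S \<inter> {x<..}. ereal (f t + P t)) - (SUP t\<in>S \<inter> {x<..}. ereal (P t))) ?F"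
      by (intro tendsto_diff_ereal_general 1 2) (use fin in auto)
    then show ?thesis by auto
  qed
qed

text \<open>A bound on either one-sided variation will do, since \<open>negvar f\<close> is the
  upper variation of \<open>- f\<close>. Left limits come from reflecting the line, which exchanges
  the two variations; the hypothesis is a disjunction so as to be stable under this
  exchange.\<close>

lemma bounded_variation_limits:
  fixes f :: "real \<Rightarrow> real"
  assumes K: "(\<forall>xs. sorted xs \<longrightarrow> set xs \<subseteq> S \<longrightarrow> posvar f xs \<le> K) \<or>
              (\<forall>xs. sorted xs \<longrightarrow> set xs \<subseteq> S \<longrightarrow> negvar f xs \<le> K)"
  shows "\<exists>l. ((\<lambda>t. ereal (f t)) \<longlongrightarrow> l) (at x within S \<inter> {x<..})"
    and "\<exists>l. ((\<lambda>t. ereal (f t)) \<longlongrightarrow> l) (at x within S \<inter> {..<x})"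
proof -
  have right: "\<exists>l. ((\<lambda>t. ereal (f t)) \<longlongrightarrow> l) (at x within S \<inter> {x<..})"
    if "(\<forall>xs. sorted xs \<longrightarrow> set xs \<subseteq> S \<longrightarrow> posvar f xs \<le> K) \<or>
        (\<forall>xs. sorted xs \<longrightarrow> set xs \<subseteq> S \<longrightarrow> negvar f xs \<le> K)" for f :: "real \<Rightarrow> real" and S x
    using that
  proof
    assume "\<forall>xs. sorted xs \<longrightarrow> set xs \<subseteq> S \<longrightarrow> posvar f xs \<le> K"
    then show ?thesis by (intro posvar_right_limit) auto
  next
    assume "\<forall>xs. sorted xs \<longrightarrow> set xs \<subseteq> S \<longrightarrow> negvar f xs \<le> K"
    then have "\<exists>l. ((\<lambda>t. ereal (- f t)) \<longlongrightarrow> l) (at x within S \<inter> {x<..})"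
      by (intro posvar_right_limit) auto
    then obtain l where "((\<lambda>t. ereal (- f t)) \<longlongrightarrow> l) (at x within S \<inter> {x<..})" ..
    then have "((\<lambda>t. - ereal (- f t)) \<longlongrightarrow> - l) (at x within S \<inter> {x<..})"
      by (intro tendsto_uminus_ereal)
    then show ?thesis by auto
  qed
  show "\<exists>l. ((\<lambda>t. ereal (f t)) \<longlongrightarrow> l) (at x within S \<inter> {x<..})"
    by (rule right[OF K])
  define g where "g t = f (- t)" for t
  have g: "posvar g xs = negvar f (rev (map uminus xs))" for xs
    by (simp add: posvar_rev posvar_map g_def[abs_def])
  have g': "negvar g xs = posvar f (rev (map uminus xs))" for xs
    by (simp add: posvar_rev posvar_map g_def[abs_def])
  have srt: "sorted (rev (map uminus xs))" if "sorted xs" for xs :: "real list"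
    using that by (induction xs) (auto simp: sorted_append)
  have "\<exists>l. ((\<lambda>t. ereal (g t)) \<longlongrightarrow> l) (at (-x) within uminus ` S \<inter> {-x<..})"
  proof (rule right)
    have "set (rev (map uminus xs)) \<subseteq> S" if "set xs \<subseteq> uminus ` S" for xs
      using that by (auto simp: image_iff)
    then show "(\<forall>xs. sorted xs \<longrightarrow> set xs \<subseteq> uminus ` S \<longrightarrow> posvar g xs \<le> K) \<or>
        (\<forall>xs. sorted xs \<longrightarrow> set xs \<subseteq> uminus ` S \<longrightarrow> negvar g xs \<le> K)"
      unfolding g g' using K srt by metis
  qed
  then obtain l where l: "((\<lambda>t. ereal (g t)) \<longlongrightarrow> l) (at (-x) within uminus ` S \<inter> {-x<..})" ..
  have "filterlim uminus (at (-x) within uminus ` S \<inter> {-x<..}) (at x within S \<inter> {..<x})"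
    unfolding filterlim_at by (auto simp: eventually_at_filter intro!: tendsto_eq_intros)
  from filterlim_compose[OF l this]
  show "\<exists>l. ((\<lambda>t. ereal (f t)) \<longlongrightarrow> l) (at x within S \<inter> {..<x})"
    by (auto simp: g_def)
qed

lemma real_limit_of_ereal:
  fixes f :: "real \<Rightarrow> real"
  assumes l: "((\<lambda>t. ereal (f t)) \<longlongrightarrow> l) F" and b: "eventually (\<lambda>t. \<bar>f t\<bar> \<le> K) F"
  shows "\<exists>r. (f \<longlongrightarrow> r) F"
proof (cases "F = bot")
  case False
  have "l \<le> ereal K"
    by (rule tendsto_upperbound[OF l _ False]) (use b in \<open>auto elim!: eventually_mono\<close>)
  moreover have "ereal (- K) \<le> l"
    by (rule tendsto_lowerbound[OF l _ False]) (use b in \<open>auto elim!: eventually_mono\<close>)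
  ultimately obtain r where "l = ereal r" by (cases l) auto
  then show ?thesis using l by auto
qed (auto simp: tendsto_bot)

lemma ennreal_limit_of_ereal:
  "((\<lambda>t. ereal (f t)) \<longlongrightarrow> l) F \<Longrightarrow> \<exists>l. ((\<lambda>t. ennreal (f t)) \<longlongrightarrow> l) F"
  using tendsto_e2ennrealI[of "\<lambda>t. ereal (f t)" l F] by (auto simp: ennreal.abs_eq[symmetric] e2ennreal_ereal)

lemma sum_eq_posvar:
  "(\<Sum>i = 1..<n. max (f (s (i + 1)) - f (s i)) 0) = posvar f (map s [1..<n + 1])"
proof (induction n)
  case (Suc n)
  show ?case
  proof (cases "n = 0")
    case False
    then have 1: "map s [1..<Suc n + 1] = map s [1..<n + 1] @ [s (n + 1)]"
      and 2: "last (map s [1..<n + 1]) = s n" and 3: "map s [1..<n + 1] \<noteq> []"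
      by (simp_all add: last_map)
    have "{1..<Suc n} = insert n {1..<n}" using False by auto
    then have "(\<Sum>i = 1..<Suc n. max (f (s (i + 1)) - f (s i)) 0) =
        posvar f (map s [1..<n + 1]) + max (f (s (n + 1)) - f (s n)) 0"
      using Suc by simp
    then show ?thesis unfolding 1 posvar_snoc 2 using 3 by (simp only: if_False max.commute)
  qed simp
qed simp

text \<open>\<open>\<Phi>\<close> is the list functional that belongs to the summand
  \<open>\<phi>\<close>; one reduction to sorted lists serves all three variations.\<close>

lemma variation_le:
  assumes "\<And>xs. sorted xs \<Longrightarrow> xs \<noteq> [] \<Longrightarrow> set xs \<subseteq> {u<..<v} \<Longrightarrow> ennreal (\<Phi> xs) \<le> C"
    and "\<And>n s. (\<Sum>i = 1..<n. \<phi> (f (s (i + 1)) - f (s i))) = \<Phi> (map s [1..<n + 1])"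
    and "\<Phi> [] = 0"
  shows "variation \<phi> f u v \<le> C"
  unfolding variation_def
proof (rule SUP_least, clarify)
  fix n :: nat and s :: "nat \<Rightarrow> real"
  assume s: "strict_mono_on {1..n} s" "s ` {1..n} \<subseteq> {u<..<v}"
  show "ennreal (\<Sum>i = 1..<n. \<phi> (f (s (i + 1)) - f (s i))) \<le> C"
  proof (cases "n = 0")
    case False
    have "sorted (map s [1..<n + 1])"
      unfolding sorted_map
      by (rule sorted_wrt_mono_rel[OF _ sorted_wrt_upt])
        (use s(1) in \<open>auto simp: monotone_on_def intro: less_imp_le\<close>)
    moreover have "set (map s [1..<n + 1]) \<subseteq> {u<..<v}"
      using s(2) by auto
    moreover have "map s [1..<n + 1] \<noteq> []" using False by simp
    ultimately show ?thesis unfolding assms(2) by (intro assms(1))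
  qed (use assms(2)[where n = 0] assms(3) in simp)
qed

lemma TV_pos_le:
  assumes "\<And>xs. sorted xs \<Longrightarrow> xs \<noteq> [] \<Longrightarrow> set xs \<subseteq> {u<..<v} \<Longrightarrow> ennreal (posvar f xs) \<le> C"
  shows "TV_pos f u v \<le> C"
  unfolding TV_pos_def by (rule variation_le[OF assms sum_eq_posvar]) auto

lemma sum_eq_negvar:
  "(\<Sum>i = 1..<n. max (- (f (s (i + 1)) - f (s i))) 0) = negvar f (map s [1..<n + 1])"
  using sum_eq_posvar[of "\<lambda>x. - f x" s n] by (simp add: algebra_simps)

lemma TV_neg_le:
  assumes "\<And>xs. sorted xs \<Longrightarrow> xs \<noteq> [] \<Longrightarrow> set xs \<subseteq> {u<..<v} \<Longrightarrow> ennreal (negvar f xs) \<le> C"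
  shows "TV_neg f u v \<le> C"
  unfolding TV_neg_def by (rule variation_le[OF assms sum_eq_negvar]) auto

lemma TV_le:
  assumes "\<And>xs. sorted xs \<Longrightarrow> xs \<noteq> [] \<Longrightarrow> set xs \<subseteq> {u<..<v} \<Longrightarrow>
    ennreal (posvar f xs + negvar f xs) \<le> C"
  shows "TV f u v \<le> C"
  unfolding TV_def
proof (rule variation_le[OF assms])
  fix n :: nat and s
  have *: "\<bar>x\<bar> = max x 0 + max (- x) 0" for x :: real by auto
  show "(\<Sum>i = 1..<n. \<bar>f (s (i + 1)) - f (s i)\<bar>) =
      posvar f (map s [1..<n + 1]) + negvar f (map s [1..<n + 1])"
    unfolding * sum.distrib sum_eq_posvar sum_eq_negvar ..
qed auto

lemma abs_diff_le_TV:
  assumes "u < x" "x < y" "y < v"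
  shows "ennreal \<bar>f y - f x\<bar> \<le> TV f u v"
proof -
  let ?s = "\<lambda>i::nat. if i = 1 then x else y"
  have "(2, ?s) \<in> {(n :: nat, s). strict_mono_on {1..n} s \<and> s ` {1..n} \<subseteq> {u<..<v}}"
    using assms by (auto simp: monotone_on_def)
  from SUP_upper[OF this, of "\<lambda>(n, s). ennreal (\<Sum>i = 1..<n. \<bar>f (s (i + 1)) - f (s i)\<bar>)"]
  show ?thesis by (simp add: TV_def variation_def numeral_2_eq_2)
qed

section \<open>One-sided variation bounds and the constraints\<close>

text \<open>The inequalities \<open>pos\<close> and \<open>neg\<close> are the form in which
  variation bounds survive limits, and all the constraints follow from them. A list may be enlarged
  by a point, so the rises before \<open>t\<close> and the falls after \<open>t\<close> are each at
  most \<open>f t\<close>.\<close>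

locale one_sided_variation =
  fixes f :: "real \<Rightarrow> real" and a b :: real
  assumes ab: "a < b"
    and nonneg: "\<And>t. a < t \<Longrightarrow> t < b \<Longrightarrow> 0 \<le> f t"
    and rcont: "\<And>t. a < t \<Longrightarrow> t < b \<Longrightarrow> continuous (at_right t) f"
    and pos: "\<And>xs. sorted xs \<Longrightarrow> xs \<noteq> [] \<Longrightarrow> set xs \<subseteq> {a<..<b} \<Longrightarrow> posvar f xs \<le> f (last xs)"
    and neg: "\<And>xs. sorted xs \<Longrightarrow> xs \<noteq> [] \<Longrightarrow> set xs \<subseteq> {a<..<b} \<Longrightarrow> negvar f xs \<le> f (hd xs)"
begin

lemma pos_le: "posvar f xs \<le> f t" if "sorted xs" "set xs \<subseteq> {a<..t}" "a < t" "t < b"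
proof -
  have "posvar f (xs @ [t]) \<le> f (last (xs @ [t]))"
    by (rule pos) (use that in \<open>auto simp: sorted_append dest!: subsetD\<close>)
  then show ?thesis using posvar_le_snoc[of f xs t] by simp
qed

lemma neg_le: "negvar f xs \<le> f t" if "sorted xs" "set xs \<subseteq> {t..<b}" "a < t" "t < b"
proof -
  have "negvar f (t # xs) \<le> f (hd (t # xs))"
    by (rule neg) (use that in \<open>auto dest!: subsetD\<close>)
  then show ?thesis using posvar_le_Cons[of "\<lambda>x. - f x" xs t] by simp
qed

lemma bounded_inside: "f x \<le> f s + f t" if "a < s" "s \<le> x" "x \<le> t" "t < b"
  using pos_le[of "[s, x]" t] that nonneg[of t] by auto

lemma left_limit: "\<exists>l. (f \<longlongrightarrow> l) (at_left t)" if "a < t" "t < b"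
proof -
  obtain c where c: "a < c" "c < t" using dense[OF \<open>a < t\<close>] by blast
  have "\<exists>l. ((\<lambda>t. ereal (f t)) \<longlongrightarrow> l) (at t within {c<..<t} \<inter> {..<t})"
  proof (rule bounded_variation_limits(2))
    have "posvar f xs \<le> f t" if "sorted xs" "set xs \<subseteq> {c<..<t}" for xs
    proof (rule pos_le[OF that(1)])
      show "set xs \<subseteq> {a<..t}" using c by (intro order.trans[OF that(2)]) auto
    qed fact+
    then show "(\<forall>xs. sorted xs \<longrightarrow> set xs \<subseteq> {c<..<t} \<longrightarrow> posvar f xs \<le> f t) \<or>
      (\<forall>xs. sorted xs \<longrightarrow> set xs \<subseteq> {c<..<t} \<longrightarrow> negvar f xs \<le> f t)" by blast
  qed
  moreover have eq: "at t within {c<..<t} \<inter> {..<t} = at_left t"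
    by (rule at_within_nhd[of _ "{c<..}"]) (use c in auto)
  ultimately obtain l where l: "((\<lambda>t. ereal (f t)) \<longlongrightarrow> l) (at_left t)" unfolding eq by blast
  have "eventually (\<lambda>x. x \<in> {c<..<t}) (at_left t)"
    using c by (intro eventually_at_leftI[of "c"]) auto
  then have "eventually (\<lambda>x. \<bar>f x\<bar> \<le> f c + f t) (at_left t)"
  proof eventually_elim
    case (elim x)
    then show ?case using bounded_inside[of c x t] nonneg[of x] c that by auto
  qed
  with l show ?thesis by (rule real_limit_of_ereal)
qed

text \<open>Before a fixed point \<open>c\<close> the rises are bounded, after it the falls. Either
  bound is enough for a limit, which may be infinite and is therefore taken in
  \<open>ennreal\<close>.\<close>

lemma endpoint_limits:
  shows "\<exists>l. ((\<lambda>t. ennreal (f t)) \<longlongrightarrow> l) (at_right a)"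
    and "\<exists>l. ((\<lambda>t. ennreal (f t)) \<longlongrightarrow> l) (at_left b)"
proof -
  obtain c where c: "a < c" "c < b" using dense[OF ab] by blast
  have "\<exists>l. ((\<lambda>t. ereal (f t)) \<longlongrightarrow> l) (at a within {a<..<c} \<inter> {a<..})"
  proof (rule bounded_variation_limits(1))
    have "posvar f xs \<le> f c" if "sorted xs" "set xs \<subseteq> {a<..<c}" for xs
    proof (rule pos_le[OF that(1)])
      show "set xs \<subseteq> {a<..c}" by (intro order.trans[OF that(2)]) auto
    qed fact+
    then show "(\<forall>xs. sorted xs \<longrightarrow> set xs \<subseteq> {a<..<c} \<longrightarrow> posvar f xs \<le> f c) \<or>
      (\<forall>xs. sorted xs \<longrightarrow> set xs \<subseteq> {a<..<c} \<longrightarrow> negvar f xs \<le> f c)" by blast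
  qed
  moreover have eq: "at a within {a<..<c} \<inter> {a<..} = at_right a"
    by (rule at_within_nhd[of _ "{..<c}"]) (use c in auto)
  ultimately show "\<exists>l. ((\<lambda>t. ennreal (f t)) \<longlongrightarrow> l) (at_right a)"
    unfolding eq using ennreal_limit_of_ereal by blast
  have "\<exists>l. ((\<lambda>t. ereal (f t)) \<longlongrightarrow> l) (at b within {c<..<b} \<inter> {..<b})"
  proof (rule bounded_variation_limits(2))
    have "negvar f xs \<le> f c" if "sorted xs" "set xs \<subseteq> {c<..<b}" for xs
    proof (rule neg_le[OF that(1)])
      show "set xs \<subseteq> {c..<b}" by (intro order.trans[OF that(2)]) auto
    qed fact+
    then show "(\<forall>xs. sorted xs \<longrightarrow> set xs \<subseteq> {c<..<b} \<longrightarrow> posvar f xs \<le> f c) \<or>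
      (\<forall>xs. sorted xs \<longrightarrow> set xs \<subseteq> {c<..<b} \<longrightarrow> negvar f xs \<le> f c)" by blast
  qed
  moreover have eq: "at b within {c<..<b} \<inter> {..<b} = at_left b"
    by (rule at_within_nhd[of _ "{c<..}"]) (use c in auto)
  ultimately show "\<exists>l. ((\<lambda>t. ennreal (f t)) \<longlongrightarrow> l) (at_left b)"
    unfolding eq using ennreal_limit_of_ereal by blast
qed

lemma regular: "regular_density f a b"
  unfolding regular_density_def using nonneg rcont left_limit endpoint_limits by auto

lemma Lim_left: "(f \<longlongrightarrow> Lim (at_left t) f) (at_left t)" if "a < t" "t < b"
  using left_limit[OF that] tendsto_Lim[of "at_left t" f] by auto

text \<open>A finite list strictly to the left of \<open>t\<close> leaves room before
  \<open>t\<close>; the bound by \<open>f x\<close> holds for all \<open>x\<close> in that room and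
  passes to the left limit.\<close>

lemma pos_le_min_left:
  assumes "sorted xs" "set xs \<subseteq> {a<..<t}" "a < t" "t < b"
  shows "ennreal (posvar f xs) \<le> min_left f t"
proof -
  have 1: "posvar f xs \<le> f t" by (rule pos_le) (use assms in auto)
  \<comment> \<open>Inserting \<open>a\<close> keeps the maximum defined for the empty list.\<close>
  define m where "m = Max (insert a (set xs))"
  have m: "a \<le> m" "m < t" "\<And>x. x \<in> set xs \<Longrightarrow> x \<le> m"
    using assms by (auto simp: m_def)
  have "posvar f xs \<le> Lim (at_left t) f"
  proof (rule tendsto_lowerbound[OF Lim_left])
    have "eventually (\<lambda>x. x \<in> {m<..<t}) (at_left t)"
      using m by (intro eventually_at_leftI[of "m"]) auto
    then show "eventually (\<lambda>x. posvar f xs \<le> f x) (at_left t)"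
    proof eventually_elim
      case (elim x)
      have "set xs \<subseteq> {a<..x}"
      proof
        fix y assume "y \<in> set xs"
        then show "y \<in> {a<..x}" using m(3)[of y] elim assms(2) by auto
      qed
      then show ?case by (rule pos_le[OF assms(1)]) (use elim assms m(1) in auto)
    qed
  qed (use assms in auto)
  with 1 show ?thesis unfolding min_left_def by (intro ennreal_leI) auto
qed

lemma neg_le_min_left:
  assumes "sorted xs" "set xs \<subseteq> {t<..<b}" "a < t" "t < b"
  shows "ennreal (negvar f xs) \<le> min_left f t"
proof -
  have 1: "negvar f xs \<le> f t" by (rule neg_le) (use assms in auto)
  have "negvar f xs \<le> Lim (at_left t) f"
  proof (rule tendsto_lowerbound[OF Lim_left])
    have "eventually (\<lambda>x. x \<in> {a<..<t}) (at_left t)"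
      using assms by (intro eventually_at_leftI[of "a"]) auto
    then show "eventually (\<lambda>x. negvar f xs \<le> f x) (at_left t)"
    proof eventually_elim
      case (elim x)
      have "set xs \<subseteq> {x..<b}"
      proof
        fix y assume "y \<in> set xs"
        then show "y \<in> {x..<b}" using elim assms(2) by auto
      qed
      then show ?case by (rule neg_le[OF assms(1)]) (use elim assms in auto)
    qed
  qed (use assms in auto)
  with 1 show ?thesis unfolding min_left_def by (intro ennreal_leI) auto
qed

text \<open>Oscillation bounded relative to a fixed point \<open>c\<close> keeps \<open>f\<close>
  bounded along \<open>F\<close>. This is the direction from finite variation to a finite endpoint
  value.\<close>

lemma TV_finite_imp:
  assumes l: "((\<lambda>t. ennreal (f t)) \<longlongrightarrow> l) F" "F \<noteq> bot"
    and ev: "eventually (\<lambda>x. ennreal \<bar>f x - f c\<bar> \<le> C) F" and "C < \<infinity>" "a < c" "c < b"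
  shows "l < \<infinity>"
proof -
  have "l \<le> ennreal (f c) + C"
  proof (rule tendsto_upperbound[OF l(1) _ l(2)])
    from ev show "eventually (\<lambda>x. ennreal (f x) \<le> ennreal (f c) + C) F"
    proof eventually_elim
      case (elim x)
      have "ennreal (f x) \<le> ennreal (f c + \<bar>f x - f c\<bar>)" by (intro ennreal_leI) auto
      also have "\<dots> = ennreal (f c) + ennreal \<bar>f x - f c\<bar>"
        using nonneg assms by (intro ennreal_plus) auto
      also have "\<dots> \<le> ennreal (f c) + C" using elim by (intro add_mono) auto
      finally show ?case .
    qed
  qed
  also have "\<dots> < \<infinity>" using assms by (simp add: ennreal_add_less_top)
  finally show ?thesis .
qed

lemma constraints: "TV_constraints f a b"
proof -
  define fa where "fa = Lim (at_right a) (\<lambda>t. ennreal (f t))"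
  define fb where "fb = Lim (at_left b) (\<lambda>t. ennreal (f t))"
  have la: "((\<lambda>t. ennreal (f t)) \<longlongrightarrow> fa) (at_right a)"
    using endpoint_limits(1) tendsto_Lim[of "at_right a" "\<lambda>t. ennreal (f t)"] by (auto simp: fa_def)
  have lb: "((\<lambda>t. ennreal (f t)) \<longlongrightarrow> fb) (at_left b)"
    using endpoint_limits(2) tendsto_Lim[of "at_left b" "\<lambda>t. ennreal (f t)"] by (auto simp: fb_def)
  let ?E = "{0<..<b - a}"
  \<comment> \<open>The rises are bounded at the right end by \<open>pos_le_min_left\<close>. The
    falls are bounded by \<open>f x\<close> for every \<open>x\<close> between \<open>a\<close> and
    the first entry, hence by the limit at \<open>a\<close>.\<close>
  have TVa: "TV f a (a + e) \<le> fa + min_left f (a + e)" if e: "e \<in> ?E" for e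
  proof (rule TV_le)
    fix xs assume xs: "sorted xs" "xs \<noteq> []" "set xs \<subseteq> {a<..<a + e}"
    have "ennreal (negvar f xs) \<le> fa"
    proof (rule tendsto_lowerbound[OF la])
      have hd: "a < hd xs" using xs by (cases xs) auto
      have "eventually (\<lambda>x. x \<in> {a<..<hd xs}) (at_right a)"
        using hd by (intro eventually_at_rightI[of _ "hd xs"]) auto
      then show "eventually (\<lambda>x. ennreal (negvar f xs) \<le> ennreal (f x)) (at_right a)"
      proof eventually_elim
        case (elim x)
        have "set xs \<subseteq> {x..<b}"
        proof
          fix y assume y: "y \<in> set xs"
          then have "hd xs \<le> y" using xs(1) by (cases xs) auto
          moreover have "y < a + e" using xs(3) y by auto
          ultimately show "y \<in> {x..<b}" using elim e by auto
        qed
        moreover have "hd xs < a + e" using subsetD[OF xs(3) hd_in_set[OF xs(2)]] by auto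
        ultimately show ?case using elim xs(1) e by (intro ennreal_leI neg_le) auto
      qed
    qed auto
    moreover have "ennreal (posvar f xs) \<le> min_left f (a + e)"
      by (rule pos_le_min_left) (use xs e in auto)
    ultimately have "ennreal (negvar f xs) + ennreal (posvar f xs) \<le> fa + min_left f (a + e)"
      by (rule add_mono)
    then show "ennreal (posvar f xs + negvar f xs) \<le> fa + min_left f (a + e)"
      by (simp add: add.commute)
  qed
  have TVb: "TV f (b - e) b \<le> min_left f (b - e) + fb" if e: "e \<in> ?E" for e
  proof (rule TV_le)
    fix xs assume xs: "sorted xs" "xs \<noteq> []" "set xs \<subseteq> {b - e<..<b}"
    have "ennreal (posvar f xs) \<le> fb"
    proof (rule tendsto_lowerbound[OF lb])
      define m where "m = Max (set xs)"
      have "m \<in> {b - e<..<b}"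
        using xs(2) subsetD[OF xs(3) Max_in] by (simp add: m_def)
      then have m: "m < b" "a < m" "\<And>x. x \<in> set xs \<Longrightarrow> x \<le> m"
        using e by (auto simp: m_def)
      have "eventually (\<lambda>x. x \<in> {m<..<b}) (at_left b)"
        using m by (intro eventually_at_leftI[of "m"]) auto
      then show "eventually (\<lambda>x. ennreal (posvar f xs) \<le> ennreal (f x)) (at_left b)"
      proof eventually_elim
        case (elim x)
        have "set xs \<subseteq> {a<..x}"
        proof
          fix y assume y: "y \<in> set xs"
          then have "b - e < y" using xs(3) by auto
          then show "y \<in> {a<..x}" using m(3)[OF y] elim e by auto
        qed
        then show ?case using elim m(2) xs(1) by (intro ennreal_leI pos_le) auto
      qed
    qed auto
    moreover have "ennreal (negvar f xs) \<le> min_left f (b - e)"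
      by (rule neg_le_min_left) (use xs e in auto)
    ultimately have "ennreal (negvar f xs) + ennreal (posvar f xs) \<le> min_left f (b - e) + fb"
      by (intro add_mono)
    then show "ennreal (posvar f xs + negvar f xs) \<le> min_left f (b - e) + fb"
      by (simp add: add.commute)
  qed
  have TVa_fin: "fa < \<infinity> \<Longrightarrow> e \<in> ?E \<Longrightarrow> TV f a (a + e) < \<infinity>" for e
    by (rule le_less_trans[OF TVa]) (auto simp: min_left_def ennreal_add_less_top)
  have TVb_fin: "fb < \<infinity> \<Longrightarrow> e \<in> ?E \<Longrightarrow> TV f (b - e) b < \<infinity>" for e
    by (rule le_less_trans[OF TVb]) (auto simp: min_left_def ennreal_add_less_top)
  have fa_fin: "fa < \<infinity>" if e: "e \<in> ?E" "TV f a (a + e) < \<infinity>" for e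
  proof (rule TV_finite_imp[OF la _ _ e(2)])
    have "eventually (\<lambda>x. x \<in> {a<..<a + e / 2}) (at_right a)"
      using e by (intro eventually_at_rightI[of _ "a + e / 2"]) auto
    then show "eventually (\<lambda>x. ennreal \<bar>f x - f (a + e / 2)\<bar> \<le> TV f a (a + e)) (at_right a)"
    proof eventually_elim
      case (elim x)
      then show ?case using abs_diff_le_TV[of a x "a + e / 2" "a + e" f] e
        by (simp add: abs_minus_commute)
    qed
  qed (use e in auto)
  have fb_fin: "fb < \<infinity>" if e: "e \<in> ?E" "TV f (b - e) b < \<infinity>" for e
  proof (rule TV_finite_imp[OF lb _ _ e(2)])
    have "eventually (\<lambda>x. x \<in> {b - e / 2<..<b}) (at_left b)"
      using e by (intro eventually_at_leftI[of "b - e / 2"]) auto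
    then show "eventually (\<lambda>x. ennreal \<bar>f x - f (b - e / 2)\<bar> \<le> TV f (b - e) b) (at_left b)"
    proof eventually_elim
      case (elim x)
      then show ?case using abs_diff_le_TV[of "b - e" "b - e / 2" x b f] e by simp
    qed
  qed (use e in auto)
  have E: "(b - a) / 2 \<in> ?E" using ab by auto
  have "TV f t1 t2 \<le> min_left f t1 + min_left f t2" if t: "a < t1" "t1 < t2" "t2 < b" for t1 t2
  proof (rule TV_le)
    fix xs assume xs: "sorted xs" "xs \<noteq> []" "set xs \<subseteq> {t1<..<t2}"
    have "set xs \<subseteq> {t1<..<b}" "set xs \<subseteq> {a<..<t2}"
      using t by (auto intro!: order.trans[OF xs(3)])
    then have "ennreal (negvar f xs) + ennreal (posvar f xs) \<le> min_left f t1 + min_left f t2"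
      using xs(1) t by (intro add_mono pos_le_min_left neg_le_min_left) auto
    then show "ennreal (posvar f xs + negvar f xs) \<le> min_left f t1 + min_left f t2"
      by (simp add: add.commute)
  qed
  moreover have "TV_pos f a (a + e) \<le> min_left f (a + e)" if "e \<in> ?E" for e
    by (intro TV_pos_le pos_le_min_left) (use that in auto)
  moreover have "TV_neg f (b - e) b \<le> min_left f (b - e)" if "e \<in> ?E" for e
    by (intro TV_neg_le neg_le_min_left) (use that in auto)
  moreover note TVa TVb TVa_fin TVb_fin fa_fin fb_fin
  ultimately show ?thesis
    unfolding TV_constraints_def Let_def fa_def[symmetric] fb_def[symmetric] using E by blast
qed

end

subsection \<open>Densities from window probabilities\<close>

text \<open>These properties are all that the construction of the density uses of a location. In
  \<open>split\<close>, cutting the window leaves each piece with the other one added to one of its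
  margins.\<close>

locale window =
  fixes q :: "real \<Rightarrow> real \<Rightarrow> real \<Rightarrow> real"
  assumes q_nonneg: "\<And>l r w. 0 \<le> l \<Longrightarrow> 0 \<le> r \<Longrightarrow> 0 < w \<Longrightarrow> 0 \<le> q l r w"
    and q_le_1: "\<And>l r w. 0 \<le> l \<Longrightarrow> 0 \<le> r \<Longrightarrow> 0 < w \<Longrightarrow> q l r w \<le> 1"
    and split: "\<And>l r w d. 0 \<le> l \<Longrightarrow> 0 \<le> r \<Longrightarrow> 0 < w \<Longrightarrow> 0 < d \<Longrightarrow>
      q l r (w + d) = q l (r + d) w + q (l + w) r d"
    and anti: "\<And>l l' r r' w. 0 \<le> l \<Longrightarrow> l \<le> l' \<Longrightarrow> 0 \<le> r \<Longrightarrow> r \<le> r' \<Longrightarrow> 0 < w \<Longrightarrow> q l' r' w \<le> q l r w"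
    and width: "\<And>l r w w'. 0 \<le> l \<Longrightarrow> 0 \<le> r \<Longrightarrow> 0 < w \<Longrightarrow> w \<le> w' \<Longrightarrow> q l r w \<le> q l r w'"
begin

text \<open>Iterates \<open>split\<close>: cell \<open>k\<close> of \<open>n + 1\<close> cells has
  \<open>k\<close> cells on its left and \<open>n - k\<close> on its right.\<close>

lemma sum_cells:
  assumes "0 \<le> l" "0 \<le> r" "0 < e"
  shows "(\<Sum>k<Suc n. q (l + real k * e) (r + (real n - real k) * e) e) = q l r (real (Suc n) * e)"
  using assms
proof (induction n arbitrary: r)
  case (Suc n)
  have "(\<Sum>k<Suc (Suc n). q (l + real k * e) (r + (real (Suc n) - real k) * e) e) =
      (\<Sum>k<Suc n. q (l + real k * e) ((r + e) + (real n - real k) * e) e) + q (l + real (Suc n) * e) r e"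
    by (simp add: algebra_simps)
  also have "\<dots> = q l (r + e) (real (Suc n) * e) + q (l + real (Suc n) * e) r e"
    using Suc.IH[of "r + e"] Suc.prems by simp
  also have "\<dots> = q l r (real (Suc n) * e + e)"
    using Suc.prems by (intro split[symmetric]) auto
  finally show ?case by (simp add: algebra_simps)
qed simp

text \<open>Pigeonhole: with \<open>m = min l r\<close>, about \<open>m / w\<close> disjoint
  translates of the window can be placed so that no margins exceed \<open>l\<close> and
  \<open>r\<close>. Each has at least the mass \<open>q l r w\<close>, and together they have at
  most 1.\<close>

lemma q_le:
  assumes "0 < l" "0 < r" "0 < w"
  shows "q l r w \<le> 2 * w / min l r"
proof -
  define m where "m = min l r"
  have m: "0 < m" "m \<le> l" "m \<le> r" using assms by (auto simp: m_def)
  show ?thesis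
  proof (cases "m < w")
    case True
    then have "1 \<le> 2 * w / m" using m by (simp add: field_simps)
    then show ?thesis using q_le_1[of l r w] assms unfolding m_def by linarith
  next
    case False
    \<comment> \<open>\<open>Suc n\<close> is the integer part of \<open>m / w\<close>. It is at
      least 1, so rounding costs at most the factor 2 in the bound.\<close>
    define n where "n = nat \<lfloor>m / w\<rfloor> - 1"
    have fl: "1 \<le> \<lfloor>m / w\<rfloor>" using False assms by (simp add: le_floor_iff)
    then have n: "real (Suc n) = of_int \<lfloor>m / w\<rfloor>" by (simp add: n_def)
    have "real (Suc n) \<le> m / w" unfolding n by (rule of_int_floor_le)
    then have nw: "real (Suc n) * w \<le> m" using assms by (simp add: field_simps)
    have "m / w < real (Suc n) + 1" unfolding n by linarith
    then have "m / w \<le> 2 * real (Suc n)" by simp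
    then have nw2: "m \<le> 2 * real (Suc n) * w" using assms by (simp add: field_simps)
    let ?l = "l - real n * w" and ?r = "r - real n * w"
    have pos: "0 \<le> ?l" "0 \<le> ?r" using nw m assms by (auto simp: algebra_simps)
    have "real (Suc n) * q l r w = (\<Sum>k<Suc n. q l r w)" by simp
    also have "\<dots> \<le> (\<Sum>k<Suc n. q (?l + real k * w) (?r + (real n - real k) * w) w)"
    proof (intro sum_mono anti)
      fix k assume "k \<in> {..<Suc n}"
      then have k: "real k \<le> real n" by auto
      then show "?l + real k * w \<le> l" using assms mult_right_mono[OF k, of w] by simp
      show "0 \<le> ?l + real k * w" using pos assms by auto
      show "?r + (real n - real k) * w \<le> r" using assms by (auto simp: algebra_simps)
      show "0 \<le> ?r + (real n - real k) * w" using pos assms k by auto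
    qed (use assms in auto)
    also have "\<dots> = q ?l ?r (real (Suc n) * w)" by (rule sum_cells[OF pos]) (use assms in auto)
    also have "\<dots> \<le> 1" by (rule q_le_1[OF pos]) (use assms in auto)
    finally have "real (Suc n) * q l r w \<le> 1" .
    then have "q l r w \<le> 1 / real (Suc n)" by (simp add: field_simps)
    also have "\<dots> \<le> 2 * w / m" using nw2 m by (simp add: field_simps)
    finally show ?thesis by (simp add: m_def)
  qed
qed

text \<open>Lengthening the right margin by \<open>e n\<close> costs at most the mass of an adjacent
  window of that width, which \<open>q_le\<close> bounds linearly. Needed because sums of quotients
  reproduce a window whose right margin is one cell too long.\<close>

lemma q_right_tendsto:
  assumes "0 \<le> l" "0 < r" "0 < w" and e: "\<And>n. 0 < e n" "e \<longlonglongrightarrow> 0"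
  shows "(\<lambda>n. q l (r + e n) w) \<longlonglongrightarrow> q l r w"
proof -
  let ?m = "min (l + w) r"
  have 1: "\<bar>q l (r + e n) w - q l r w\<bar> \<le> 2 / ?m * e n" for n
  proof -
    have "q l r w \<le> q l r (w + e n)" by (rule width) (use assms(1-3) less_imp_le[OF e(1)[of n]] in auto)
    also have "\<dots> = q l (r + e n) w + q (l + w) r (e n)"
      by (rule split) (use assms e(1)[of n] in auto)
    finally have "q l r w - q l (r + e n) w \<le> q (l + w) r (e n)" by simp
    also have "\<dots> \<le> 2 * e n / ?m" by (rule q_le) (use assms e(1)[of n] in auto)
    finally have "q l r w - q l (r + e n) w \<le> 2 / ?m * e n" by simp
    moreover have "q l (r + e n) w \<le> q l r w"
      by (rule anti) (use assms(1-3) less_imp_le[OF e(1)[of n]] in auto)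
    ultimately show ?thesis by simp
  qed
  have 2: "(\<lambda>n. 2 / ?m * e n) \<longlonglongrightarrow> 0" using tendsto_mult_right_zero[OF e(2)] .
  have "(\<lambda>n. q l (r + e n) w - q l r w) \<longlonglongrightarrow> 0"
    by (rule Lim_null_comparison[OF _ 2]) (use 1 in \<open>simp add: always_eventually\<close>)
  then show ?thesis by (simp add: LIM_zero_iff)
qed

end

section \<open>Dyadic grids\<close>

definition mesh :: "nat \<Rightarrow> real" where "mesh n = 1 / 2 ^ n"

definition dyadics :: "real set" where "dyadics = {of_int k * mesh n | k n. True}"

lemma mesh_pos [simp]: "0 < mesh n" by (simp add: mesh_def)

lemma mesh_nonneg [simp]: "0 \<le> mesh n" by (simp add: mesh_def)

lemma mesh_nonzero [simp]: "mesh n \<noteq> 0" by (simp add: mesh_def)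

lemma mesh_tendsto_0: "mesh \<longlonglongrightarrow> 0"
  unfolding mesh_def by real_asymp

lemma mesh_split: "m \<le> n \<Longrightarrow> mesh m = 2 ^ (n - m) * mesh n"
  by (simp add: mesh_def power_diff)

lemma mesh_refine: "m \<le> n \<Longrightarrow> \<exists>j. of_int k * mesh m = of_int j * mesh n"
  by (rule exI[of _ "k * 2 ^ (n - m)"]) (simp add: mesh_split[of m n])

text \<open>The grids are nested, so finitely many dyadic points lie together on every sufficiently
  fine one; estimates that hold on a single grid thus reach any finite list of dyadics.\<close>

lemma dyadics_common:
  assumes "finite A" "A \<subseteq> dyadics"
  shows "\<exists>m. \<forall>n\<ge>m. \<forall>x\<in>A. \<exists>k. x = of_int k * mesh n"
  using assms
proof (induction rule: finite_induct)
  case (insert x A)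
  then obtain m where m: "\<forall>n\<ge>m. \<forall>x\<in>A. \<exists>k. x = of_int k * mesh n" by auto
  obtain k m' where k: "x = of_int k * mesh m'" using insert by (auto simp: dyadics_def)
  have "\<forall>n\<ge>max m m'. \<forall>x\<in>insert x A. \<exists>k. x = of_int k * mesh n"
    using m mesh_refine[of m' _ k] k by (auto)
  then show ?case ..
qed auto

lemma dyadics_dense: "x < y \<Longrightarrow> \<exists>z\<in>dyadics. x < z \<and> z < y"
proof -
  assume "x < y"
  have "eventually (\<lambda>n. mesh n < y - x) sequentially"
    using order_tendstoD(2)[OF mesh_tendsto_0, of "y - x"] \<open>x < y\<close> by simp
  then obtain n where n: "mesh n < y - x" by (auto simp: eventually_sequentially)
  let ?z = "of_int (\<lfloor>x / mesh n\<rfloor> + 1) * mesh n"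
  have "x / mesh n < of_int (\<lfloor>x / mesh n\<rfloor> + 1)" by linarith
  then have "x < ?z" by (simp add: field_simps)
  moreover have "of_int \<lfloor>x / mesh n\<rfloor> \<le> x / mesh n" by simp
  then have "of_int \<lfloor>x / mesh n\<rfloor> * mesh n \<le> x" by (simp only: pos_le_divide_eq mesh_pos)
  then have "?z < y" using n by (simp add: algebra_simps)
  moreover have "?z \<in> dyadics" unfolding dyadics_def by blast
  ultimately show ?thesis by blast
qed

lemma max_diff_divide: "0 < e \<Longrightarrow> e * max 0 (x / e - y / e) = max 0 (x - y)" for e x y :: real
  by (auto simp: max_def field_simps)

section \<open>Difference quotients and their dyadic limit\<close>

locale window_interval = window +
  fixes a b :: real
  assumes ab: "a < b"
begin

text \<open>The underlying interval is \<open>[a, b + mesh n]\<close>, not \<open>[a, b]\<close>: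
  the margins \<open>x - a\<close> and \<open>b - x\<close> stay the same for all \<open>n\<close>,
  which makes the quotients increase in \<open>n\<close> exactly.\<close>

definition quot :: "nat \<Rightarrow> real \<Rightarrow> real" where
  "quot n x = q (x - a) (b - x) (mesh n) / mesh n"

definition slope :: "real \<Rightarrow> real" where
  "slope x = lim (\<lambda>n. quot n x)"

lemma quot_nonneg: "a < x \<Longrightarrow> x < b \<Longrightarrow> 0 \<le> quot n x"
  unfolding quot_def by (intro divide_nonneg_nonneg q_nonneg) (auto intro: less_imp_le)

lemma quot_le: "a < x \<Longrightarrow> x < b \<Longrightarrow> quot n x \<le> 2 / min (x - a) (b - x)"
  using q_le[of "x - a" "b - x" "mesh n"] by (simp add: quot_def field_simps)

lemma quot_tendsto: "(\<lambda>n. quot n x) \<longlonglongrightarrow> slope x" if x: "a < x" "x < b"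
proof -
  \<comment> \<open>Each half of a cell has one margin longer by \<open>?e\<close>; shortening it
    only raises the mass, so halving the cell cannot lower the quotient.\<close>
  have "incseq (\<lambda>n. quot n x)"
  proof (rule incseq_SucI)
    fix n
    let ?e = "mesh (Suc n)"
    have e: "mesh n = ?e + ?e" by (simp add: mesh_def)
    have "q (x - a) (b - x) (?e + ?e) = q (x - a) (b - x + ?e) ?e + q (x - a + ?e) (b - x) ?e"
      by (rule split) (use x in auto)
    moreover have "q (x - a) (b - x + ?e) ?e \<le> q (x - a) (b - x) ?e"
      by (rule anti) (use x mesh_pos[of "Suc n"] in \<open>auto simp del: mesh_pos\<close>)
    moreover have "q (x - a + ?e) (b - x) ?e \<le> q (x - a) (b - x) ?e"
      by (rule anti) (use x mesh_pos[of "Suc n"] in \<open>auto simp del: mesh_pos\<close>)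
    ultimately have "q (x - a) (b - x) (?e + ?e) \<le> 2 * q (x - a) (b - x) ?e" by simp
    then have "q (x - a) (b - x) (?e + ?e) / (?e + ?e) \<le> 2 * q (x - a) (b - x) ?e / (?e + ?e)"
      by (rule divide_right_mono) (simp add: less_imp_le)
    then show "quot n x \<le> quot (Suc n) x"
      unfolding quot_def e by simp
  qed
  from incseq_convergent[OF this, of "2 / min (x - a) (b - x)"] quot_le[OF x]
  obtain L where "(\<lambda>n. quot n x) \<longlonglongrightarrow> L" by blast
  then show ?thesis unfolding slope_def using limI by blast
qed

lemma slope_nonneg: "a < x \<Longrightarrow> x < b \<Longrightarrow> 0 \<le> slope x"
  by (rule tendsto_lowerbound[OF quot_tendsto]) (auto intro: quot_nonneg always_eventually)

lemma slope_le: "a < x \<Longrightarrow> x < b \<Longrightarrow> slope x \<le> 2 / min (x - a) (b - x)"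
  by (rule tendsto_upperbound[OF quot_tendsto]) (auto intro: quot_le always_eventually)

text \<open>The mass gained on a cell when the interval is shortened on the right sums to at most the
  mass of the last cell; shortening on the left gives the mass of the first cell.\<close>

lemma grid_variation:
  fixes x :: real and n N :: nat
  defines "y \<equiv> \<lambda>k. x + real k * mesh n"
  assumes "a < x" "x + real N * mesh n < b"
  shows "(\<Sum>k<N. max 0 (quot n (y (Suc k)) - quot n (y k))) \<le> quot n (y N)"
    and "(\<Sum>k<N. max 0 (quot n (y k) - quot n (y (Suc k)))) \<le> quot n x"
proof -
  let ?e = "mesh n"
  have e: "0 < ?e" by simp
  have yle: "y k \<le> y N" if "k \<le> N" for k
    using that by (simp add: y_def)
  have yge: "x \<le> y k" for k by (simp add: y_def less_imp_le)
  have ySuc: "y (Suc k) = y k + ?e" for k by (simp add: y_def algebra_simps)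
  show "(\<Sum>k<N. max 0 (quot n (y (Suc k)) - quot n (y k))) \<le> quot n (y N)"
  proof (cases N)
    case 0
    then show ?thesis using quot_nonneg assms by (simp add: y_def)
  next
    case (Suc N')
    have "?e * (\<Sum>k<N. max 0 (quot n (y (Suc k)) - quot n (y k))) =
        (\<Sum>k<N. max 0 (q (y (Suc k) - a) (b - y (Suc k)) ?e - q (y k - a) (b - y k) ?e))"
      unfolding sum_distrib_left
      by (intro sum.cong refl) (simp only: quot_def max_diff_divide[OF e])
    \<comment> \<open>The mixed term, with the left margin of \<open>y k\<close> and the right
      margin of \<open>y (Suc k)\<close>, dominates both neighbours, and its sum again runs over
      consecutive cells.\<close>
    also have "\<dots> \<le> (\<Sum>k<N. q (y k - a) (b - y (Suc k)) ?e - q (y k - a) (b - y k) ?e)"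
    proof (rule sum_mono)
      fix k assume "k \<in> {..<N}"
      then have "Suc k \<le> N" by auto
      from yle[OF this] have "y (Suc k) < b" using assms(3) unfolding y_def by linarith
      then show "max 0 (q (y (Suc k) - a) (b - y (Suc k)) ?e - q (y k - a) (b - y k) ?e)
          \<le> q (y k - a) (b - y (Suc k)) ?e - q (y k - a) (b - y k) ?e"
        using anti[of "y k - a" "y (Suc k) - a" "b - y (Suc k)" "b - y (Suc k)" ?e]
          anti[of "y k - a" "y k - a" "b - y (Suc k)" "b - y k" ?e] yge[of k] assms(2) ySuc[of k] e
        by (auto simp del: mesh_pos)
    qed
    also have "\<dots> = (\<Sum>k<Suc N'. q ((x - a) + real k * ?e) ((b - y N) + (real N' - real k) * ?e) ?e)
        - (\<Sum>k<Suc N'. q ((x - a) + real k * ?e) ((b - y N + ?e) + (real N' - real k) * ?e) ?e)"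
      unfolding Suc sum_subtractf[symmetric]
      by (intro sum.cong refl arg_cong2[where f = "(-)"] arg_cong2[where f = "\<lambda>u v. q u v ?e"])
        (auto simp: y_def algebra_simps)
    also have "\<dots> = q (x - a) (b - y N) (real N * ?e) - q (x - a) (b - y N + ?e) (real N * ?e)"
      unfolding Suc using assms(2,3)
      by (intro arg_cong2[where f = "(-)"] sum_cells) (auto simp: y_def Suc)
    \<comment> \<open>Widening the window from \<open>N\<close> to \<open>N + 1\<close> cells cannot
      lower its mass; by \<open>split\<close> the gain is paid for by the last cell.\<close>
    also have "\<dots> \<le> q (y N - a) (b - y N) ?e"
    proof -
      have p: "0 \<le> x - a" "0 \<le> b - y N" "0 < real N * ?e" "real N * ?e \<le> real N * ?e + ?e"
        using assms(2,3) by (auto simp: y_def Suc)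
      have eq: "x - a + real N * ?e = y N - a" by (simp add: y_def)
      show ?thesis using split[OF p(1,2,3) e] width[OF p(1,2,3,4)] unfolding eq by linarith
    qed
    also have "\<dots> = ?e * quot n (y N)" by (simp add: quot_def)
    finally show ?thesis using e by (simp del: mesh_pos)
  qed
  show "(\<Sum>k<N. max 0 (quot n (y k) - quot n (y (Suc k)))) \<le> quot n x"
  proof (cases N)
    case 0
    then show ?thesis using quot_nonneg assms by (simp add: y_def)
  next
    case (Suc N')
    have "?e * (\<Sum>k<N. max 0 (quot n (y k) - quot n (y (Suc k)))) =
        (\<Sum>k<N. max 0 (q (y k - a) (b - y k) ?e - q (y (Suc k) - a) (b - y (Suc k)) ?e))"
      unfolding sum_distrib_left
      by (intro sum.cong refl) (simp only: quot_def max_diff_divide[OF e])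
    \<comment> \<open>The same mixed term, now against \<open>y (Suc k)\<close>: the two sums differ
      in the left margin, and the excess is at most the first cell.\<close>
    also have "\<dots> \<le> (\<Sum>k<N. q (y k - a) (b - y (Suc k)) ?e - q (y (Suc k) - a) (b - y (Suc k)) ?e)"
    proof (rule sum_mono)
      fix k assume "k \<in> {..<N}"
      then have "Suc k \<le> N" by auto
      from yle[OF this] have "y (Suc k) < b" using assms(3) unfolding y_def by linarith
      then show "max 0 (q (y k - a) (b - y k) ?e - q (y (Suc k) - a) (b - y (Suc k)) ?e)
          \<le> q (y k - a) (b - y (Suc k)) ?e - q (y (Suc k) - a) (b - y (Suc k)) ?e"
        using anti[of "y k - a" "y (Suc k) - a" "b - y (Suc k)" "b - y (Suc k)" ?e]
          anti[of "y k - a" "y k - a" "b - y (Suc k)" "b - y k" ?e] yge[of k] assms(2) ySuc[of k] e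
        by (auto simp del: mesh_pos)
    qed
    also have "\<dots> = (\<Sum>k<Suc N'. q ((x - a) + real k * ?e) ((b - y N) + (real N' - real k) * ?e) ?e)
        - (\<Sum>k<Suc N'. q ((x - a + ?e) + real k * ?e) ((b - y N) + (real N' - real k) * ?e) ?e)"
      unfolding Suc sum_subtractf[symmetric]
      by (intro sum.cong refl arg_cong2[where f = "(-)"] arg_cong2[where f = "\<lambda>u v. q u v ?e"])
        (auto simp: y_def algebra_simps)
    also have "\<dots> = q (x - a) (b - y N) (real N * ?e) - q (x - a + ?e) (b - y N) (real N * ?e)"
      unfolding Suc using assms(2,3)
      by (intro arg_cong2[where f = "(-)"] sum_cells) (auto simp: y_def Suc intro: add_nonneg_nonneg less_imp_le)
    also have "\<dots> \<le> q (x - a) (b - x) ?e"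
    proof -
      have p: "0 \<le> x - a" "0 \<le> b - y N" "0 < real N * ?e" "real N * ?e \<le> ?e + real N * ?e"
        using assms(2,3) by (auto simp: y_def Suc)
      have eq: "b - y N + real N * ?e = b - x" by (simp add: y_def)
      have "0 \<le> x - a + ?e" using p(1) by simp
      then show ?thesis
        using split[OF p(1,2) e p(3)] width[OF p(1,2,3,4)] unfolding eq by linarith
    qed
    also have "\<dots> = ?e * quot n x" by (simp add: quot_def)
    finally show ?thesis using e by (simp del: mesh_pos)
  qed
qed

lemma abs_variation_grid:
  assumes "a < x" "x + real N * mesh n < b"
  shows "(\<Sum>k<N. \<bar>quot n (x + real (Suc k) * mesh n) - quot n (x + real k * mesh n)\<bar>)
    \<le> quot n (x + real N * mesh n) + quot n x"
proof -
  have *: "\<bar>s - t\<bar> = max 0 (s - t) + max 0 (t - s)" for s t :: real by auto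
  show ?thesis unfolding * sum.distrib by (intro add_mono grid_variation assms)
qed

end

text \<open>Each jump is the sum of the single steps it skips, and the blocks skipped by a sorted
  list do not overlap. A list of grid points is thus bounded by the whole grid between its
  ends.\<close>

lemma posvar_le_sum_steps:
  fixes h :: "nat \<Rightarrow> real"
  assumes "sorted ks" "ks \<noteq> []"
  shows "posvar h ks \<le> (\<Sum>k\<in>{hd ks..<last ks}. max 0 (h (Suc k) - h k))"
  using assms(2,1)
proof (induction ks rule: list_nonempty_induct)
  case (cons i ks)
  have le: "i \<le> hd ks" "hd ks \<le> last ks"
    using cons by (cases ks; auto)+
  have "h j - h i \<le> (\<Sum>k\<in>{i..<j}. max 0 (h (Suc k) - h k))" if "i \<le> j" for j
  proof -
    have "h j - h i = (\<Sum>k\<in>{i..<j}. h (Suc k) - h k)"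
      using that by (simp add: sum_Suc_diff')
    also have "\<dots> \<le> (\<Sum>k\<in>{i..<j}. max 0 (h (Suc k) - h k))" by (rule sum_mono) auto
    finally show ?thesis .
  qed
  from this[OF le(1)] have "max 0 (h (hd ks) - h i) \<le> (\<Sum>k\<in>{i..<hd ks}. max 0 (h (Suc k) - h k))"
    by (simp add: sum_nonneg)
  moreover have "posvar h ks \<le> (\<Sum>k\<in>{hd ks..<last ks}. max 0 (h (Suc k) - h k))"
    using cons by simp
  moreover have "(\<Sum>k\<in>{i..<last ks}. max 0 (h (Suc k) - h k)) =
      (\<Sum>k\<in>{i..<hd ks}. max 0 (h (Suc k) - h k)) + (\<Sum>k\<in>{hd ks..<last ks}. max 0 (h (Suc k) - h k))"
    using le by (simp add: sum.atLeastLessThan_concat)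
  moreover have "posvar h (i # ks) = posvar h ks + max 0 (h (hd ks) - h i)"
    using cons(1) by (simp add: posvar_Cons)
  moreover have eq: "last (i # ks) = last ks" "hd (i # ks) = i" using cons(1) by auto
  ultimately show ?case unfolding eq by linarith
qed simp

text \<open>Within a block of length \<open>p\<close> no value differs from the one at its right end
  by more than the variation over the block. This turns a sum over a fine grid into a Riemann sum
  over a coarse one.\<close>

lemma sum_blocks:
  fixes c :: "nat \<Rightarrow> real"
  shows "\<bar>(\<Sum>j<N * p. c j) - real p * (\<Sum>k<N. c (Suc k * p))\<bar>
    \<le> real p * (\<Sum>j<N * p. \<bar>c (Suc j) - c j\<bar>)"
proof (induction N)
  case (Suc N)
  let ?I = "{N * p..<Suc N * p}"
  have split: "(\<Sum>j<Suc N * p. g j) = (\<Sum>j<N * p. g j) + (\<Sum>j\<in>?I. g j)" for g :: "nat \<Rightarrow> real"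
    unfolding lessThan_atLeast0 by (rule sum.atLeastLessThan_concat[symmetric]) auto
  have "\<bar>c j - c (Suc N * p)\<bar> \<le> (\<Sum>i\<in>?I. \<bar>c (Suc i) - c i\<bar>)" if "j \<in> ?I" for j
  proof -
    have "c (Suc N * p) - c j = (\<Sum>i\<in>{j..<Suc N * p}. c (Suc i) - c i)"
      using that by (subst sum_Suc_diff') auto
    then have "\<bar>c j - c (Suc N * p)\<bar> = \<bar>\<Sum>i\<in>{j..<Suc N * p}. c (Suc i) - c i\<bar>"
      by (simp add: abs_minus_commute)
    also have "\<dots> \<le> (\<Sum>i\<in>{j..<Suc N * p}. \<bar>c (Suc i) - c i\<bar>)" by (rule sum_abs)
    also have "\<dots> \<le> (\<Sum>i\<in>?I. \<bar>c (Suc i) - c i\<bar>)"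
      using that by (intro sum_mono2) auto
    finally show ?thesis .
  qed
  then have "(\<Sum>j\<in>?I. \<bar>c j - c (Suc N * p)\<bar>) \<le> real (card ?I) * (\<Sum>i\<in>?I. \<bar>c (Suc i) - c i\<bar>)"
    by (intro sum_bounded_above) auto
  moreover have "\<bar>(\<Sum>j\<in>?I. c j) - real p * c (Suc N * p)\<bar> \<le> (\<Sum>j\<in>?I. \<bar>c j - c (Suc N * p)\<bar>)"
    using sum_abs[of "\<lambda>j. c j - c (Suc N * p)" ?I] by (simp add: sum_subtractf)
  ultimately have "\<bar>(\<Sum>j\<in>?I. c j) - real p * c (Suc N * p)\<bar> \<le> real p * (\<Sum>i\<in>?I. \<bar>c (Suc i) - c i\<bar>)"
    by simp
  with Suc.IH show ?case unfolding split sum.lessThan_Suc by (simp add: algebra_simps)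
qed simp

text \<open>The \<open>+ 1\<close> makes the result strictly larger than \<open>x\<close> even when
  \<open>x\<close> is a grid point, so \<open>x\<close> is approached only through dyadics on its
  right. The result is constant on half-open cells.\<close>

definition round_up :: "nat \<Rightarrow> real \<Rightarrow> real" where
  "round_up m x = of_int (\<lfloor>x / mesh m\<rfloor> + 1) * mesh m"

lemma round_up_dyadic: "round_up m x \<in> dyadics"
  unfolding round_up_def dyadics_def by blast

lemma round_up_bounds: "x < round_up m x" "round_up m x \<le> x + mesh m"
proof -
  have "x / mesh m < of_int (\<lfloor>x / mesh m\<rfloor> + 1)" by linarith
  then show "x < round_up m x" by (simp add: round_up_def field_simps)
  have "of_int \<lfloor>x / mesh m\<rfloor> \<le> x / mesh m" by simp
  then have "of_int \<lfloor>x / mesh m\<rfloor> * mesh m \<le> x" by (simp only: pos_le_divide_eq mesh_pos)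
  then show "round_up m x \<le> x + mesh m" by (simp add: round_up_def algebra_simps)
qed

lemma round_up_mono: "x \<le> y \<Longrightarrow> round_up m x \<le> round_up m y"
  unfolding round_up_def
  by (intro mult_right_mono) (auto intro!: floor_mono divide_right_mono simp: less_imp_le)

lemma round_up_cell:
  assumes "of_int k * mesh m \<le> x" "x < of_int k * mesh m + mesh m"
  shows "round_up m x = of_int k * mesh m + mesh m"
proof -
  have "\<lfloor>x / mesh m\<rfloor> = k"
    using assms by (intro floor_unique) (simp_all add: field_simps)
  then show ?thesis by (simp add: round_up_def algebra_simps)
qed

lemma round_up_tendsto: "(\<lambda>m. round_up m x) \<longlonglongrightarrow> x"
proof (rule tendsto_sandwich[of "\<lambda>_. x" _ _ "\<lambda>m. x + mesh m"])
  show "(\<lambda>m. x + mesh m) \<longlonglongrightarrow> x"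
    using tendsto_add[OF tendsto_const mesh_tendsto_0, of x] by simp
qed (auto intro!: always_eventually less_imp_le[OF round_up_bounds(1)] round_up_bounds(2))

context window_interval
begin

lemma variation_quot:
  assumes xs: "sorted xs" "xs \<noteq> []" "set xs \<subseteq> {a<..<b}"
    and grid: "\<And>x. x \<in> set xs \<Longrightarrow> \<exists>k. x = of_int k * mesh n"
  shows "posvar (quot n) xs \<le> quot n (last xs)" and "negvar (quot n) xs \<le> quot n (hd xs)"
proof -
  define y where "y k = hd xs + real k * mesh n" for k
  \<comment> \<open>\<open>g\<close> recovers the index of a grid point counted from the head of the
    list; the list becomes a sorted list of indices.\<close>
  define g where "g x = nat \<lfloor>(x - hd xs) / mesh n\<rfloor>" for x
  have hd_le: "hd xs \<le> x" if "x \<in> set xs" for x using that xs by (cases xs) auto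
  have yg: "y (g x) = x" if x: "x \<in> set xs" for x
  proof -
    obtain i j where "x = of_int i * mesh n" "hd xs = of_int j * mesh n"
      using grid[OF x] grid[OF hd_in_set[OF xs(2)]] by blast
    then have ij: "x - hd xs = of_int (i - j) * mesh n" by (simp add: algebra_simps)
    then have "(x - hd xs) / mesh n = of_int (i - j)" by simp
    then have "g x = nat (i - j)" unfolding g_def by simp
    moreover have "0 \<le> of_int (i - j) * mesh n" using hd_le[OF x] ij by simp
    then have "i \<ge> j" using mesh_pos[of n] unfolding zero_le_mult_iff by auto
    ultimately show ?thesis using ij by (simp add: y_def)
  qed
  have map: "map y (map g xs) = xs" using yg by (simp add: map_idI)
  have srt: "sorted (map g xs)"
    unfolding sorted_map
    by (rule sorted_wrt_mono_rel[OF _ xs(1)])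
      (auto simp: g_def intro!: nat_mono floor_mono divide_right_mono)
  have ends: "hd (map g xs) = 0" "last (map g xs) = g (last xs)" "map g xs \<noteq> []"
    using xs(2) by (auto simp: hd_map last_map g_def)
  have inside: "a < hd xs" "hd xs + real (g (last xs)) * mesh n < b"
    using subsetD[OF xs(3) hd_in_set[OF xs(2)]] subsetD[OF xs(3) last_in_set[OF xs(2)]]
      yg[OF last_in_set[OF xs(2)]] by (auto simp: y_def)
  have "posvar (quot n) xs = posvar (\<lambda>k. quot n (y k)) (map g xs)"
    using posvar_map[of "quot n" y "map g xs"] unfolding map by simp
  also have "\<dots> \<le> (\<Sum>k<g (last xs). max 0 (quot n (y (Suc k)) - quot n (y k)))"
    using posvar_le_sum_steps[OF srt ends(3), of "\<lambda>k. quot n (y k)"] unfolding ends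
    by (simp add: lessThan_atLeast0)
  also have "\<dots> \<le> quot n (y (g (last xs)))"
    unfolding y_def by (rule grid_variation(1)[OF inside])
  finally show "posvar (quot n) xs \<le> quot n (last xs)" using yg xs(2) by simp
  have "negvar (quot n) xs = negvar (\<lambda>k. quot n (y k)) (map g xs)"
    using posvar_map[of "\<lambda>x. - quot n x" y "map g xs"] unfolding map by simp
  also have "\<dots> \<le> (\<Sum>k<g (last xs). max 0 (quot n (y k) - quot n (y (Suc k))))"
    using posvar_le_sum_steps[OF srt ends(3), of "\<lambda>k. - quot n (y k)"] unfolding ends
    by (simp add: lessThan_atLeast0)
  also have "\<dots> \<le> quot n (hd xs)"
    unfolding y_def by (rule grid_variation(2)[OF inside])
  finally show "negvar (quot n) xs \<le> quot n (hd xs)" .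
qed

text \<open>A finite list of dyadics lies on all fine grids, where \<open>variation_quot\<close>
  applies; both sides pass to the limit.\<close>

lemma variation_slope:
  assumes xs: "sorted xs" "xs \<noteq> []" "set xs \<subseteq> {a<..<b}" "set xs \<subseteq> dyadics"
  shows "posvar slope xs \<le> slope (last xs)" and "negvar slope xs \<le> slope (hd xs)"
proof -
  obtain m where m: "\<forall>n\<ge>m. \<forall>x\<in>set xs. \<exists>k. x = of_int k * mesh n"
    using dyadics_common[OF _ xs(4)] by auto
  have lim: "(\<lambda>n. quot n x) \<longlonglongrightarrow> slope x" if "x \<in> set xs" for x
    using subsetD[OF xs(3) that] by (intro quot_tendsto) auto
  have ends: "hd xs \<in> set xs" "last xs \<in> set xs" using xs(2) by auto
  show "posvar slope xs \<le> slope (last xs)"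
  proof (rule LIMSEQ_le)
    show "(\<lambda>n. posvar (quot n) xs) \<longlonglongrightarrow> posvar slope xs" by (rule tendsto_posvar) (rule lim)
    show "\<exists>N. \<forall>n\<ge>N. posvar (quot n) xs \<le> quot n (last xs)"
      using m variation_quot(1)[OF xs(1,2,3)] by blast
  qed (rule lim[OF ends(2)])
  show "negvar slope xs \<le> slope (hd xs)"
  proof (rule LIMSEQ_le)
    show "(\<lambda>n. negvar (quot n) xs) \<longlonglongrightarrow> negvar slope xs"
      by (rule tendsto_posvar) (intro tendsto_minus lim)
    show "\<exists>N. \<forall>n\<ge>N. negvar (quot n) xs \<le> quot n (hd xs)"
      using m variation_quot(2)[OF xs(1,2,3)] by blast
  qed (rule lim[OF ends(1)])
qed

section \<open>The density as a right limit along dyadics\<close>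

abbreviation right_dyadic :: "real \<Rightarrow> real filter" where
  "right_dyadic x \<equiv> at x within dyadics \<inter> {a<..<b} \<inter> {x<..}"

text \<open>The variation of \<open>slope\<close> has been bounded on dyadic points only, so only
  its values there enter; taking right limits along them also secures right continuity.\<close>

definition dens :: "real \<Rightarrow> real" where
  "dens x = Lim (right_dyadic x) slope"

lemma round_up_right_dyadic:
  assumes "a < x" "x < b"
  shows "filterlim (\<lambda>m. round_up m x) (right_dyadic x) sequentially"
proof -
  have "eventually (\<lambda>m. round_up m x < b) sequentially"
    using order_tendstoD(2)[OF round_up_tendsto assms(2)] .
  then have "eventually (\<lambda>m. round_up m x \<in> dyadics \<inter> {a<..<b} \<inter> {x<..} \<and> round_up m x \<noteq> x) sequentially"
  proof eventually_elim
    case (elim m)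
    then show ?case using round_up_dyadic[of m x] round_up_bounds(1)[of x m] assms by auto
  qed
  then show ?thesis unfolding filterlim_at using round_up_tendsto by auto
qed

lemma slope_right_limit:
  assumes x: "a < x" "x < b"
  shows "(slope \<longlongrightarrow> dens x) (right_dyadic x)"
proof -
  \<comment> \<open>Appending a dyadic \<open>d\<close> to the right of \<open>x\<close> bounds the
    rises on \<open>(x, d)\<close> by the single number \<open>slope d\<close>.\<close>
  obtain d where d: "d \<in> dyadics" "x < d" "d < b" using dyadics_dense[OF x(2)] by blast
  let ?S = "dyadics \<inter> {x<..<d}"
  have eq: "at x within ?S \<inter> {x<..} = right_dyadic x"
    by (rule at_within_nhd[of _ "{a<..<d}"]) (use x d in auto)
  have "\<exists>l. ((\<lambda>t. ereal (slope t)) \<longlongrightarrow> l) (at x within ?S \<inter> {x<..})"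
  proof (rule bounded_variation_limits(1))
    have "posvar slope xs \<le> slope d" if xs: "sorted xs" "set xs \<subseteq> ?S" for xs
    proof -
      have "set xs \<subseteq> {a<..<d}" "set xs \<subseteq> dyadics"
        using x by (auto intro!: order.trans[OF xs(2)])
      then have "posvar slope (xs @ [d]) \<le> slope (last (xs @ [d]))"
        by (intro variation_slope) (use xs(1) d x in \<open>auto simp: sorted_append\<close>)
      then show ?thesis using posvar_le_snoc[of slope xs d] by simp
    qed
    then show "(\<forall>xs. sorted xs \<longrightarrow> set xs \<subseteq> ?S \<longrightarrow> posvar slope xs \<le> slope d) \<or>
      (\<forall>xs. sorted xs \<longrightarrow> set xs \<subseteq> ?S \<longrightarrow> negvar slope xs \<le> slope d)" by blast
  qed
  then obtain l where l: "((\<lambda>t. ereal (slope t)) \<longlongrightarrow> l) (right_dyadic x)" unfolding eq by blast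
  have "eventually (\<lambda>t. t \<in> ?S) (at x within ?S \<inter> {x<..})"
    by (simp add: eventually_at_filter)
  then have "eventually (\<lambda>t. \<bar>slope t\<bar> \<le> 2 / min (x - a) (b - d)) (right_dyadic x)"
    unfolding eq
  proof eventually_elim
    case (elim t)
    then have t: "a < t" "t < b" using x d by auto
    have "slope t \<le> 2 / min (t - a) (b - t)" by (rule slope_le[OF t])
    also have "\<dots> \<le> 2 / min (x - a) (b - d)"
      using elim x d by (intro divide_left_mono) auto
    finally show ?case using slope_nonneg[OF t] by simp
  qed
  from real_limit_of_ereal[OF l this] obtain r where r: "(slope \<longlongrightarrow> r) (right_dyadic x)" ..
  have "right_dyadic x \<noteq> bot"
    using round_up_right_dyadic[OF x] unfolding filterlim_def
    by (auto simp: bot_unique filtermap_bot_iff)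
  from tendsto_Lim[OF this r] r show ?thesis by (simp add: dens_def)
qed

lemma slope_round_up: "a < x \<Longrightarrow> x < b \<Longrightarrow> (\<lambda>m. slope (round_up m x)) \<longlonglongrightarrow> dens x"
  by (rule filterlim_compose[OF slope_right_limit round_up_right_dyadic])

lemma round_up_eventually: "x < b \<Longrightarrow> eventually (\<lambda>m. round_up m x < b) sequentially"
  using order_tendstoD(2)[OF round_up_tendsto] .

lemma dens_nonneg: "0 \<le> dens x" if x: "a < x" "x < b"
proof (rule tendsto_lowerbound[OF slope_round_up[OF x]])
  show "eventually (\<lambda>m. 0 \<le> slope (round_up m x)) sequentially"
    using round_up_eventually[OF x(2)]
  proof eventually_elim
    case (elim m)
    then show ?case using x round_up_bounds(1)[of x m] by (intro slope_nonneg) auto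
  qed
qed simp

text \<open>For \<open>y\<close> slightly above \<open>x\<close>, the dyadics that define
  \<open>dens y\<close> are themselves slightly above \<open>x\<close>, where \<open>slope\<close>
  is already close to \<open>dens x\<close>.\<close>

lemma dens_right_continuous: "continuous (at_right x) dens" if x: "a < x" "x < b"
  unfolding continuous_within
proof (rule tendstoI)
  fix e :: real assume e: "0 < e"
  have "eventually (\<lambda>y. dist (slope y) (dens x) < e / 2) (right_dyadic x)"
    by (rule tendstoD[OF slope_right_limit[OF x]]) (use e in auto)
  then obtain d where d: "0 < d"
    "\<And>y. y \<in> dyadics \<inter> {a<..<b} \<inter> {x<..} \<Longrightarrow> y \<noteq> x \<Longrightarrow> dist y x < d \<Longrightarrow> dist (slope y) (dens x) < e / 2"
    unfolding eventually_at by blast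
  have "eventually (\<lambda>y. y \<in> {x<..<min (x + d) b}) (at_right x)"
    using d x by (intro eventually_at_rightI[of _ "min (x + d) b"]) auto
  then show "eventually (\<lambda>y. dist (dens y) (dens x) < e) (at_right x)"
  proof eventually_elim
    case (elim y)
    then have y: "a < y" "y < b" using x by auto
    have "dist (dens y) (dens x) \<le> e / 2"
    proof (rule tendsto_upperbound[OF tendsto_dist[OF slope_round_up[OF y] tendsto_const]])
      have "eventually (\<lambda>m. round_up m y < min (x + d) b) sequentially"
        by (rule order_tendstoD(2)[OF round_up_tendsto]) (use elim in auto)
      then show "eventually (\<lambda>m. dist (slope (round_up m y)) (dens x) \<le> e / 2) sequentially"
      proof eventually_elim
        case (elim m)
        have "dist (slope (round_up m y)) (dens x) < e / 2"
          by (rule d(2)) (use elim round_up_dyadic[of m y] round_up_bounds(1)[of y m] y x \<open>y \<in> {x<..<min (x + d) b}\<close>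
            in \<open>auto simp: dist_real_def\<close>)
        then show ?case by simp
      qed
    qed simp
    then show ?case using e by simp
  qed
qed

text \<open>Rounding up preserves the order of a list and moves it onto dyadics; for large
  \<open>m\<close> the list stays inside the interval.\<close>

lemma variation_dens:
  assumes xs: "sorted xs" "xs \<noteq> []" "set xs \<subseteq> {a<..<b}"
  shows "posvar dens xs \<le> dens (last xs)" and "negvar dens xs \<le> dens (hd xs)"
proof -
  have lim: "(\<lambda>m. slope (round_up m x)) \<longlonglongrightarrow> dens x" if "x \<in> set xs" for x
    using subsetD[OF xs(3) that] by (intro slope_round_up) auto
  have ends: "hd xs \<in> set xs" "last xs \<in> set xs" using xs(2) by auto
  have "eventually (\<lambda>m. \<forall>x\<in>set xs. round_up m x < b) sequentially"
    using xs(3) by (intro eventually_ball_finite) (auto intro!: round_up_eventually dest!: subsetD)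
  then obtain M where M: "\<forall>m\<ge>M. \<forall>x\<in>set xs. round_up m x < b"
    by (auto simp: eventually_sequentially)
  have lists: "sorted (map (round_up m) xs)" "map (round_up m) xs \<noteq> []"
    "set (map (round_up m) xs) \<subseteq> {a<..<b}" "set (map (round_up m) xs) \<subseteq> dyadics"
    "hd (map (round_up m) xs) = round_up m (hd xs)" "last (map (round_up m) xs) = round_up m (last xs)"
    if "m \<ge> M" for m
  proof -
    show "sorted (map (round_up m) xs)"
      unfolding sorted_map by (rule sorted_wrt_mono_rel[OF _ xs(1)]) (rule round_up_mono)
    show "set (map (round_up m) xs) \<subseteq> {a<..<b}"
    proof
      fix y assume "y \<in> set (map (round_up m) xs)"
      then obtain x where x: "x \<in> set xs" "y = round_up m x" by auto
      then have "a < x" using xs(3) by auto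
      then show "y \<in> {a<..<b}" using round_up_bounds(1)[of x m] M that x by auto
    qed
  qed (use xs(2) round_up_dyadic in \<open>auto simp: hd_map last_map\<close>)
  show "posvar dens xs \<le> dens (last xs)"
  proof (rule LIMSEQ_le)
    show "(\<lambda>m. posvar (\<lambda>x. slope (round_up m x)) xs) \<longlonglongrightarrow> posvar dens xs"
      by (rule tendsto_posvar) (rule lim)
    show "\<exists>N. \<forall>m\<ge>N. posvar (\<lambda>x. slope (round_up m x)) xs \<le> slope (round_up m (last xs))"
      using variation_slope(1)[OF lists(1-4)] unfolding posvar_map by (metis lists(6))
  qed (rule lim[OF ends(2)])
  show "negvar dens xs \<le> dens (hd xs)"
  proof (rule LIMSEQ_le)
    show "(\<lambda>m. negvar (\<lambda>x. slope (round_up m x)) xs) \<longlonglongrightarrow> negvar dens xs"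
      by (rule tendsto_posvar) (intro tendsto_minus lim)
    show "\<exists>N. \<forall>m\<ge>N. negvar (\<lambda>x. slope (round_up m x)) xs \<le> slope (round_up m (hd xs))"
      using variation_slope(2)[OF lists(1-4)] unfolding posvar_map by (metis lists(5))
  qed (rule lim[OF ends(1)])
qed

text \<open>At a finer mesh \<open>n\<close> the cells sum to a window probability exactly, while
  \<open>sum_blocks\<close> compares that sum with the Riemann sum on mesh \<open>m\<close> at a
  cost proportional to the variation, itself at most \<open>4 / min (u - a) (b - v)\<close>. Then
  \<open>n\<close> tends to infinity with \<open>m\<close> fixed.\<close>

lemma slope_riemann_sum:
  assumes "a < u" "v < b" "v = u + real N * mesh m" "0 < N"
  shows "\<bar>q (u - a) (b - v) (v - u) - mesh m * (\<Sum>k<N. slope (u + real (Suc k) * mesh m))\<bar>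
    \<le> mesh m * (4 / min (u - a) (b - v))"
proof (rule tendsto_upperbound)
  have uv: "u < v" using assms by simp
  have inside: "u \<le> u + real k * mesh m \<and> u + real k * mesh m \<le> v" if "k \<le> N" for k
    using mult_right_mono[of "real k" "real N" "mesh m"] that assms(3) by auto
  show "(\<lambda>n. \<bar>q (u - a) (b - v + mesh n) (v - u) - mesh m * (\<Sum>k<N. quot n (u + real (Suc k) * mesh m))\<bar>)
    \<longlonglongrightarrow> \<bar>q (u - a) (b - v) (v - u) - mesh m * (\<Sum>k<N. slope (u + real (Suc k) * mesh m))\<bar>"
  proof (intro tendsto_intros q_right_tendsto quot_tendsto mesh_tendsto_0)
    fix k assume "k \<in> {..<N}"
    then have "Suc k \<le> N" by auto
    from inside[OF this] assms(1,2) show "a < u + real (Suc k) * mesh m" "u + real (Suc k) * mesh m < b"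
      by linarith+
  qed (use assms uv in auto)
  show "eventually (\<lambda>n. \<bar>q (u - a) (b - v + mesh n) (v - u) - mesh m * (\<Sum>k<N. quot n (u + real (Suc k) * mesh m))\<bar>
    \<le> mesh m * (4 / min (u - a) (b - v))) sequentially"
  proof (rule eventually_sequentiallyI[of m])
    fix n assume n: "m \<le> n"
    define p :: nat where "p = 2 ^ (n - m)"
    have p: "mesh m = real p * mesh n" "0 < p" using mesh_split[OF n] by (auto simp: p_def)
    define c where "c j = quot n (u + real j * mesh n)" for j
    have v: "v = u + real (N * p) * mesh n" using assms(3) p by simp
    obtain N' where N': "N * p = Suc N'" using assms(4) p(2) by (cases "N * p") auto
    \<comment> \<open>The last cell ends at \<open>v\<close>, but its quotient has the right margin
      \<open>b - v + mesh n\<close>; this is the excess that \<open>q_right_tendsto\<close>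
      removes.\<close>
    have "mesh n * (\<Sum>j<N * p. c j) =
        (\<Sum>j<Suc N'. q ((u - a) + real j * mesh n) ((b - v + mesh n) + (real N' - real j) * mesh n) (mesh n))"
      unfolding sum_distrib_left N' c_def quot_def
      by (intro sum.cong refl) (simp add: v N' algebra_simps)
    also have "\<dots> = q (u - a) (b - v + mesh n) (real (Suc N') * mesh n)"
      by (rule sum_cells) (use assms in \<open>auto intro!: add_nonneg_nonneg less_imp_le\<close>)
    also have "real (Suc N') * mesh n = v - u" by (simp add: v N')
    finally have 1: "mesh n * (\<Sum>j<N * p. c j) = q (u - a) (b - v + mesh n) (v - u)" .
    have 2: "c (Suc k * p) = quot n (u + real (Suc k) * mesh m)" for k
      by (simp add: c_def p algebra_simps)
    have K: "quot n x \<le> 2 / min (u - a) (b - v)" if "u \<le> x" "x \<le> v" for x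
    proof -
      have "quot n x \<le> 2 / min (x - a) (b - x)" by (rule quot_le) (use that assms in auto)
      also have "\<dots> \<le> 2 / min (u - a) (b - v)" using that assms by (intro divide_left_mono) auto
      finally show ?thesis .
    qed
    have "(\<Sum>j<N * p. \<bar>c (Suc j) - c j\<bar>) \<le> quot n v + quot n u"
      unfolding c_def using abs_variation_grid[of u "N * p" n] assms(1,2) by (simp add: v)
    also have "\<dots> \<le> 4 / min (u - a) (b - v)" using K[of u] K[of v] uv by simp
    finally have 3: "(\<Sum>j<N * p. \<bar>c (Suc j) - c j\<bar>) \<le> 4 / min (u - a) (b - v)" .
    have "\<bar>mesh n * (\<Sum>j<N * p. c j) - mesh n * (real p * (\<Sum>k<N. c (Suc k * p)))\<bar>
        = mesh n * \<bar>(\<Sum>j<N * p. c j) - real p * (\<Sum>k<N. c (Suc k * p))\<bar>"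
      by (simp add: right_diff_distrib[symmetric] abs_mult less_imp_le)
    also have "\<dots> \<le> mesh n * (real p * (4 / min (u - a) (b - v)))"
      using sum_blocks[of c N p] mult_left_mono[OF 3, of "real p"]
      by (intro mult_left_mono) (auto simp: less_imp_le)
    also have "\<dots> = mesh m * (4 / min (u - a) (b - v))" by (simp add: p)
    finally show "\<bar>q (u - a) (b - v + mesh n) (v - u) - mesh m * (\<Sum>k<N. quot n (u + real (Suc k) * mesh m))\<bar>
        \<le> mesh m * (4 / min (u - a) (b - v))"
      unfolding 1 2 mult.assoc[symmetric] by (simp add: p mult.commute)
  qed
qed simp

text \<open>On each cell \<open>round_up m\<close> is the right end, so the step function integrates
  to the Riemann sum of \<open>slope_riemann_sum\<close>.\<close>

lemma integral_step:
  assumes u: "u = of_int k * mesh m"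
  shows "has_bochner_integral lborel (\<lambda>x. indicator {u..<u + real N * mesh m} x * slope (round_up m x))
    (mesh m * (\<Sum>k<N. slope (u + real (Suc k) * mesh m)))"
proof (induction N)
  case (Suc N)
  let ?l = "u + real N * mesh m" and ?r = "u + real (Suc N) * mesh m"
  have lr: "?r = ?l + mesh m" by (simp add: algebra_simps)
  have ul: "u \<le> ?l" by (simp add: less_imp_le)
  have "has_bochner_integral lborel (\<lambda>x. slope ?r * indicator {?l..<?r} x) (slope ?r * measure lborel {?l..<?r})"
    by (intro has_bochner_integral_mult_right has_bochner_integral_real_indicator) (auto simp: lr less_imp_le)
  from has_bochner_integral_add[OF Suc.IH this]
  have "has_bochner_integral lborel
     (\<lambda>x. indicator {u..<?l} x * slope (round_up m x) + slope ?r * indicator {?l..<?r} x)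
     (mesh m * (\<Sum>k<Suc N. slope (u + real (Suc k) * mesh m)))"
    by (simp add: lr algebra_simps less_imp_le)
  moreover have "indicator {u..<?l} x * slope (round_up m x) + slope ?r * indicator {?l..<?r} x
      = indicator {u..<?r} x * slope (round_up m x)" for x
  proof (cases "x \<in> {?l..<?r}")
    case True
    have "round_up m x = of_int (k + int N) * mesh m + mesh m"
      by (rule round_up_cell) (use True in \<open>auto simp: u algebra_simps\<close>)
    then have "round_up m x = ?r" by (simp add: u algebra_simps)
    moreover have "x \<in> {u..<?r}" "x \<notin> {u..<?l}"
      using True ul unfolding atLeastLessThan_iff by linarith+
    ultimately show ?thesis using True by simp
  next
    case False
    then have "x \<in> {u..<?l} \<longleftrightarrow> x \<in> {u..<?r}"
      using ul lr mesh_pos[of m] unfolding atLeastLessThan_iff by linarith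
    then show ?thesis using False by (simp add: indicator_def del: atLeastLessThan_iff)
  qed
  ultimately show ?case by simp
qed (simp add: has_bochner_integral_zero)

lemma dens_measurable: "dens \<in> borel_measurable (restrict_space lborel {a<..<b})"
proof (rule borel_measurable_LIMSEQ_real)
  fix m
  have "(\<lambda>x. (\<lambda>k::int. slope (of_int (k + 1) * mesh m)) \<lfloor>x / mesh m\<rfloor>) \<in> borel_measurable lborel"
    by (rule measurable_compose[of _ _ "count_space UNIV"]) auto
  then have "(\<lambda>x. slope (round_up m x)) \<in> borel_measurable lborel"
    by (simp add: round_up_def[abs_def])
  then show "(\<lambda>x. slope (round_up m x)) \<in> borel_measurable (restrict_space lborel {a<..<b})"
    by (rule measurable_restrict_space1)
qed (auto intro!: slope_round_up simp: space_restrict_space)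

text \<open>The step functions \<open>slope (round_up m x)\<close> converge pointwise to
  \<open>dens\<close> and are bounded by \<open>K\<close> on \<open>[u, v)\<close>, while their
  integrals differ from the window probability by at most \<open>2 * K * mesh m\<close>. Dominated
  convergence identifies the limits.\<close>

lemma dens_integral:
  assumes "a < u" "u < v" "v < b" "u \<in> dyadics" "v \<in> dyadics"
  shows "(\<integral>\<^sup>+x. indicator {u..<v} x * ennreal (dens x) \<partial>lborel) = ennreal (q (u - a) (b - v) (v - u))"
proof -
  obtain M where M: "\<forall>n\<ge>M. \<forall>x\<in>{u, v}. \<exists>k. x = of_int k * mesh n"
    using dyadics_common[of "{u, v}"] assms by auto
  have grid: "\<exists>k N. u = of_int k * mesh m \<and> v = u + real N * mesh m \<and> 0 < N" if m: "m \<ge> M" for m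
  proof -
    obtain i j where ij: "u = of_int i * mesh m" "v = of_int j * mesh m" using M m by blast
    then have "i < j" using assms(2) by simp
    then show ?thesis using ij by (intro exI[of _ i] exI[of _ "nat (j - i)"]) (simp add: algebra_simps)
  qed
  define K where "K = 2 / min (u - a) (b - v)"
  have K: "\<bar>slope x\<bar> \<le> K" if "u \<le> x" "x \<le> v" for x
  proof -
    have "slope x \<le> 2 / min (x - a) (b - x)" by (rule slope_le) (use that assms in auto)
    also have "\<dots> \<le> K" unfolding K_def using that assms by (intro divide_left_mono) auto
    finally show ?thesis using slope_nonneg[of x] that assms by auto
  qed
  let ?s = "\<lambda>m x. indicator {u..<v} x * slope (round_up m x)"
  let ?f = "\<lambda>x. indicator {u..<v} x * dens x"
  have step: "\<exists>I. has_bochner_integral lborel (?s m) I \<and> \<bar>q (u - a) (b - v) (v - u) - I\<bar> \<le> mesh m * (2 * K)"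
    if "m \<ge> M" for m
  proof -
    from grid[OF that] obtain k N where kN: "u = of_int k * mesh m" "v = u + real N * mesh m" "0 < N" by blast
    show ?thesis
      using integral_step[OF kN(1), of N] slope_riemann_sum[OF assms(1,3) kN(2,3)] kN(2)
      by (auto simp: K_def)
  qed
  have bound: "\<bar>?s m x\<bar> \<le> K * indicator {u..<v} x" if m: "m \<ge> M" for m x
  proof (cases "x \<in> {u..<v}")
    case True
    from M m obtain j where j: "v = of_int j * mesh m" by blast
    have "round_up m x \<le> v"
    proof -
      have "\<lfloor>x / mesh m\<rfloor> < j" using True j by (simp add: floor_less_iff field_simps)
      then have "of_int (\<lfloor>x / mesh m\<rfloor> + 1) \<le> (of_int j :: real)" by linarith
      then show ?thesis unfolding round_up_def j by (intro mult_right_mono) (auto simp: less_imp_le)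
    qed
    then show ?thesis using True K[of "round_up m x"] round_up_bounds(1)[of x m] by auto
  qed simp
  have lim: "(\<lambda>m. ?s m x) \<longlonglongrightarrow> ?f x" for x
    by (cases "x \<in> {u..<v}") (use assms in \<open>auto intro!: slope_round_up\<close>)
  have meas: "?s (m + M) \<in> borel_measurable lborel" for m
    using step[of "m + M"] by (auto simp: has_bochner_integral_iff)
  have fmeas: "?f \<in> borel_measurable lborel"
    by (rule borel_measurable_LIMSEQ_real[OF LIMSEQ_ignore_initial_segment[OF lim] meas])
  have dom: "integrable lborel (\<lambda>x. K * indicator {u..<v} x)"
    using assms by (intro integrable_mult_right integrable_real_indicator) auto
  have lim': "AE x in lborel. (\<lambda>m. ?s (m + M) x) \<longlonglongrightarrow> ?f x"
    using LIMSEQ_ignore_initial_segment[OF lim] by auto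
  have bound': "AE x in lborel. norm (?s (m + M) x) \<le> K * indicator {u..<v} x" for m
    using bound[of "m + M"] by auto
  note dc = integral_dominated_convergence[OF fmeas meas dom lim' bound']
    integrable_dominated_convergence[OF fmeas meas dom lim' bound']
  have "(\<lambda>m. integral\<^sup>L lborel (?s (m + M))) \<longlonglongrightarrow> q (u - a) (b - v) (v - u)"
  proof -
    have 1: "\<bar>integral\<^sup>L lborel (?s (m + M)) - q (u - a) (b - v) (v - u)\<bar> \<le> 2 * K * mesh (m + M)" for m
      using step[of "m + M"] by (auto simp: has_bochner_integral_iff abs_minus_commute algebra_simps)
    have 2: "(\<lambda>m. 2 * K * mesh (m + M)) \<longlonglongrightarrow> 0"
      by (rule tendsto_mult_right_zero) (rule LIMSEQ_ignore_initial_segment[OF mesh_tendsto_0])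
    have "(\<lambda>m. integral\<^sup>L lborel (?s (m + M)) - q (u - a) (b - v) (v - u)) \<longlonglongrightarrow> 0"
      by (rule Lim_null_comparison[OF _ 2]) (use 1 in \<open>simp add: always_eventually\<close>)
    then show ?thesis by (simp add: LIM_zero_iff)
  qed
  with dc(1) have int: "integral\<^sup>L lborel ?f = q (u - a) (b - v) (v - u)" by (rule LIMSEQ_unique)
  have "(\<integral>\<^sup>+x. indicator {u..<v} x * ennreal (dens x) \<partial>lborel) = (\<integral>\<^sup>+x. ennreal (?f x) \<partial>lborel)"
    by (intro nn_integral_cong) (simp add: indicator_def)
  also have "\<dots> = ennreal (integral\<^sup>L lborel ?f)"
    using assms by (intro nn_integral_eq_integral dc(2)) (auto simp: indicator_def intro!: dens_nonneg)
  finally show ?thesis unfolding int .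
qed

sublocale variation: one_sided_variation dens a b
  by unfold_locales (use ab in \<open>auto intro!: dens_nonneg dens_right_continuous variation_dens\<close>)

end

subsection \<open>Paths, laws and first points\<close>

lemma space_path_space [simp]: "space path_space = UNIV"
  by (simp add: path_space_def space_PiM)

lemma measurable_path_space_iff:
  "g \<in> M \<rightarrow>\<^sub>M path_space \<longleftrightarrow> (\<forall>t. (\<lambda>\<omega>. g \<omega> t) \<in> borel_measurable M)"
proof
  assume g: "g \<in> M \<rightarrow>\<^sub>M path_space"
  have "(\<lambda>f. f t) \<in> borel_measurable path_space" for t :: real
    unfolding path_space_def by (rule measurable_component_singleton) simp
  then show "\<forall>t. (\<lambda>\<omega>. g \<omega> t) \<in> borel_measurable M"
    using measurable_compose[OF g] by blast
next
  assume "\<forall>t. (\<lambda>\<omega>. g \<omega> t) \<in> borel_measurable M"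
  then show "g \<in> M \<rightarrow>\<^sub>M path_space"
    unfolding path_space_def by (intro measurable_PiM_single') (auto simp: space_PiM PiE_def extensional_def)
qed

lemma space_cylindrical [simp]: "space (cylindrical H) = H"
  by (simp add: cylindrical_def space_restrict_space)

lemma sets_cylindrical: "sets (cylindrical H) = (\<lambda>A. H \<inter> A) ` sets path_space"
  by (simp add: cylindrical_def sets_restrict_space)

lemma measurable_cylindricalI:
  assumes "\<And>\<omega>. \<omega> \<in> space M \<Longrightarrow> g \<omega> \<in> H" "\<And>t. (\<lambda>\<omega>. g \<omega> t) \<in> borel_measurable M"
  shows "g \<in> M \<rightarrow>\<^sub>M cylindrical H"
  unfolding cylindrical_def
  by (rule measurable_restrict_space2) (use assms measurable_path_space_iff in auto)

text \<open>The joint measurability of evaluation in \<open>LI_set\<close> is what allows a random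
  time here; later the time is a second coordinate next to the path.\<close>

lemma measurable_cylindrical_eval:
  assumes "LI_set H" and g: "g \<in> M \<rightarrow>\<^sub>M cylindrical H" and s: "s \<in> borel_measurable M"
  shows "(\<lambda>\<omega>. g \<omega> (s \<omega>)) \<in> borel_measurable M"
proof -
  have "(\<lambda>(f, t). f t) \<in> borel_measurable (cylindrical H \<Otimes>\<^sub>M borel)"
    using assms(1) by (simp add: LI_set_def)
  from measurable_compose[OF measurable_Pair[OF g s] this] show ?thesis by simp
qed

lemma space_ext_line: "space ext_line = insert \<infinity> (range ereal)"
  unfolding ext_line_def by (rule space_measure_of) auto

lemma in_space_ext_line: "x \<in> space ext_line \<longleftrightarrow> x \<noteq> -\<infinity>"
  by (cases x) (auto simp: space_ext_line)

lemma sets_ext_line: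
  "sets ext_line = sigma_sets (insert \<infinity> (range ereal)) (insert {\<infinity>} ((\<lambda>B. ereal ` B) ` sets borel))"
  unfolding ext_line_def by (rule sets_measure_of) auto

lemma infinity_in_ext_line: "{\<infinity>} \<in> sets ext_line"
  unfolding sets_ext_line by (rule sigma_sets.Basic) simp

lemma ereal_image_in_ext_line: "B \<in> sets borel \<Longrightarrow> ereal ` B \<in> sets ext_line"
  unfolding sets_ext_line by (rule sigma_sets.Basic) simp

lemma real_of_ereal_ext_line: "real_of_ereal \<in> borel_measurable ext_line"
proof (rule measurableI)
  fix B :: "real set" assume B: "B \<in> sets borel"
  \<comment> \<open>\<open>real_of_ereal\<close> sends infinity to 0, so infinity belongs to the
    preimage exactly if 0 belongs to \<open>B\<close>.\<close>
  have eq: "real_of_ereal -` B \<inter> space ext_line = ereal ` B \<union> (if 0 \<in> B then {\<infinity>} else {})"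
  proof (rule set_eqI)
    fix x show "x \<in> real_of_ereal -` B \<inter> space ext_line \<longleftrightarrow> x \<in> ereal ` B \<union> (if 0 \<in> B then {\<infinity>} else {})"
      by (cases x) (auto simp: in_space_ext_line)
  qed
  show "real_of_ereal -` B \<inter> space ext_line \<in> sets ext_line"
    unfolding eq by (intro sets.Un ereal_image_in_ext_line B) (simp add: infinity_in_ext_line)
qed auto

lemma measurable_ext_lineI:
  assumes F: "\<And>x. x \<in> space M \<Longrightarrow> F x \<noteq> -\<infinity>"
    and inf: "{x \<in> space M. F x = \<infinity>} \<in> sets M"
    and re: "(\<lambda>x. real_of_ereal (F x)) \<in> borel_measurable M"
  shows "F \<in> M \<rightarrow>\<^sub>M ext_line"
proof (rule measurable_sigma_sets[OF sets_ext_line])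
  show "F \<in> space M \<rightarrow> insert \<infinity> (range ereal)"
  proof
    fix x assume "x \<in> space M"
    then show "F x \<in> insert \<infinity> (range ereal)" using F[of x] by (cases "F x") auto
  qed
  fix A :: "ereal set" assume "A \<in> insert {\<infinity>} ((\<lambda>B. ereal ` B) ` sets borel)"
  then consider "A = {\<infinity>}" | B where "B \<in> sets borel" "A = ereal ` B" by auto
  then show "F -` A \<inter> space M \<in> sets M"
  proof cases
    case 1
    then have "F -` A \<inter> space M = {x \<in> space M. F x = \<infinity>}" by auto
    then show ?thesis using inf by simp
  next
    case 2
    have "F x \<in> ereal ` B \<longleftrightarrow> F x \<noteq> \<infinity> \<and> real_of_ereal (F x) \<in> B" if "x \<in> space M" for x
      using F[OF that] by (cases "F x") auto
    then have "F -` A \<inter> space M = ((\<lambda>x. real_of_ereal (F x)) -` B \<inter> space M) - {x \<in> space M. F x = \<infinity>}"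
      using 2 by auto
    then show ?thesis using measurable_sets[OF re 2(1)] inf by auto
  qed
qed auto

lemma minus_ereal_ext_line: "(\<lambda>x. x - ereal c) \<in> ext_line \<rightarrow>\<^sub>M ext_line"
proof (rule measurable_ext_lineI)
  have "{x \<in> space ext_line. x - ereal c = \<infinity>} = {\<infinity>}"
  proof (rule set_eqI)
    fix x show "x \<in> {x \<in> space ext_line. x - ereal c = \<infinity>} \<longleftrightarrow> x \<in> {\<infinity>}"
      by (cases x) (auto simp: in_space_ext_line)
  qed
  then show "{x \<in> space ext_line. x - ereal c = \<infinity>} \<in> sets ext_line"
    by (simp add: infinity_in_ext_line)
  have "(\<lambda>x. if x \<in> {\<infinity>} then 0 else real_of_ereal x - c) \<in> borel_measurable ext_line"
    by (intro measurable_If_set measurable_const borel_measurable_diff real_of_ereal_ext_line)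
      (auto simp: space_ext_line infinity_in_ext_line insert_absorb)
  moreover have "real_of_ereal (x - ereal c) = (if x \<in> {\<infinity>} then 0 else real_of_ereal x - c)"
    if "x \<in> space ext_line" for x
    using that by (cases x) (auto simp: in_space_ext_line)
  ultimately show "(\<lambda>x. real_of_ereal (x - ereal c)) \<in> borel_measurable ext_line"
    by (subst measurable_cong) auto
next
  fix x assume "x \<in> space ext_line"
  then show "x - ereal c \<noteq> -\<infinity>" by (cases x) (auto simp: in_space_ext_line)
qed

section \<open>Recentred paths and the law on H\<close>

definition recentre :: "(real \<Rightarrow> real) \<Rightarrow> real \<Rightarrow> real" where
  "recentre f = (\<lambda>x. f x - f 0)"

lemma recentre_shift: "recentre (shift s f) = (\<lambda>x. f (x + s) - f s)"
  by (simp add: recentre_def shift_def)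

text \<open>Recentring forgets only an additive constant, which the second recentring removes
  anyway. A shift can therefore be undone after recentring.\<close>

lemma recentre_shift_recentre_shift: "recentre (shift s (recentre (shift r f))) = recentre (shift (r + s) f)"
  by (simp add: recentre_shift algebra_simps)

lemma shift_shift: "shift s (shift r f) = shift (r + s) f"
  by (simp add: shift_def algebra_simps)

lemma recentre_shift_add: "recentre (shift s (\<lambda>x. f x + c)) = recentre (shift s f)"
  by (simp add: recentre_shift)

lemma recentre_in: "LI_set H \<Longrightarrow> f \<in> H \<Longrightarrow> recentre f \<in> H"
proof -
  assume "LI_set H" "f \<in> H"
  then have "(\<lambda>x. f x + - f 0) \<in> H" unfolding LI_set_def by blast
  then show ?thesis by (simp add: recentre_def)
qed

lemma shift_in: "LI_set H \<Longrightarrow> f \<in> H \<Longrightarrow> shift c f \<in> H"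
  by (simp add: LI_set_def)

lemma measurable_recentre_shift:
  assumes "LI_set H" and g: "g \<in> M \<rightarrow>\<^sub>M cylindrical H" and s: "s \<in> borel_measurable M"
  shows "(\<lambda>\<omega>. recentre (shift (s \<omega>) (g \<omega>))) \<in> M \<rightarrow>\<^sub>M cylindrical H"
proof (rule measurable_cylindricalI)
  fix \<omega> assume "\<omega> \<in> space M"
  then have "g \<omega> \<in> H" using measurable_space[OF g] by simp
  then show "recentre (shift (s \<omega>) (g \<omega>)) \<in> H" using assms(1) by (intro recentre_in shift_in)
next
  fix t
  show "(\<lambda>\<omega>. recentre (shift (s \<omega>) (g \<omega>)) t) \<in> borel_measurable M"
    unfolding recentre_shift
    by (intro borel_measurable_diff measurable_cylindrical_eval[OF assms(1) g] borel_measurable_add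
        borel_measurable_const s)
qed

lemma measurable_recentre_shift_const:
  "LI_set H \<Longrightarrow> (\<lambda>f. recentre (shift s f)) \<in> cylindrical H \<rightarrow>\<^sub>M cylindrical H"
  by (rule measurable_recentre_shift) auto

definition increment_law :: "(real \<Rightarrow> real) set \<Rightarrow> (real \<Rightarrow> real) measure \<Rightarrow> real \<Rightarrow> (real \<Rightarrow> real) measure" where
  "increment_law H N h = distr N (cylindrical H) (\<lambda>f. recentre (shift h f))"

text \<open>\<open>H\<close> need not be measurable in \<open>path_space\<close>. The measurable
  sets of \<open>cylindrical H\<close> are traces, and a map into \<open>H\<close> has the same
  preimage for a set and for its trace.\<close>

lemma distr_path_space_eq_iff:
  assumes g: "g \<in> N \<rightarrow>\<^sub>M cylindrical H" and g': "g' \<in> N \<rightarrow>\<^sub>M cylindrical H"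
  shows "distr N path_space g = distr N path_space g' \<longleftrightarrow> distr N (cylindrical H) g = distr N (cylindrical H) g'"
proof
  have id: "(\<lambda>f. f) \<in> cylindrical H \<rightarrow>\<^sub>M path_space"
    unfolding cylindrical_def by (rule measurable_restrict_space1) simp
  have gp: "g \<in> N \<rightarrow>\<^sub>M path_space" "g' \<in> N \<rightarrow>\<^sub>M path_space"
    using measurable_compose[OF g id] measurable_compose[OF g' id] by auto
  {
    assume eq: "distr N path_space g = distr N path_space g'"
    show "distr N (cylindrical H) g = distr N (cylindrical H) g'"
    proof (rule measure_eqI)
      fix B assume "B \<in> sets (distr N (cylindrical H) g)"
      then obtain A where A: "A \<in> sets path_space" "B = H \<inter> A" by (auto simp: sets_cylindrical)
      have pre: "k -` B \<inter> space N = k -` A \<inter> space N" if "k \<in> N \<rightarrow>\<^sub>M cylindrical H" for k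
        using measurable_space[OF that] A(2) by auto
      have B: "B \<in> sets (cylindrical H)" using A by (auto simp: sets_cylindrical)
      have "emeasure (distr N path_space g) A = emeasure (distr N path_space g') A"
        using eq by simp
      then show "emeasure (distr N (cylindrical H) g) B = emeasure (distr N (cylindrical H) g') B"
        using A(1) B g g' gp by (simp add: emeasure_distr pre)
    qed simp
  }
  assume "distr N (cylindrical H) g = distr N (cylindrical H) g'"
  then have "distr (distr N (cylindrical H) g) path_space (\<lambda>f. f) = distr (distr N (cylindrical H) g') path_space (\<lambda>f. f)"
    by simp
  then show "distr N path_space g = distr N path_space g'"
    by (simp add: distr_distr[OF id g] distr_distr[OF id g'] comp_def)
qed

text \<open>The paths lying in \<open>H\<close> form an event of the completion only. Off that
  event, which has full probability, the path is redirected to a fixed \<open>f0\<close>; this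
  changes neither the laws of locations nor those of increments, and the problem moves to a law on
  \<open>H\<close> itself.\<close>

lemma path_law_reduction:
  fixes M :: "'a measure" and X :: "real \<Rightarrow> 'a \<Rightarrow> real"
  assumes "prob_space M" and LI: "LI_set H" and X: "\<And>t. X t \<in> borel_measurable M"
    and AE: "AE \<omega> in M. (\<lambda>t. X t \<omega>) \<in> H"
  obtains N where "prob_space N" "sets N = sets (cylindrical H)"
    "stationary_increments M X \<longleftrightarrow> (\<forall>h. increment_law H N h = increment_law H N 0)"
    "\<And>L I. doubly_intrinsic_location H L \<Longrightarrow> I \<in> intervals \<Longrightarrow>
      ext_law M (path_location H L X I) = distr N ext_line (\<lambda>f. L f I)"
    "\<And>L I c. doubly_intrinsic_location H L \<Longrightarrow> I \<in> intervals \<Longrightarrow>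
      ext_law M (\<lambda>\<omega>. path_location H L X I \<omega> - ereal c) = distr N ext_line (\<lambda>f. L f I - ereal c)"
proof -
  interpret M: prob_space M by fact
  let ?C = "cylindrical H" and ?cM = "completion M"
  \<comment> \<open>A path \<open>f0\<close> in \<open>H\<close> exists because an almost sure
    property holds somewhere in a probability space.\<close>
  have "\<exists>\<omega>. (\<lambda>t. X t \<omega>) \<in> H"
  proof (rule ccontr)
    assume no: "\<not> (\<exists>\<omega>. (\<lambda>t. X t \<omega>) \<in> H)"
    from AE have "AE \<omega> in M. False" by eventually_elim (use no in blast)
    then show False by (simp add: M.AE_False)
  qed
  then obtain f0 where f0: "f0 \<in> H" by blast
  obtain Z where Z: "{\<omega> \<in> space M. (\<lambda>t. X t \<omega>) \<notin> H} \<subseteq> Z" "Z \<in> null_sets M"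
    using AE by (auto simp: eventually_ae_filter)
  define \<Omega> where "\<Omega> = {\<omega> \<in> space M. (\<lambda>t. X t \<omega>) \<in> H}"
  have "space M - \<Omega> \<in> null_sets ?cM"
    using Z by (intro null_sets_completionI null_sets_completion_subset[of _ Z]) (auto simp: \<Omega>_def)
  then have "space M - (space M - \<Omega>) \<in> sets ?cM"
    using sets.compl_sets[of "space M - \<Omega>" ?cM] by auto
  moreover have "space M - (space M - \<Omega>) = \<Omega>" by (auto simp: \<Omega>_def)
  ultimately have \<Omega>: "\<Omega> \<in> sets ?cM" by simp
  define Y where "Y \<omega> = (if \<omega> \<in> \<Omega> then (\<lambda>t. X t \<omega>) else f0)" for \<omega>
  have XC: "X t \<in> borel_measurable ?cM" for t by (rule measurable_completion[OF X])
  have Y: "Y \<in> ?cM \<rightarrow>\<^sub>M ?C"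
  proof (rule measurable_cylindricalI)
    fix \<omega> show "Y \<omega> \<in> H" using f0 by (auto simp: Y_def \<Omega>_def)
  next
    fix t
    have "(\<lambda>\<omega>. if \<omega> \<in> \<Omega> then X t \<omega> else f0 t) \<in> borel_measurable ?cM"
      using \<Omega> sets.sets_into_space[OF \<Omega>] by (intro measurable_If_set XC) (auto simp: Int_absorb2)
    moreover have "(\<lambda>\<omega>. Y \<omega> t) = (\<lambda>\<omega>. if \<omega> \<in> \<Omega> then X t \<omega> else f0 t)"
      by (auto simp: Y_def)
    ultimately show "(\<lambda>\<omega>. Y \<omega> t) \<in> borel_measurable ?cM" by simp
  qed
  define N where "N = distr ?cM ?C Y"
  have cM: "prob_space ?cM" by (rule M.prob_space_completion)
  have AE\<Omega>: "AE \<omega> in ?cM. \<omega> \<in> \<Omega>"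
    using AE_completion[OF AE] AE_space by eventually_elim (simp add: \<Omega>_def)
  have loc: "(\<lambda>f. L f I) \<in> ?C \<rightarrow>\<^sub>M ext_line" if "doubly_intrinsic_location H L" "I \<in> intervals" for L I
    using that by (simp add: doubly_intrinsic_location_def intrinsic_location_def)
  have law: "path_location H L X I \<in> ?cM \<rightarrow>\<^sub>M ext_line \<and>
      distr ?cM ext_line (path_location H L X I) = distr N ext_line (\<lambda>f. L f I)"
    if LI': "doubly_intrinsic_location H L" "I \<in> intervals" for L I
  proof
    have LY: "(\<lambda>\<omega>. L (Y \<omega>) I) \<in> ?cM \<rightarrow>\<^sub>M ext_line"
      by (rule measurable_compose[OF Y loc[OF LI']])
    have "(\<lambda>\<omega>. if \<omega> \<in> \<Omega> then L (Y \<omega>) I else \<infinity>) \<in> ?cM \<rightarrow>\<^sub>M ext_line"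
      using \<Omega> sets.sets_into_space[OF \<Omega>]
      by (intro measurable_If_set LY measurable_const) (auto simp: Int_absorb2 space_ext_line)
    moreover have "path_location H L X I \<omega> = (if \<omega> \<in> \<Omega> then L (Y \<omega>) I else \<infinity>)" if "\<omega> \<in> space ?cM" for \<omega>
      using that by (auto simp: path_location_def Y_def \<Omega>_def)
    ultimately show pl: "path_location H L X I \<in> ?cM \<rightarrow>\<^sub>M ext_line"
      by (subst measurable_cong) auto
    have "distr ?cM ext_line (path_location H L X I) = distr ?cM ext_line (\<lambda>\<omega>. L (Y \<omega>) I)"
    proof (rule distr_cong_AE[OF refl refl _ pl LY])
      show "AE \<omega> in ?cM. path_location H L X I \<omega> = L (Y \<omega>) I"
        using AE\<Omega> by eventually_elim (simp add: path_location_def Y_def \<Omega>_def)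
    qed
    also have "\<dots> = distr N ext_line (\<lambda>f. L f I)"
      unfolding N_def by (subst distr_distr[OF loc[OF LI'] Y]) (simp add: comp_def)
    finally show "distr ?cM ext_line (path_location H L X I) = distr N ext_line (\<lambda>f. L f I)" .
  qed
  have st: "distr M path_space (\<lambda>\<omega> t. X (t + h) \<omega> - X h \<omega>) = distr N path_space (\<lambda>f. recentre (shift h f))" for h
  proof -
    have m: "(\<lambda>\<omega> t. X (t + h) \<omega> - X h \<omega>) \<in> M \<rightarrow>\<^sub>M path_space"
      unfolding measurable_path_space_iff by (intro allI borel_measurable_diff X)
    have id: "(\<lambda>f. f) \<in> ?C \<rightarrow>\<^sub>M path_space"
      unfolding cylindrical_def by (rule measurable_restrict_space1) simp
    have r: "(\<lambda>f. recentre (shift h f)) \<in> ?C \<rightarrow>\<^sub>M path_space"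
      by (rule measurable_compose[OF measurable_recentre_shift_const[OF LI] id])
    have "distr M path_space (\<lambda>\<omega> t. X (t + h) \<omega> - X h \<omega>) = distr ?cM path_space (\<lambda>\<omega> t. X (t + h) \<omega> - X h \<omega>)"
      by (rule distr_completion[OF m, symmetric])
    also have "\<dots> = distr ?cM path_space (\<lambda>\<omega>. recentre (shift h (Y \<omega>)))"
    proof (rule distr_cong_AE[OF refl refl _ measurable_completion[OF m] measurable_compose[OF Y r]])
      show "AE \<omega> in ?cM. (\<lambda>t. X (t + h) \<omega> - X h \<omega>) = recentre (shift h (Y \<omega>))"
        using AE\<Omega> by eventually_elim (simp add: recentre_shift Y_def)
    qed
    also have "\<dots> = distr N path_space (\<lambda>f. recentre (shift h f))"
      unfolding N_def by (subst distr_distr[OF r Y]) (simp add: comp_def)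
    finally show ?thesis .
  qed
  have setsN: "sets N = sets ?C" by (simp add: N_def)
  show thesis
  proof (rule that[of N])
    show "prob_space N" unfolding N_def by (rule prob_space.prob_space_distr[OF cM Y])
    show "sets N = sets ?C" by fact
    have rN: "(\<lambda>f. recentre (shift h f)) \<in> N \<rightarrow>\<^sub>M ?C" for h
      using measurable_recentre_shift_const[OF LI] by (simp add: measurable_cong_sets[OF setsN refl])
    have "stationary_increments M X \<longleftrightarrow>
        (\<forall>h. distr N path_space (\<lambda>f. recentre (shift h f)) = distr N path_space (\<lambda>f. recentre (shift 0 f)))"
      unfolding stationary_increments_def using st st[of 0] by simp
    also have "\<dots> \<longleftrightarrow> (\<forall>h. increment_law H N h = increment_law H N 0)"
      unfolding increment_law_def by (intro all_cong1 distr_path_space_eq_iff rN)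
    finally show "stationary_increments M X \<longleftrightarrow> (\<forall>h. increment_law H N h = increment_law H N 0)" .
  next
    fix L I assume "doubly_intrinsic_location H L" "I \<in> intervals"
    from law[OF this] show "ext_law M (path_location H L X I) = distr N ext_line (\<lambda>f. L f I)"
      by (simp add: ext_law_def)
  next
    fix L I c assume LI': "doubly_intrinsic_location H L" "I \<in> intervals"
    have pl: "path_location H L X I \<in> ?cM \<rightarrow>\<^sub>M ext_line" using law[OF LI'] by simp
    have lN: "(\<lambda>f. L f I) \<in> N \<rightarrow>\<^sub>M ext_line"
      using loc[OF LI'] by (simp add: measurable_cong_sets[OF setsN refl])
    have "ext_law M (\<lambda>\<omega>. path_location H L X I \<omega> - ereal c) =
        distr (distr ?cM ext_line (path_location H L X I)) ext_line (\<lambda>x. x - ereal c)"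
      unfolding ext_law_def by (subst distr_distr[OF minus_ereal_ext_line pl]) (simp add: comp_def)
    also have "\<dots> = distr (distr N ext_line (\<lambda>f. L f I)) ext_line (\<lambda>x. x - ereal c)"
      using law[OF LI'] by simp
    also have "\<dots> = distr N ext_line (\<lambda>f. L f I - ereal c)"
      by (subst distr_distr[OF minus_ereal_ext_line lN]) (simp add: comp_def)
    finally show "ext_law M (\<lambda>\<omega>. path_location H L X I \<omega> - ereal c) = distr N ext_line (\<lambda>f. L f I - ereal c)" .
  qed
qed

section \<open>First points of shift-equivariant closed sets\<close>

definition first_point :: "((real \<Rightarrow> real) \<Rightarrow> real set) \<Rightarrow> (real \<Rightarrow> real) \<Rightarrow> real set \<Rightarrow> ereal" where
  "first_point R f I = (if R f \<inter> I = {} then \<infinity> else ereal (Inf (R f \<inter> I)))"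

text \<open>A random closed set that depends on the increments of the path alone. Hitting events are
  required for \<open>a = b\<close> too, which makes membership of a single point an event.\<close>

definition point_field :: "(real \<Rightarrow> real) set \<Rightarrow> ((real \<Rightarrow> real) \<Rightarrow> real set) \<Rightarrow> bool" where
  "point_field H R \<longleftrightarrow>
    (\<forall>f\<in>H. closed (R f)) \<and>
    (\<forall>f\<in>H. \<forall>c x. x \<in> R (shift c f) \<longleftrightarrow> x + c \<in> R f) \<and>
    (\<forall>f\<in>H. \<forall>c. R (\<lambda>x. f x + c) = R f) \<and>
    (\<forall>a b. a \<le> b \<longrightarrow> {f \<in> H. R f \<inter> {a..b} \<noteq> {}} \<in> sets (cylindrical H))"

text \<open>Closedness makes the infimum attained. The point found is minimal among all points of
  \<open>R f\<close> from \<open>a\<close> on, not only up to \<open>b\<close>; so moving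
  \<open>b\<close> does not change it as long as it stays in the interval.\<close>

lemma first_point_cases:
  assumes "closed (R f)"
  obtains "R f \<inter> {a..b} = {}" "first_point R f {a..b} = \<infinity>"
  | x where "x \<in> R f" "a \<le> x" "x \<le> b" "\<And>y. y \<in> R f \<Longrightarrow> a \<le> y \<Longrightarrow> x \<le> y"
      "first_point R f {a..b} = ereal x"
proof (cases "R f \<inter> {a..b} = {}")
  case False
  let ?x = "Inf (R f \<inter> {a..b})"
  have bdd: "bdd_below (R f \<inter> {a..b})" by (rule bdd_belowI[of _ a]) auto
  have "?x \<in> R f \<inter> {a..b}"
    using False bdd assms by (intro closed_contains_Inf) auto
  moreover have "?x \<le> y" if "y \<in> R f" "a \<le> y" for y
  proof (cases "y \<le> b")
    case True
    then show ?thesis using that by (intro cInf_lower[OF _ bdd]) auto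
  next
    case False
    then show ?thesis using calculation by auto
  qed
  ultimately show ?thesis using False that(2)[of ?x] by (auto simp: first_point_def)
qed (use that(1) in \<open>auto simp: first_point_def\<close>)

lemma first_point_eqI:
  assumes "closed (R f)" "x \<in> R f" "a \<le> x" "x \<le> b" "\<And>y. y \<in> R f \<Longrightarrow> a \<le> y \<Longrightarrow> y < x \<Longrightarrow> False"
  shows "first_point R f {a..b} = ereal x"
  using assms(1)
proof (cases rule: first_point_cases[where R = R and f = f and a = a and b = b])
  case 1
  then show ?thesis using assms by auto
next
  case (2 y)
  then show ?thesis using assms(2,3) 2(4)[of x] assms(5)[of y] by (auto simp: not_le less_le)
qed

lemma first_point_infty_iff: "first_point R f {a..b} = \<infinity> \<longleftrightarrow> R f \<inter> {a..b} = {}"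
  by (simp add: first_point_def)

text \<open>Minimality gives the behaviour under restriction, equivariance the translation rule. For
  measurability, the first point is at most \<open>x\<close> exactly if the set hits
  \<open>[a, min x b]\<close>.\<close>

lemma first_point_doubly_intrinsic:
  assumes LI: "LI_set H" and R: "point_field H R"
  shows "doubly_intrinsic_location H (first_point R)"
proof -
  have cl: "closed (R f)" if "f \<in> H" for f using R that by (simp add: point_field_def)
  have sh: "x \<in> R (shift c f) \<longleftrightarrow> x + c \<in> R f" if "f \<in> H" for f c x
    using R that by (simp add: point_field_def)
  have ad: "R (\<lambda>x. f x + c) = R f" if "f \<in> H" for f c
    using R that by (simp add: point_field_def)
  have hit: "{f \<in> H. R f \<inter> {a..b} \<noteq> {}} \<in> sets (cylindrical H)" if "a \<le> b" for a b
    using R that by (simp add: point_field_def)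
  have meas: "(\<lambda>f. first_point R f {a..b}) \<in> cylindrical H \<rightarrow>\<^sub>M ext_line" if ab: "a < b" for a b
  proof (rule measurable_ext_lineI)
    show "first_point R f {a..b} \<noteq> -\<infinity>" for f by (simp add: first_point_def)
    have inf: "{f \<in> space (cylindrical H). first_point R f {a..b} = \<infinity>} =
        space (cylindrical H) - {f \<in> H. R f \<inter> {a..b} \<noteq> {}}"
      by (auto simp: first_point_infty_iff)
    show i: "{f \<in> space (cylindrical H). first_point R f {a..b} = \<infinity>} \<in> sets (cylindrical H)"
      unfolding inf using hit ab by (intro sets.compl_sets) auto
    show "(\<lambda>f. real_of_ereal (first_point R f {a..b})) \<in> borel_measurable (cylindrical H)"
      unfolding borel_measurable_iff_le
    proof
      fix x
      \<comment> \<open>The second alternative reflects the value 0 of \<open>real_of_ereal\<close>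
        at infinity.\<close>
      have iff: "real_of_ereal (first_point R f {a..b}) \<le> x \<longleftrightarrow>
          (a \<le> x \<and> R f \<inter> {a..min x b} \<noteq> {}) \<or> (0 \<le> x \<and> first_point R f {a..b} = \<infinity>)" if "f \<in> H" for f
        using cl[OF that]
      proof (cases rule: first_point_cases[where R = R and f = f and a = a and b = b])
        case 1
        then have "R f \<inter> {a..min x b} = {}" by auto
        then show ?thesis unfolding 1(2) by simp
      next
        case (2 y)
        have "y \<le> x \<longleftrightarrow> a \<le> x \<and> R f \<inter> {a..min x b} \<noteq> {}"
        proof
          assume "y \<le> x"
          then show "a \<le> x \<and> R f \<inter> {a..min x b} \<noteq> {}" using 2 by auto
        next
          assume "a \<le> x \<and> R f \<inter> {a..min x b} \<noteq> {}"
          then obtain z where "z \<in> R f" "a \<le> z" "z \<le> x" by auto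
          then show "y \<le> x" using 2(4)[of z] by auto
        qed
        then show ?thesis using 2 by simp
      qed
      have "{f \<in> space (cylindrical H). real_of_ereal (first_point R f {a..b}) \<le> x} =
          (if a \<le> x then {f \<in> H. R f \<inter> {a..min x b} \<noteq> {}} else {}) \<union>
          (if 0 \<le> x then {f \<in> space (cylindrical H). first_point R f {a..b} = \<infinity>} else {})"
        using iff by auto
      also have "\<dots> \<in> sets (cylindrical H)"
        using i hit[of a "min x b"] ab by (intro sets.Un) auto
      finally show "{f \<in> space (cylindrical H). real_of_ereal (first_point R f {a..b}) \<le> x} \<in> sets (cylindrical H)" .
    qed
  qed
  have range: "first_point R f {a..b} \<in> ereal ` {a..b} \<union> {\<infinity>}" if "f \<in> H" for f a b
    using cl[OF that] by (cases rule: first_point_cases[where R = R and f = f and a = a and b = b]) auto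
  have trans: "first_point R f {a..b} = first_point R (shift c f) ((\<lambda>x. x - c) ` {a..b}) + ereal c"
    if f: "f \<in> H" for f a b c
  proof -
    have img: "(\<lambda>x. x - c) ` {a..b} = {a - c..b - c}"
      using image_add_atLeastAtMost[of "-c" a b] by (simp add: add.commute[of "- c"] image_def)
    have "first_point R f {a..b} = first_point R (shift c f) {a - c..b - c} + ereal c"
      using cl[OF f]
    proof (cases rule: first_point_cases[where R = R and f = f and a = a and b = b])
      case 1
      have "x \<notin> R (shift c f) \<inter> {a - c..b - c}" for x
      proof
        assume "x \<in> R (shift c f) \<inter> {a - c..b - c}"
        then have "x + c \<in> R f \<inter> {a..b}" using sh[OF f] by auto
        then show False using 1 by auto
      qed
      then show ?thesis using 1 first_point_infty_iff[of R "shift c f" "a - c" "b - c"] by auto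
    next
      case (2 x)
      have "first_point R (shift c f) {a - c..b - c} = ereal (x - c)"
      proof (rule first_point_eqI)
        show "closed (R (shift c f))" using cl shift_in[OF LI f] by auto
        show "x - c \<in> R (shift c f)" using sh[OF f] 2 by simp
      next
        fix y assume y: "y \<in> R (shift c f)" "a - c \<le> y" "y < x - c"
        then have "x \<le> y + c" using 2(4)[of "y + c"] sh[OF f] by auto
        then show False using y by simp
      qed (use 2 in auto)
      then show ?thesis using 2 by simp
    qed
    then show ?thesis unfolding img .
  qed
  have sub: "first_point R f {a2..b2} = first_point R f {a1..b1}"
    if f: "f \<in> H" and le: "{a2..b2} \<subseteq> {a1..b1}" and m: "first_point R f {a1..b1} \<in> ereal ` {a2..b2}" "a2 < b2" for f a1 b1 a2 b2
    using cl[OF f]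
  proof (cases rule: first_point_cases[where R = R and f = f and a = a1 and b = b1])
    case 1
    then show ?thesis using m by auto
  next
    case (2 x)
    then have "x \<in> {a2..b2}" using m by auto
    moreover have "a1 \<le> a2" using le m(2) by simp
    ultimately have "first_point R f {a2..b2} = ereal x"
      using 2(1,4) by (intro first_point_eqI cl f) force+
    then show ?thesis using 2 by simp
  qed
  have ext: "first_point R f I1 \<noteq> \<infinity>" if "I2 \<subseteq> I1" "first_point R f I2 \<noteq> \<infinity>" for f I1 I2
    using that by (auto simp: first_point_def split: if_splits)
  have const: "first_point R f I = first_point R (\<lambda>x. f x + c) I" if "f \<in> H" for f I c
    using ad[OF that] by (simp add: first_point_def)
  show ?thesis
    unfolding doubly_intrinsic_location_def intrinsic_location_def
  proof (intro conjI ballI allI impI)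
    fix I assume "I \<in> intervals"
    then show "(\<lambda>f. first_point R f I) \<in> cylindrical H \<rightarrow>\<^sub>M ext_line"
      using meas by (auto simp: intervals_def)
  next
    fix f I assume "f \<in> H" "I \<in> intervals"
    then show "first_point R f I \<in> ereal ` I \<union> {\<infinity>}"
      using range by (fastforce simp: intervals_def)
  next
    fix f I c assume "f \<in> H" "I \<in> intervals"
    then show "first_point R f I = first_point R (shift c f) ((\<lambda>x. x - c) ` I) + ereal c"
      using trans by (auto simp: intervals_def)
  next
    fix f I1 I2 assume f: "f \<in> H" and I: "I1 \<in> intervals" "I2 \<in> intervals"
      and *: "I2 \<subseteq> I1 \<and> first_point R f I1 \<in> ereal ` I2"
    from I obtain a1 b1 a2 b2 where "I1 = {a1..b1}" "I2 = {a2..b2}" "a2 < b2"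
      by (auto simp: intervals_def)
    then show "first_point R f I2 = first_point R f I1" using sub[OF f] * by simp
  next
    fix f I1 I2 assume "I2 \<subseteq> I1 \<and> first_point R f I2 \<noteq> \<infinity>"
    then show "first_point R f I1 \<noteq> \<infinity>" using ext by blast
  next
    fix f I c assume "f \<in> H"
    then show "first_point R f I = first_point R (\<lambda>x. f x + c) I" by (rule const)
  qed
qed

subsection \<open>Stationary increments imply the total variation constraints\<close>

locale path_law =
  fixes H :: "(real \<Rightarrow> real) set" and N :: "(real \<Rightarrow> real) measure"
  assumes LI: "LI_set H" and prob: "prob_space N" and sets_N: "sets N = sets (cylindrical H)"
begin

sublocale prob_space N by (rule prob)

lemma space_N [simp]: "space N = H"
  using sets_eq_imp_space_eq[OF sets_N] by simp

lemma measurable_N: "measurable N A = measurable (cylindrical H) A"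
  by (rule measurable_cong_sets[OF sets_N refl])

end

locale path_law_location = path_law +
  fixes L :: "(real \<Rightarrow> real) \<Rightarrow> real set \<Rightarrow> ereal"
  assumes L: "doubly_intrinsic_location H L"
begin

lemma
  shows L_measurable: "a < b \<Longrightarrow> (\<lambda>f. L f {a..b}) \<in> N \<rightarrow>\<^sub>M ext_line"
    and L_range: "f \<in> H \<Longrightarrow> a < b \<Longrightarrow> L f {a..b} \<in> ereal ` {a..b} \<union> {\<infinity>}"
    and L_sub: "f \<in> H \<Longrightarrow> a1 \<le> a2 \<Longrightarrow> a2 < b2 \<Longrightarrow> b2 \<le> b1 \<Longrightarrow> L f {a1..b1} \<in> ereal ` {a2..b2} \<Longrightarrow>
      L f {a2..b2} = L f {a1..b1}"
    and L_ext: "f \<in> H \<Longrightarrow> a1 \<le> a2 \<Longrightarrow> a2 < b2 \<Longrightarrow> b2 \<le> b1 \<Longrightarrow> L f {a1..b1} = \<infinity> \<Longrightarrow> L f {a2..b2} = \<infinity>"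
proof -
  have I: "{a..b} \<in> intervals" if "a < b" for a b :: real using that by (auto simp: intervals_def)
  note D = conjunct1[OF L[unfolded doubly_intrinsic_location_def], unfolded intrinsic_location_def]
  note D1 = D[THEN conjunct1] and D2 = D[THEN conjunct2, THEN conjunct1]
  note D4 = D[THEN conjunct2, THEN conjunct2, THEN conjunct2, THEN conjunct1]
  note D5 = D[THEN conjunct2, THEN conjunct2, THEN conjunct2, THEN conjunct2]
  show "a < b \<Longrightarrow> (\<lambda>f. L f {a..b}) \<in> N \<rightarrow>\<^sub>M ext_line"
    unfolding measurable_N using D1 I by simp
  show "f \<in> H \<Longrightarrow> a < b \<Longrightarrow> L f {a..b} \<in> ereal ` {a..b} \<union> {\<infinity>}"
    by (rule D2[rule_format, OF _ I])
  assume f: "f \<in> H" and le: "a1 \<le> a2" "a2 < b2" "b2 \<le> b1"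
  then have I': "{a1..b1} \<in> intervals" "{a2..b2} \<in> intervals" "{a2..b2} \<subseteq> {a1..b1}" using I by auto
  show "L f {a1..b1} \<in> ereal ` {a2..b2} \<Longrightarrow> L f {a2..b2} = L f {a1..b1}"
    by (rule D4[rule_format, OF f I'(1,2) conjI[OF I'(3)]])
  show "L f {a1..b1} = \<infinity> \<Longrightarrow> L f {a2..b2} = \<infinity>"
    using D5[rule_format, OF f I'(1,2) conjI[OF I'(3)]] by blast
qed

text \<open>Translation and invariance under added constants combine: the location on a moving
  interval is a fixed functional of the path recentred at \<open>c\<close>.\<close>

lemma L_recentre:
  assumes "f \<in> H" "a < b"
  shows "L f {a + c..b + c} - ereal c = L (recentre (shift c f)) {a..b}"
proof -
  have I: "{a..b} \<in> intervals" "{a + c..b + c} \<in> intervals" using assms by (auto simp: intervals_def)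
  note D = L[unfolded doubly_intrinsic_location_def intrinsic_location_def]
  note D3 = D[THEN conjunct1, THEN conjunct2, THEN conjunct2, THEN conjunct1]
  note D6 = D[THEN conjunct2]
  have img: "(\<lambda>x. x - c) ` {a + c..b + c} = {a..b}"
    using image_add_atLeastAtMost[of "-c" "a + c" "b + c"] by (simp add: add.commute[of "- c"] image_def)
  have sh: "shift c f \<in> H" by (rule shift_in[OF LI assms(1)])
  have "L f {a + c..b + c} = L (shift c f) {a..b} + ereal c"
    using D3[rule_format, OF assms(1) I(2), of c] unfolding img .
  moreover have "L (shift c f) {a..b} = L (recentre (shift c f)) {a..b}"
  proof -
    have "L (shift c f) {a..b} = L (\<lambda>x. shift c f x + - shift c f 0) {a..b}"
      by (rule D6[rule_format, OF sh I(1)])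
    then show ?thesis by (simp add: recentre_def)
  qed
  moreover have "x + ereal c - ereal c = x" if "x \<noteq> - \<infinity>" for x
    using that by (cases x) auto
  ultimately show ?thesis using L_range[OF sh assms(2)] by auto
qed

end

locale stationary_law = path_law_location +
  assumes stationary: "\<And>h. increment_law H N h = increment_law H N 0"
begin

text \<open>By \<open>L_recentre\<close> both sides are laws of one functional, under
  \<open>increment_law H N c\<close> and under \<open>increment_law H N 0\<close>. This already
  yields the shift-free laws.\<close>

lemma law_shift:
  assumes "a < b"
  shows "distr N ext_line (\<lambda>f. L f {a + c..b + c} - ereal c) = distr N ext_line (\<lambda>f. L f {a..b})"
proof -
  have r: "(\<lambda>f. recentre (shift c f)) \<in> N \<rightarrow>\<^sub>M cylindrical H" for c
    unfolding measurable_N by (rule measurable_recentre_shift_const[OF LI])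
  have l: "(\<lambda>f. L f {a..b}) \<in> cylindrical H \<rightarrow>\<^sub>M ext_line"
    using L_measurable[OF assms] unfolding measurable_N .
  have *: "distr N ext_line (\<lambda>f. L f {a + c..b + c} - ereal c) = distr (increment_law H N c) ext_line (\<lambda>f. L f {a..b})" for c
    unfolding increment_law_def distr_distr[OF l r]
    by (intro distr_cong refl) (simp add: L_recentre assms)
  have "distr N ext_line (\<lambda>f. L f {a + c..b + c} - ereal c) = distr (increment_law H N 0) ext_line (\<lambda>f. L f {a..b})"
    unfolding *[of c] stationary[of c] ..
  also have "\<dots> = distr N ext_line (\<lambda>f. L f {a..b})"
    unfolding *[of 0, symmetric] by (simp add: zero_ereal_def[symmetric])
  finally show ?thesis .
qed

definition pr :: "real \<Rightarrow> real \<Rightarrow> real set \<Rightarrow> real" where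
  "pr a b B = measure N {f \<in> H. L f {a..b} \<in> ereal ` B}"

lemma event: "a < b \<Longrightarrow> B \<in> sets borel \<Longrightarrow> {f \<in> H. L f {a..b} \<in> ereal ` B} \<in> sets N"
  using measurable_sets[OF L_measurable ereal_image_in_ext_line, of a b B]
  by (simp add: vimage_def Int_def conj_commute)

lemma event_infinity: "a < b \<Longrightarrow> {f \<in> H. L f {a..b} = \<infinity>} \<in> sets N"
  using measurable_sets[OF L_measurable infinity_in_ext_line, of a b]
  by (simp add: vimage_def Int_def conj_commute)

lemma pr_shift:
  assumes "a < b" "B \<in> sets borel" and B': "\<And>x. x \<in> B' \<longleftrightarrow> x - c \<in> B"
  shows "pr (a + c) (b + c) B' = pr a b B"
proof -
  have lm: "(\<lambda>f. L f {a + c..b + c} - ereal c) \<in> N \<rightarrow>\<^sub>M ext_line"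
    by (rule measurable_compose[OF L_measurable minus_ereal_ext_line]) (use assms in auto)
  have "measure (distr N ext_line (\<lambda>f. L f {a + c..b + c} - ereal c)) (ereal ` B)
      = measure (distr N ext_line (\<lambda>f. L f {a..b})) (ereal ` B)"
    by (simp add: law_shift[OF assms(1)])
  then have "measure N ((\<lambda>f. L f {a + c..b + c} - ereal c) -` (ereal ` B) \<inter> H) = measure N ((\<lambda>f. L f {a..b}) -` (ereal ` B) \<inter> H)"
    by (simp add: measure_distr lm L_measurable assms ereal_image_in_ext_line)
  moreover have "(\<lambda>f. L f {a..b}) -` (ereal ` B) \<inter> H = {f \<in> H. L f {a..b} \<in> ereal ` B}" by auto
  moreover have "(\<lambda>f. L f {a + c..b + c} - ereal c) -` (ereal ` B) \<inter> H = {f \<in> H. L f {a + c..b + c} \<in> ereal ` B'}"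
  proof -
    have "x - ereal c \<in> ereal ` B \<longleftrightarrow> x \<in> ereal ` B'" for x
      using B' by (cases x) (auto simp: image_iff)
    then show ?thesis unfolding vimage_def by blast
  qed
  ultimately show ?thesis by (simp add: pr_def)
qed

text \<open>A location that falls into a subinterval stays the location there, so shrinking the
  interval can only raise the chance of falling into \<open>B\<close>.\<close>

lemma pr_sub:
  assumes "a1 \<le> a2" "a2 < b2" "b2 \<le> b1" "B \<subseteq> {a2..b2}" "B \<in> sets borel"
  shows "pr a1 b1 B \<le> pr a2 b2 B"
  unfolding pr_def
proof (rule finite_measure_mono)
  show "{f \<in> H. L f {a1..b1} \<in> ereal ` B} \<subseteq> {f \<in> H. L f {a2..b2} \<in> ereal ` B}"
  proof clarsimp
    fix f x assume f: "f \<in> H" "L f {a1..b1} = ereal x" "x \<in> B"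
    then have "L f {a1..b1} \<in> ereal ` {a2..b2}" using assms(4) by auto
    from L_sub[OF f(1) assms(1,2,3) this] show "L f {a2..b2} \<in> ereal ` B" using f by auto
  qed
qed (use assms event in auto)

lemma pr_disjoint:
  assumes "a < b" "B \<in> sets borel" "B' \<in> sets borel" "B \<inter> B' = {}"
  shows "pr a b (B \<union> B') = pr a b B + pr a b B'"
proof -
  have "{f \<in> H. L f {a..b} \<in> ereal ` (B \<union> B')} = {f \<in> H. L f {a..b} \<in> ereal ` B} \<union> {f \<in> H. L f {a..b} \<in> ereal ` B'}"
    by auto
  then show ?thesis
    unfolding pr_def using assms by (auto intro!: finite_measure_Union event)
qed

lemma pr_total: "pr a b {a..b} + measure N {f \<in> H. L f {a..b} = \<infinity>} = 1" if "a < b"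
proof -
  have "{f \<in> H. L f {a..b} \<in> ereal ` {a..b}} \<union> {f \<in> H. L f {a..b} = \<infinity>} = space N"
    using L_range[OF _ that] by auto
  then have "measure N ({f \<in> H. L f {a..b} \<in> ereal ` {a..b}} \<union> {f \<in> H. L f {a..b} = \<infinity>}) = 1"
    by (simp add: prob_space[simplified])
  then show ?thesis
    unfolding pr_def by (subst (asm) finite_measure_Union) (auto intro!: event event_infinity that)
qed

definition hit :: "real \<Rightarrow> real \<Rightarrow> real \<Rightarrow> real" where
  "hit l r w = pr (- l) (w + r) {0..<w}"

text \<open>Widening the window lowers the probability of each of the three ways to miss it: a location
  on its left, one on its right, and none at all.\<close>

lemma hit_width:
  assumes "0 \<le> l" "0 \<le> r" "0 < w" "w \<le> w'"
  shows "hit l r w \<le> hit l r w'"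
proof -
  have parts: "hit l r w = 1 - pr (- l) (w + r) {- l..<0} - pr (- l) (w + r) {w..w + r}
      - measure N {f \<in> H. L f {- l..w + r} = \<infinity>}" if "0 < w" for w
  proof -
    have lt: "- l < w + r" using assms that by auto
    have dj: "{- l..<0} \<inter> ({0..<w} \<union> {w..w + r}) = {}" "{0..<w} \<inter> {w..w + r} = {}"
      using that by auto
    have "{- l..w + r} = {- l..<0} \<union> ({0..<w} \<union> {w..w + r})" using assms that by auto
    then have "pr (- l) (w + r) {- l..w + r} = pr (- l) (w + r) {- l..<0} + (hit l r w + pr (- l) (w + r) {w..w + r})"
      unfolding hit_def
      using pr_disjoint[OF lt _ _ dj(1)] pr_disjoint[OF lt _ _ dj(2)] by simp
    then show ?thesis using pr_total[OF lt] by simp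
  qed
  have "pr (- l) (w' + r) {- l..<0} \<le> pr (- l) (w + r) {- l..<0}"
    by (rule pr_sub) (use assms in auto)
  moreover have "pr (- l) (w' + r) {w'..w' + r} \<le> pr (- l) (w + r) {w..w + r}"
  proof -
    \<comment> \<open>To compare the right margins, the larger interval is moved left by
      \<open>w' - w\<close>; it then contains the smaller one, with the same right end.\<close>
    have "pr (- l - (w' - w) + (w' - w)) (w + r + (w' - w)) {w'..w' + r} = pr (- l - (w' - w)) (w + r) {w..w + r}"
      by (rule pr_shift) (use assms in auto)
    also have "\<dots> \<le> pr (- l) (w + r) {w..w + r}"
      by (rule pr_sub) (use assms in auto)
    finally show ?thesis by (simp add: algebra_simps)
  qed
  moreover have "measure N {f \<in> H. L f {- l..w' + r} = \<infinity>} \<le> measure N {f \<in> H. L f {- l..w + r} = \<infinity>}"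
    by (rule finite_measure_mono) (use assms L_ext[of _ "-l" "-l" "w + r" "w' + r"] in \<open>auto intro!: event_infinity\<close>)
  ultimately show ?thesis using parts[of w] parts[of w'] assms by simp
qed

sublocale window hit
proof
  fix l r w :: real assume *: "0 \<le> l" "0 \<le> r" "0 < w"
  show "0 \<le> hit l r w" "hit l r w \<le> 1" by (simp_all add: hit_def pr_def)
  show "hit l r (w + d) = hit l (r + d) w + hit (l + w) r d" if "0 < d" for d
  proof -
    have "{0..<w + d} = {0..<w} \<union> {w..<w + d}" using * that by auto
    then have "hit l r (w + d) = pr (- l) (w + d + r) {0..<w} + pr (- l) (w + d + r) {w..<w + d}"
      unfolding hit_def using * that by (auto simp: pr_disjoint)
    also have "pr (- l) (w + d + r) {w..<w + d} = hit (l + w) r d"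
      unfolding hit_def using pr_shift[of "- (l + w)" "d + r" "{0..<d}" "{w..<w + d}" w] * that
      by (auto simp: algebra_simps)
    finally show ?thesis by (simp add: hit_def algebra_simps)
  qed
  show "hit l' r' w \<le> hit l r w" if "l \<le> l'" "r \<le> r'" for l' r'
    unfolding hit_def by (rule pr_sub) (use * that in auto)
  show "hit l r w \<le> hit l r w'" if "w \<le> w'" for w'
    by (rule hit_width) (use * that in auto)
qed

end

section \<open>Dyadic cells as a generator\<close>

definition dyadic_cells :: "real \<Rightarrow> real \<Rightarrow> real set set" where
  "dyadic_cells a b = {{u..<v} | u v. u \<in> dyadics \<and> v \<in> dyadics \<and> a < u \<and> v < b}"

lemma countable_dyadics: "countable dyadics"
proof -
  have "dyadics = (\<lambda>(k::int, n). of_int k * mesh n) ` UNIV" by (auto simp: dyadics_def)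
  moreover have "countable (UNIV :: (int \<times> nat) set)" by simp
  ultimately show ?thesis by (metis countable_image)
qed

lemma countable_dyadic_cells: "countable (dyadic_cells a b)"
proof (rule countable_subset)
  show "dyadic_cells a b \<subseteq> (\<lambda>(u, v). {u..<v}) ` (dyadics \<times> dyadics)"
    by (auto simp: dyadic_cells_def)
qed (intro countable_image countable_SIGMA countable_dyadics)

lemma open_interval_dyadic_cells:
  "{u<..<v} = \<Union>(dyadic_cells u v)" for u v :: real
proof (rule set_eqI)
  fix x
  show "x \<in> {u<..<v} \<longleftrightarrow> x \<in> \<Union>(dyadic_cells u v)"
  proof
    assume "x \<in> {u<..<v}"
    then obtain p p' where "p \<in> dyadics" "u < p" "p < x" "p' \<in> dyadics" "x < p'" "p' < v"
      using dyadics_dense[of u x] dyadics_dense[of x v] by auto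
    then have "{p..<p'} \<in> dyadic_cells u v" "x \<in> {p..<p'}" by (auto simp: dyadic_cells_def)
    then show "x \<in> \<Union>(dyadic_cells u v)" by blast
  qed (auto simp: dyadic_cells_def)
qed

lemma sets_borel_dyadic_cells:
  "sets (restrict_space borel {a<..<b}) = sigma_sets {a<..<b} (dyadic_cells a b)"
proof
  have box: "(\<lambda>(u, v). box u v) = (\<lambda>(u, v). {u<..<v :: real})" by (auto simp: box_real)
  have G: "sets (borel :: real measure) = sigma_sets UNIV (range (\<lambda>(u, v). {u<..<v}))"
    by (subst borel_eq_box) (simp add: sets_measure_of box)
  have "sets (restrict_space borel {a<..<b}) = (\<inter>) {a<..<b} ` sigma_sets UNIV (range (\<lambda>(u, v). {u<..<v}))"
    by (simp add: sets_restrict_space G)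
  also have "\<dots> = sigma_sets {a<..<b} ((\<inter>) {a<..<b} ` range (\<lambda>(u, v). {u<..<v}))"
    by (rule sigma_sets_Int) (auto simp: G[symmetric])
  also have "\<dots> \<subseteq> sigma_sets {a<..<b} (dyadic_cells a b)"
  proof (rule sigma_sets_mono, clarify)
    fix u v :: real
    have "{a<..<b} \<inter> {u<..<v} = \<Union>(dyadic_cells (max a u) (min b v))"
      unfolding open_interval_dyadic_cells[symmetric] by auto
    moreover have "\<Union>(dyadic_cells (max a u) (min b v)) \<in> sigma_sets {a<..<b} (dyadic_cells a b)"
      by (rule sigma_sets_UNION[OF countable_dyadic_cells])
        (auto simp: dyadic_cells_def intro!: sigma_sets.Basic)
    ultimately show "{a<..<b} \<inter> {u<..<v} \<in> sigma_sets {a<..<b} (dyadic_cells a b)" by simp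
  qed
  finally show "sets (restrict_space borel {a<..<b}) \<subseteq> sigma_sets {a<..<b} (dyadic_cells a b)" .
  have "dyadic_cells a b \<subseteq> sets (restrict_space borel {a<..<b})"
  proof
    fix A assume "A \<in> dyadic_cells a b"
    then have "A \<in> sets borel" "A = {a<..<b} \<inter> A" by (auto simp: dyadic_cells_def)
    then show "A \<in> sets (restrict_space borel {a<..<b})" by (auto simp: sets_restrict_space)
  qed
  from sets.sigma_sets_subset[OF this]
  show "sigma_sets {a<..<b} (dyadic_cells a b) \<subseteq> sets (restrict_space borel {a<..<b})"
    by (simp add: space_restrict_space)
qed

lemma emeasure_law_inside:
  assumes mu: "sets \<mu> = sets ext_line" and B: "B \<in> sets (restrict_space borel {a<..<b})"
  shows "emeasure (law_inside \<mu> a b) B = emeasure \<mu> (ereal ` B)"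
proof -
  let ?E = "ereal ` {a<..<b}"
  have E: "?E \<in> sets \<mu>" unfolding mu by (rule ereal_image_in_ext_line) simp
  have sp: "space \<mu> = space ext_line" by (rule sets_eq_imp_space_eq[OF mu])
  have Esp: "?E \<subseteq> space \<mu>" unfolding sp by (auto simp: in_space_ext_line)
  have spE: "space (restrict_space \<mu> ?E) = ?E"
    using Esp by (simp add: space_restrict_space Int_absorb2)
  have Bs: "B \<subseteq> {a<..<b}" using sets.sets_into_space[OF B] by (simp add: space_restrict_space)
  have "real_of_ereal \<in> borel_measurable \<mu>"
    using real_of_ereal_ext_line by (simp add: measurable_cong_sets[OF mu refl])
  then have "real_of_ereal \<in> restrict_space \<mu> ?E \<rightarrow>\<^sub>M restrict_space borel {a<..<b}"
    by (intro measurable_restrict_space3) auto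
  then have "emeasure (law_inside \<mu> a b) B = emeasure (restrict_space \<mu> ?E) (real_of_ereal -` B \<inter> space (restrict_space \<mu> ?E))"
    unfolding law_inside_def using B by (rule emeasure_distr)
  also have "real_of_ereal -` B \<inter> space (restrict_space \<mu> ?E) = ereal ` B"
    unfolding spE using Bs by auto
  also have "emeasure (restrict_space \<mu> ?E) (ereal ` B) = emeasure \<mu> (ereal ` B)"
  proof (rule emeasure_restrict_space)
    show "?E \<inter> space \<mu> \<in> sets \<mu>" using E Esp by (simp add: Int_absorb2)
    show "ereal ` B \<subseteq> ?E" using Bs by (rule image_mono)
  qed
  finally show ?thesis .
qed

context stationary_law
begin

text \<open>Finite masses on a countable, intersection-stable generator determine the law. After
  translation by \<open>u\<close>, the cell \<open>[u, v)\<close> is a window with margins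
  \<open>u - a\<close> and \<open>b - v\<close>.\<close>

lemma law_inside_density:
  assumes ab: "a < b"
  defines "leb \<equiv> restrict_space lborel {a<..<b}"
  defines "\<nu> \<equiv> law_inside (distr N ext_line (\<lambda>f. L f {a..b})) a b"
  shows "\<exists>f \<in> borel_measurable leb. \<nu> = density leb (\<lambda>x. ennreal (f x)) \<and> regular_density f a b \<and> TV_constraints f a b"
proof -
  interpret window_interval hit a b by unfold_locales (rule ab)
  have setsl: "sets leb = sets (restrict_space borel {a<..<b})"
    unfolding leb_def by (intro sets_restrict_space_cong) simp
  have meas: "(\<lambda>x. ennreal (dens x)) \<in> borel_measurable leb"
    unfolding leb_def using dens_measurable by simp
  have "\<nu> = density leb (\<lambda>x. ennreal (dens x))"
  proof (rule measure_eqI_generator_eq_countable[where E = "dyadic_cells a b" and \<Omega> = "{a<..<b}" and A = "dyadic_cells a b"])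
    show "Int_stable (dyadic_cells a b)"
    proof (rule Int_stableI)
      fix A B assume "A \<in> dyadic_cells a b" "B \<in> dyadic_cells a b"
      then obtain u v u' v' where *: "A = {u..<v}" "B = {u'..<v'}"
        "u \<in> dyadics" "v \<in> dyadics" "a < u" "v < b" "u' \<in> dyadics" "v' \<in> dyadics" "a < u'" "v' < b"
        by (auto simp: dyadic_cells_def)
      then have "A \<inter> B = {max u u'..<min v v'}" "max u u' \<in> dyadics" "min v v' \<in> dyadics"
        by (auto simp: max_def min_def)
      then show "A \<inter> B \<in> dyadic_cells a b" unfolding dyadic_cells_def using * by (auto intro!: exI)
    qed
    show "dyadic_cells a b \<subseteq> Pow {a<..<b}" by (auto simp: dyadic_cells_def)
    show "sets \<nu> = sigma_sets {a<..<b} (dyadic_cells a b)"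
      unfolding \<nu>_def law_inside_def by (simp add: sets_borel_dyadic_cells)
    show "sets (density leb (\<lambda>x. ennreal (dens x))) = sigma_sets {a<..<b} (dyadic_cells a b)"
      by (simp add: setsl sets_borel_dyadic_cells)
    show "dyadic_cells a b \<subseteq> dyadic_cells a b" ..
    show "\<Union>(dyadic_cells a b) = {a<..<b}" by (rule open_interval_dyadic_cells[symmetric])
    show "countable (dyadic_cells a b)" by (rule countable_dyadic_cells)
    have in_sets: "A \<in> sets (restrict_space borel {a<..<b})" if "A \<in> dyadic_cells a b" for A
      unfolding sets_borel_dyadic_cells using that by (rule sigma_sets.Basic)
    have nu: "emeasure \<nu> A = emeasure N {f \<in> H. L f {a..b} \<in> ereal ` A}" if "A \<in> dyadic_cells a b" for A
    proof -
      have "A \<in> sets borel" using that by (auto simp: dyadic_cells_def)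
      then show ?thesis
        unfolding \<nu>_def using in_sets[OF that]
        by (subst emeasure_law_inside) (auto simp: emeasure_distr L_measurable ab ereal_image_in_ext_line vimage_def Int_def conj_commute)
    qed
    show "emeasure \<nu> A \<noteq> \<infinity>" if "A \<in> dyadic_cells a b" for A
      unfolding nu[OF that] by simp
    fix A assume A: "A \<in> dyadic_cells a b"
    then obtain u v where uv: "A = {u..<v}" "u \<in> dyadics" "v \<in> dyadics" "a < u" "v < b"
      by (auto simp: dyadic_cells_def)
    show "emeasure \<nu> A = emeasure (density leb (\<lambda>x. ennreal (dens x))) A"
    proof (cases "u < v")
      case True
      have "emeasure \<nu> A = ennreal (pr a b {u..<v})"
        using nu[OF A] unfolding pr_def uv(1) emeasure_eq_measure .
      also have "pr a b {u..<v} = hit (u - a) (b - v) (v - u)"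
        unfolding hit_def using pr_shift[of "a - u" "b - u" "{0..<v - u}" "{u..<v}" u] ab by auto
      also have "ennreal \<dots> = (\<integral>\<^sup>+x. indicator {u..<v} x * ennreal (dens x) \<partial>lborel)"
        by (rule dens_integral[symmetric]) (use uv True in auto)
      also have "\<dots> = (\<integral>\<^sup>+x. (ennreal (dens x) * indicator A x) * indicator {a<..<b} x \<partial>lborel)"
        using uv by (intro nn_integral_cong) (auto simp: indicator_def)
      also have "\<dots> = (\<integral>\<^sup>+x. ennreal (dens x) * indicator A x \<partial>leb)"
        unfolding leb_def by (subst nn_integral_restrict_space) auto
      also have "\<dots> = emeasure (density leb (\<lambda>x. ennreal (dens x))) A"
        by (rule emeasure_density[symmetric, OF meas]) (use in_sets[OF A] setsl in simp)
      finally show ?thesis .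
    next
      case False
      then have "A = {}" using uv by auto
      then show ?thesis by simp
    qed
  qed
  moreover have "dens \<in> borel_measurable leb" unfolding leb_def by (rule dens_measurable)
  ultimately show ?thesis using variation.regular variation.constraints by blast
qed

end

subsection \<open>Point fields\<close>

lemma point_fieldD:
  assumes "point_field H R"
  shows "f \<in> H \<Longrightarrow> closed (R f)"
    and "f \<in> H \<Longrightarrow> x \<in> R (shift c f) \<longleftrightarrow> x + c \<in> R f"
    and "f \<in> H \<Longrightarrow> R (\<lambda>x. f x + c) = R f"
    and "{f \<in> H. R f \<inter> {a..b} \<noteq> {}} \<in> sets (cylindrical H)"
proof -
  show "{f \<in> H. R f \<inter> {a..b} \<noteq> {}} \<in> sets (cylindrical H)"
    using assms unfolding point_field_def by (cases "a \<le> b") auto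
qed (use assms in \<open>simp_all add: point_field_def\<close>)

lemma point_field_miss:
  assumes "point_field H R"
  shows "{f \<in> H. R f \<inter> {a..b} = {}} \<in> sets (cylindrical H)"
proof -
  have "{f \<in> H. R f \<inter> {a..b} = {}} = space (cylindrical H) - {f \<in> H. R f \<inter> {a..b} \<noteq> {}}" by auto
  also have "\<dots> \<in> sets (cylindrical H)" by (rule sets.compl_sets[OF point_fieldD(4)[OF assms]])
  finally show ?thesis .
qed

lemma gap_below: "x < v \<Longrightarrow> \<exists>n. x \<le> v - 1 / real (Suc n)"
proof -
  assume "x < v"
  then obtain n where "inverse (real (Suc n)) < v - x" using reals_Archimedean[of "v - x"] by auto
  then have "x \<le> v - 1 / real (Suc n)" by (simp add: inverse_eq_divide)
  then show ?thesis ..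
qed

lemma point_field_miss_half_open:
  assumes "point_field H R"
  shows "{f \<in> H. R f \<inter> {u..<v} = {}} \<in> sets (cylindrical H)"
proof -
  have "{u..<v} = (\<Union>n. {u..v - 1 / real (Suc n)})"
  proof (rule set_eqI)
    fix x show "x \<in> {u..<v} \<longleftrightarrow> x \<in> (\<Union>n. {u..v - 1 / real (Suc n)})"
    proof
      assume "x \<in> (\<Union>n. {u..v - 1 / real (Suc n)})"
      then obtain n where "u \<le> x" "x \<le> v - 1 / real (Suc n)" by auto
      moreover have "0 < 1 / real (Suc n)" by simp
      ultimately show "x \<in> {u..<v}" unfolding atLeastLessThan_iff by linarith
    qed (use gap_below[of x v] in auto)
  qed
  then have "{f \<in> H. R f \<inter> {u..<v} = {}} = {f \<in> space (cylindrical H). \<forall>n. f \<in> {f \<in> H. R f \<inter> {u..v - 1 / real (Suc n)} = {}}}"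
    by auto
  also have "\<dots> \<in> sets (cylindrical H)"
    by (intro sets.sets_Collect_countable_All) (use point_field_miss[OF assms] in simp)
  finally show ?thesis .
qed

lemma point_field_hit_half_open:
  assumes "point_field H R"
  shows "{f \<in> H. R f \<inter> {u..<v} \<noteq> {}} \<in> sets (cylindrical H)"
proof -
  have "{f \<in> H. R f \<inter> {u..<v} \<noteq> {}} = space (cylindrical H) - {f \<in> H. R f \<inter> {u..<v} = {}}" by auto
  also have "\<dots> \<in> sets (cylindrical H)" by (rule sets.compl_sets[OF point_field_miss_half_open[OF assms]])
  finally show ?thesis .
qed

lemma point_field_miss_closed_ray:
  assumes "point_field H R"
  shows "{f \<in> H. R f \<inter> {b..} = {}} \<in> sets (cylindrical H)"
proof -
  have "{f \<in> H. R f \<inter> {b..} = {}} = {f \<in> space (cylindrical H). \<forall>n::nat. f \<in> {f \<in> H. R f \<inter> {b..real n} = {}}}"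
    using real_arch_simple by fastforce
  also have "\<dots> \<in> sets (cylindrical H)"
    by (intro sets.sets_Collect_countable_All) (use point_field_miss[OF assms] in simp)
  finally show ?thesis .
qed

lemma point_field_miss_open_ray:
  assumes "point_field H R"
  shows "{f \<in> H. R f \<inter> {b<..} = {}} \<in> sets (cylindrical H)"
proof -
  have "{b<..} = (\<Union>n. {b + 1 / real (Suc n)..})"
  proof (rule set_eqI)
    fix x show "x \<in> {b<..} \<longleftrightarrow> x \<in> (\<Union>n. {b + 1 / real (Suc n)..})"
    proof
      assume "x \<in> (\<Union>n. {b + 1 / real (Suc n)..})"
      then obtain n where "b + 1 / real (Suc n) \<le> x" by auto
      moreover have "0 < 1 / real (Suc n)" by simp
      ultimately show "x \<in> {b<..}" unfolding greaterThan_iff by linarith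
    next
      assume "x \<in> {b<..}"
      then obtain n where "b \<le> x - 1 / real (Suc n)" using gap_below[of b x] by auto
      then have "b + 1 / real (Suc n) \<le> x" by linarith
      then show "x \<in> (\<Union>n. {b + 1 / real (Suc n)..})" by blast
    qed
  qed
  then have "{f \<in> H. R f \<inter> {b<..} = {}} = {f \<in> space (cylindrical H). \<forall>n. f \<in> {f \<in> H. R f \<inter> {b + 1 / real (Suc n)..} = {}}}"
    by auto
  also have "\<dots> \<in> sets (cylindrical H)"
    by (intro sets.sets_Collect_countable_All) (use point_field_miss_closed_ray[OF assms] in simp)
  finally show ?thesis .
qed

lemma translate_Int_empty_iff:
  fixes c :: real
  assumes T: "\<And>y. y \<in> T \<longleftrightarrow> y + c \<in> S" and B: "\<And>y. y \<in> B \<longleftrightarrow> y + c \<in> D"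
  shows "T \<inter> B = {} \<longleftrightarrow> S \<inter> D = {}"
proof -
  have "T \<inter> B = (\<lambda>y. y + c) -` (S \<inter> D)" using T B by auto
  moreover have "surj (\<lambda>y. y + c)" by (metis diff_add_cancel surj_def)
  ultimately show ?thesis by (metis vimage_empty surj_image_vimage_eq image_empty)
qed

section \<open>Points after a gap and last points\<close>

text \<open>Including \<open>t - \<eta>\<close> in the gap makes the distances between entries
  strictly larger than \<open>\<eta>\<close>. This separation is also what makes the set of entries
  closed.\<close>

definition entry :: "real \<Rightarrow> ('a \<Rightarrow> real set) \<Rightarrow> 'a \<Rightarrow> real set" where
  "entry \<eta> S f = {t \<in> S f. S f \<inter> {t - \<eta>..<t} = {}}"

lemma entry_separated:
  assumes "s \<in> entry \<eta> S f" "t \<in> entry \<eta> S f" "s < t"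
  shows "\<eta> < t - s"
proof (rule ccontr)
  assume "\<not> \<eta> < t - s"
  then have "s \<in> S f \<inter> {t - \<eta>..<t}" using assms by (auto simp: entry_def)
  then show False using assms by (auto simp: entry_def)
qed

lemma closed_of_separated:
  fixes A :: "real set"
  assumes "0 < \<eta>" "\<And>s t. s \<in> A \<Longrightarrow> t \<in> A \<Longrightarrow> s < t \<Longrightarrow> \<eta> < t - s"
  shows "closed A"
proof (rule discrete_imp_closed[OF assms(1)], intro ballI impI)
  fix x y assume "x \<in> A" "y \<in> A" "dist y x < \<eta>"
  then show "y = x"
    using assms(2)[of x y] assms(2)[of y x] by (cases x y rule: linorder_cases) (auto simp: dist_real_def)
qed

text \<open>Replaces an uncountable union over gap positions by a countable one. Since
  \<open>S f\<close> is closed and misses \<open>t - \<eta>\<close>, the gap extends a little to the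
  left and a rational \<open>r\<close> fits into the extension. Conversely, the first point from
  \<open>max a r\<close> on is preceded by a gap that reaches back to \<open>r\<close> and is longer
  than \<open>\<eta>\<close>.\<close>

lemma entry_hit_iff:
  fixes S :: "(real \<Rightarrow> real) \<Rightarrow> real set"
  assumes cl: "closed (S f)" and \<eta>: "0 < \<eta>"
  shows "entry \<eta> S f \<inter> {a..b} \<noteq> {} \<longleftrightarrow>
    (\<exists>r\<in>\<rat>. S f \<inter> {r..r + \<eta>} = {} \<and> S f \<inter> {r..<a} = {} \<and> S f \<inter> {max a r..b} \<noteq> {})"
proof
  assume "entry \<eta> S f \<inter> {a..b} \<noteq> {}"
  then obtain t where t: "t \<in> S f" "S f \<inter> {t - \<eta>..<t} = {}" "a \<le> t" "t \<le> b"
    by (auto simp: entry_def)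
  have "t - \<eta> \<notin> S f" using t(2) \<eta> by auto
  then obtain e where e: "0 < e" "\<And>y. dist y (t - \<eta>) < e \<Longrightarrow> y \<notin> S f"
    using cl unfolding closed_def open_dist by blast
  obtain r where r: "r \<in> \<rat>" "t - \<eta> - e < r" "r < t - \<eta>"
    using Rats_dense_in_real[of "t - \<eta> - e" "t - \<eta>"] e by auto
  have gap: "y \<notin> S f" if "r \<le> y" "y < t" for y
  proof (cases "y < t - \<eta>")
    case True
    then show ?thesis using r that by (intro e(2)) (auto simp: dist_real_def)
  next
    case False
    then show ?thesis using t(2) that by auto
  qed
  have "S f \<inter> {r..r + \<eta>} = {}" "S f \<inter> {r..<a} = {}" using gap r t(3) by auto
  moreover have "t \<in> S f \<inter> {max a r..b}" using t r \<eta> by auto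
  ultimately show "\<exists>r\<in>\<rat>. S f \<inter> {r..r + \<eta>} = {} \<and> S f \<inter> {r..<a} = {} \<and> S f \<inter> {max a r..b} \<noteq> {}"
    using r(1) by blast
next
  assume "\<exists>r\<in>\<rat>. S f \<inter> {r..r + \<eta>} = {} \<and> S f \<inter> {r..<a} = {} \<and> S f \<inter> {max a r..b} \<noteq> {}"
  then obtain r where r: "S f \<inter> {r..r + \<eta>} = {}" "S f \<inter> {r..<a} = {}" "S f \<inter> {max a r..b} \<noteq> {}"
    by blast
  from cl show "entry \<eta> S f \<inter> {a..b} \<noteq> {}"
  proof (cases rule: first_point_cases[where R = S and f = f and a = "max a r" and b = b])
    case 1
    then show ?thesis using r by simp
  next
    case (2 t)
    have "\<not> t \<le> r + \<eta>" using r(1) 2 by auto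
    moreover have "y \<notin> S f" if "r \<le> y" "y < t" for y
    proof
      assume "y \<in> S f"
      then have "a \<le> y" using r(2) that by (auto simp: not_le[symmetric])
      then show False using 2(4)[OF \<open>y \<in> S f\<close>] that by simp
    qed
    ultimately have "t \<in> entry \<eta> S f" using 2(1) by (auto simp: entry_def)
    then show ?thesis using 2 by auto
  qed
qed

lemma point_field_entry:
  assumes S: "point_field H S" and \<eta>: "0 < \<eta>"
  shows "point_field H (entry \<eta> S)"
  unfolding point_field_def
proof (intro conjI ballI allI impI)
  fix f assume "f \<in> H"
  show "closed (entry \<eta> S f)" by (rule closed_of_separated[OF \<eta> entry_separated])
  fix c x
  have sh: "y \<in> S (shift c f) \<longleftrightarrow> y + c \<in> S f" for y by (rule point_fieldD(2)[OF S \<open>f \<in> H\<close>])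
  have "S (shift c f) \<inter> {x - \<eta>..<x} = {} \<longleftrightarrow> S f \<inter> {x + c - \<eta>..<x + c} = {}"
    by (rule translate_Int_empty_iff[OF sh]) auto
  then show "x \<in> entry \<eta> S (shift c f) \<longleftrightarrow> x + c \<in> entry \<eta> S f"
    by (simp add: entry_def sh)
  show "entry \<eta> S (\<lambda>x. f x + c) = entry \<eta> S f"
    by (simp add: entry_def point_fieldD(3)[OF S \<open>f \<in> H\<close>])
next
  fix a b :: real
  have iff: "entry \<eta> S f \<inter> {a..b} \<noteq> {} \<longleftrightarrow>
    (\<exists>r\<in>\<rat>. S f \<inter> {r..r + \<eta>} = {} \<and> S f \<inter> {r..<a} = {} \<and> S f \<inter> {max a r..b} \<noteq> {})" if "f \<in> H" for f
    by (rule entry_hit_iff[where S = S and f = f, OF point_fieldD(1)[OF S that] \<eta>])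
  have "{f \<in> H. entry \<eta> S f \<inter> {a..b} \<noteq> {}} = {f \<in> H. \<exists>r\<in>\<rat>. S f \<inter> {r..r + \<eta>} = {} \<and>
      S f \<inter> {r..<a} = {} \<and> S f \<inter> {max a r..b} \<noteq> {}}"
    by (intro Collect_cong conj_cong refl iff)
  also have "\<dots> = (\<Union>r\<in>\<rat>. {f \<in> H. S f \<inter> {r..r + \<eta>} = {}} \<inter>
      {f \<in> H. S f \<inter> {r..<a} = {}} \<inter> {f \<in> H. S f \<inter> {max a r..b} \<noteq> {}})"
    by auto
  also have "\<dots> \<in> sets (cylindrical H)"
    by (intro sets.countable_UN' countable_rat image_subsetI sets.Int point_fieldD(4) point_field_miss point_field_miss_half_open S)
  finally show "{f \<in> H. entry \<eta> S f \<inter> {a..b} \<noteq> {}} \<in> sets (cylindrical H)" .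
qed

definition last_point :: "('a \<Rightarrow> real set) \<Rightarrow> 'a \<Rightarrow> real set" where
  "last_point S f = {t \<in> S f. S f \<inter> {t<..} = {}}"

lemma last_point_unique: "s \<in> last_point S f \<Longrightarrow> t \<in> last_point S f \<Longrightarrow> s = t"
  by (rule linorder_cases[of s t]) (auto simp: last_point_def)

lemma last_point_hit_iff:
  assumes cl: "closed (S f)"
  shows "last_point S f \<inter> {a..b} \<noteq> {} \<longleftrightarrow> S f \<inter> {a..b} \<noteq> {} \<and> S f \<inter> {b<..} = {}"
proof
  assume "S f \<inter> {a..b} \<noteq> {} \<and> S f \<inter> {b<..} = {}"
  then have ne: "S f \<inter> {a..b} \<noteq> {}" and no: "S f \<inter> {b<..} = {}" by auto
  have "compact (S f \<inter> {a..b})" using cl by (intro closed_Int_compact) auto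
  from compact_attains_sup[OF this ne]
  obtain t where t: "t \<in> S f \<inter> {a..b}" "\<forall>y\<in>S f \<inter> {a..b}. y \<le> t" by blast
  have "y \<le> t" if "y \<in> S f" for y
  proof (rule ccontr)
    assume "\<not> y \<le> t"
    moreover have "y \<le> b" using no that by (auto simp: not_less[symmetric])
    ultimately show False using t that by auto
  qed
  then have "t \<in> last_point S f" using t by (auto simp: last_point_def not_less[symmetric])
  then show "last_point S f \<inter> {a..b} \<noteq> {}" using t by blast
next
  assume "last_point S f \<inter> {a..b} \<noteq> {}"
  then obtain t where t: "t \<in> S f" "S f \<inter> {t<..} = {}" "t \<in> {a..b}"
    unfolding last_point_def by blast
  then show "S f \<inter> {a..b} \<noteq> {} \<and> S f \<inter> {b<..} = {}" by auto
qed

lemma point_field_last_point: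
  assumes S: "point_field H S"
  shows "point_field H (last_point S)"
  unfolding point_field_def
proof (intro conjI ballI allI impI)
  fix f assume "f \<in> H"
  \<comment> \<open>There is at most one point, so any separation constant will do.\<close>
  show "closed (last_point S f)"
  proof (rule closed_of_separated[of 1])
    fix s t assume "s \<in> last_point S f" "t \<in> last_point S f" "s < t"
    then show "1 < t - s" using last_point_unique[of s S f t] by simp
  qed simp
  fix c x
  have sh: "y \<in> S (shift c f) \<longleftrightarrow> y + c \<in> S f" for y by (rule point_fieldD(2)[OF S \<open>f \<in> H\<close>])
  have "S (shift c f) \<inter> {x<..} = {} \<longleftrightarrow> S f \<inter> {x + c<..} = {}"
    by (rule translate_Int_empty_iff[OF sh]) auto
  then show "x \<in> last_point S (shift c f) \<longleftrightarrow> x + c \<in> last_point S f"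
    by (simp add: last_point_def sh)
  show "last_point S (\<lambda>x. f x + c) = last_point S f"
    by (simp add: last_point_def point_fieldD(3)[OF S \<open>f \<in> H\<close>])
next
  fix a b :: real
  have iff: "last_point S f \<inter> {a..b} \<noteq> {} \<longleftrightarrow> S f \<inter> {a..b} \<noteq> {} \<and> S f \<inter> {b<..} = {}" if "f \<in> H" for f
    by (rule last_point_hit_iff[where S = S and f = f, OF point_fieldD(1)[OF S that]])
  have "{f \<in> H. last_point S f \<inter> {a..b} \<noteq> {}} =
      {f \<in> H. S f \<inter> {a..b} \<noteq> {} \<and> S f \<inter> {b<..} = {}}"
    by (intro Collect_cong conj_cong refl iff)
  also have "\<dots> = {f \<in> H. S f \<inter> {a..b} \<noteq> {}} \<inter> {f \<in> H. S f \<inter> {b<..} = {}}"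
    by auto
  also have "\<dots> \<in> sets (cylindrical H)"
    by (intro sets.Int point_fieldD(4) point_field_miss_open_ray S)
  finally show "{f \<in> H. last_point S f \<inter> {a..b} \<noteq> {}} \<in> sets (cylindrical H)" .
qed

lemma max_diff_le_TV_pos:
  assumes "u < x" "x < y" "y < v"
  shows "ennreal (f y - f x) \<le> TV_pos f u v"
proof -
  let ?s = "\<lambda>i::nat. if i = 1 then x else y"
  have in_dom: "(2, ?s) \<in> {(n :: nat, s). strict_mono_on {1..n} s \<and> s ` {1..n} \<subseteq> {u<..<v}}"
    using assms by (auto simp: monotone_on_def)
  have "ennreal (f y - f x) \<le> ennreal (max (f y - f x) 0)" by (rule ennreal_leI) simp
  also have "\<dots> \<le> TV_pos f u v"
    using SUP_upper[OF in_dom, of "\<lambda>(n, s). ennreal (\<Sum>i = 1..<n. max (f (s (i + 1)) - f (s i)) 0)"]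
    by (simp add: TV_pos_def variation_def numeral_2_eq_2)
  finally show ?thesis .
qed

section \<open>First points under the variation constraints\<close>

text \<open>No right end of the interval occurs: by \<open>first_in_eq\<close> the same event is
  seen on every \<open>[a, b]\<close> with \<open>v \<le> b\<close>, so \<open>b\<close> may be sent
  far out.\<close>

definition first_in :: "(real \<Rightarrow> real) set \<Rightarrow> ((real \<Rightarrow> real) \<Rightarrow> real set) \<Rightarrow> real \<Rightarrow> real \<Rightarrow> real \<Rightarrow> (real \<Rightarrow> real) set" where
  "first_in H R a u v = {f \<in> H. \<exists>x\<in>R f. u \<le> x \<and> x < v \<and> (\<forall>y\<in>R f. a \<le> y \<longrightarrow> x \<le> y)}"

lemma first_in_eq:
  assumes "point_field H R" "a \<le> u" "v \<le> b"
  shows "first_in H R a u v = {f \<in> H. first_point R f {a..b} \<in> ereal ` {u..<v}}"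
proof -
  have "(\<exists>x\<in>R f. u \<le> x \<and> x < v \<and> (\<forall>y\<in>R f. a \<le> y \<longrightarrow> x \<le> y)) \<longleftrightarrow> first_point R f {a..b} \<in> ereal ` {u..<v}"
    if f: "f \<in> H" for f
  proof
    assume "\<exists>x\<in>R f. u \<le> x \<and> x < v \<and> (\<forall>y\<in>R f. a \<le> y \<longrightarrow> x \<le> y)"
    then obtain x where x: "x \<in> R f" "u \<le> x" "x < v" "\<And>y. y \<in> R f \<Longrightarrow> a \<le> y \<Longrightarrow> x \<le> y" by blast
    have "first_point R f {a..b} = ereal x"
    proof (rule first_point_eqI[where R = R and f = f, OF point_fieldD(1)[OF assms(1) f] x(1)])
      show "a \<le> x" "x \<le> b" using x assms by auto
    qed (use x(4) in force)
    then show "first_point R f {a..b} \<in> ereal ` {u..<v}" using x by auto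
  next
    assume *: "first_point R f {a..b} \<in> ereal ` {u..<v}"
    from point_fieldD(1)[OF assms(1) f]
    show "\<exists>x\<in>R f. u \<le> x \<and> x < v \<and> (\<forall>y\<in>R f. a \<le> y \<longrightarrow> x \<le> y)"
    proof (cases rule: first_point_cases[where R = R and f = f and a = a and b = b])
      case 1
      then show ?thesis using * by auto
    next
      case (2 x)
      then have "x \<in> {u..<v}" using * by auto
      then show ?thesis using 2(1,4) by (intro bexI[of _ x]) auto
    qed
  qed
  then show ?thesis unfolding first_in_def by blast
qed

locale tv_law = path_law +
  assumes TV: "\<And>L a b. doubly_intrinsic_location H L \<Longrightarrow> a < b \<Longrightarrow>
    \<exists>f \<in> borel_measurable (restrict_space lborel {a<..<b}).
      law_inside (distr N ext_line (\<lambda>f. L f {a..b})) a b = density (restrict_space lborel {a<..<b}) (\<lambda>x. ennreal (f x)) \<and>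
      regular_density f a b \<and> TV_constraints f a b"
begin

lemma first_in_sets:
  assumes R: "point_field H R" "a \<le> u"
  shows "first_in H R a u v \<in> sets N"
proof (cases "u < v")
  case True
  have "path_law_location H N (first_point R)"
    by unfold_locales (rule first_point_doubly_intrinsic[OF LI R(1)])
  then have "(\<lambda>f. first_point R f {a..v}) \<in> N \<rightarrow>\<^sub>M ext_line"
    by (rule path_law_location.L_measurable) (use R True in auto)
  from measurable_sets[OF this ereal_image_in_ext_line, of "{u..<v}"]
  show ?thesis unfolding first_in_eq[OF R order_refl] by (simp add: vimage_def Int_def conj_commute)
next
  case False
  then have "first_in H R a u v = {}" by (auto simp: first_in_def)
  then show ?thesis by simp
qed

text \<open>For every later \<open>t\<close>, the bound on \<open>TV_pos\<close> limits each rise of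
  the density before \<open>t\<close> by \<open>f t\<close>. If the later cell had more mass, the
  density would therefore stay above a fixed \<open>\<kappa>\<close> on an arbitrarily long stretch,
  against total mass at most 1.\<close>

lemma first_in_antimono:
  assumes R: "point_field H R" and as: "a < s" "s \<le> s'" and \<delta>: "0 < \<delta>"
  shows "measure N (first_in H R a s' (s' + \<delta>)) \<le> measure N (first_in H R a s (s + \<delta>))"
proof (cases "s = s'")
  case False
  then have ss: "s < s'" using as by simp
  let ?P = "measure N (first_in H R a s (s + \<delta>))" and ?P' = "measure N (first_in H R a s' (s' + \<delta>))"
  show ?thesis
  proof (rule ccontr)
    assume "\<not> ?P' \<le> ?P"
    define \<kappa> where "\<kappa> = (?P' - ?P) / \<delta>"
    have \<kappa>: "0 < \<kappa>" "?P' = ?P + \<kappa> * \<delta>" using \<open>\<not> ?P' \<le> ?P\<close> \<delta> by (auto simp: \<kappa>_def)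
    \<comment> \<open>A stretch of length \<open>2 / \<kappa>\<close> at height
      \<open>\<kappa>\<close> carries mass 2.\<close>
    define b where "b = s' + \<delta> + 2 / \<kappa>"
    have b: "s' + \<delta> < b" using \<kappa> by (simp add: b_def)
    have ab: "a < b" using as \<delta> b by simp
    let ?leb = "restrict_space lborel {a<..<b}"
    have loc: "doubly_intrinsic_location H (first_point R)" by (rule first_point_doubly_intrinsic[OF LI R])
    interpret loc: path_law_location H N "first_point R" by unfold_locales (rule loc)
    define \<nu> where "\<nu> = law_inside (distr N ext_line (\<lambda>f. first_point R f {a..b})) a b"
    from TV[OF loc ab] obtain f where fm: "f \<in> borel_measurable ?leb"
      and f: "\<nu> = density ?leb (\<lambda>x. ennreal (f x))" and reg: "regular_density f a b" and tv: "TV_constraints f a b"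
      unfolding \<nu>_def by blast
    define g where "g x = ennreal (f x) * indicator {a<..<b} x" for x
    have "(\<lambda>x. ennreal (f x)) \<in> borel_measurable ?leb" using fm by simp
    then have g: "g \<in> borel_measurable lborel"
      unfolding g_def using borel_measurable_restrict_space_iff_ennreal[of "{a<..<b}" lborel "\<lambda>x. ennreal (f x)"] by simp
    have nonneg: "0 \<le> f t" if "t \<in> {a<..<b}" for t using reg that by (auto simp: regular_density_def)
    have cell: "(\<integral>\<^sup>+x. g x * indicator {u..<v} x \<partial>lborel) = emeasure N (first_in H R a u v)"
      if uv: "a < u" "v < b" for u v
    proof -
      have B: "{u..<v} \<in> sets (restrict_space borel {a<..<b})"
      proof -
        have "{u..<v} = {a<..<b} \<inter> {u..<v}" using uv by auto
        then show ?thesis by (auto simp: sets_restrict_space)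
      qed
      have leb: "sets ?leb = sets (restrict_space borel {a<..<b})"
        by (intro sets_restrict_space_cong) simp
      have "emeasure \<nu> {u..<v} = emeasure (distr N ext_line (\<lambda>f. first_point R f {a..b})) (ereal ` {u..<v})"
        unfolding \<nu>_def by (rule emeasure_law_inside[OF _ B]) simp
      also have "\<dots> = emeasure N {f \<in> H. first_point R f {a..b} \<in> ereal ` {u..<v}}"
        by (simp add: emeasure_distr loc.L_measurable ab ereal_image_in_ext_line vimage_def Int_def conj_commute)
      also have "\<dots> = emeasure N (first_in H R a u v)"
        by (subst first_in_eq[OF R, of a u v b]) (use uv in auto)
      finally have "emeasure N (first_in H R a u v) = emeasure (density ?leb (\<lambda>x. ennreal (f x))) {u..<v}"
        by (simp add: f)
      also have "\<dots> = (\<integral>\<^sup>+x. ennreal (f x) * indicator {u..<v} x \<partial>?leb)"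
        by (rule emeasure_density) (use fm B leb in auto)
      also have "\<dots> = (\<integral>\<^sup>+x. g x * indicator {u..<v} x \<partial>lborel)"
        by (subst nn_integral_restrict_space) (auto simp: g_def ac_simps)
      finally show ?thesis by simp
    qed
    have low: "\<kappa> \<le> f t" if t: "t \<in> {s' + \<delta><..<b}" for t
    proof -
      have tab: "a < t" "t < b" using t as \<delta> by auto
      have "TV_pos f a (a + (t - a)) \<le> min_left f (a + (t - a))"
      proof -
        have "\<forall>\<epsilon>\<in>{0<..<b - a}. TV_pos f a (a + \<epsilon>) \<le> min_left f (a + \<epsilon>)"
          using tv unfolding TV_constraints_def Let_def by (elim conjE)
        then show ?thesis by (rule bspec) (use tab in auto)
      qed
      also have "\<dots> \<le> ennreal (f t)" unfolding min_left_def by (intro ennreal_leI) simp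
      finally have tvt: "TV_pos f a t \<le> ennreal (f t)" by simp
      have inc: "f (s' - s + x) \<le> f x + f t" if x: "x \<in> {s..<s + \<delta>}" for x
      proof -
        have "ennreal (f (s' - s + x) - f x) \<le> TV_pos f a t"
          by (rule max_diff_le_TV_pos) (use x ss as t in auto)
        also note tvt
        finally have "f (s' - s + x) - f x \<le> f t" using nonneg[of t] tab by (simp add: ennreal_le_iff)
        then show ?thesis by simp
      qed
      have "ennreal ?P' = (\<integral>\<^sup>+x. g x * indicator {s'..<s' + \<delta>} x \<partial>lborel)"
        by (subst cell) (use as b in \<open>auto simp: emeasure_eq_measure\<close>)
      \<comment> \<open>Translation by \<open>s' - s\<close> lays the later cell over the earlier
        one, so that the two densities can be compared point by point.\<close>
      also have "\<dots> = (\<integral>\<^sup>+x. g (s' - s + x) * indicator {s'..<s' + \<delta>} (s' - s + x) \<partial>lborel)"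
        using nn_integral_real_affine[of "\<lambda>x. g x * indicator {s'..<s' + \<delta>} x" 1 "s' - s"] g by simp
      also have "\<dots> \<le> (\<integral>\<^sup>+x. g x * indicator {s..<s + \<delta>} x + ennreal (f t) * indicator {s..<s + \<delta>} x \<partial>lborel)"
      proof (rule nn_integral_mono)
        fix x :: real
        show "g (s' - s + x) * indicator {s'..<s' + \<delta>} (s' - s + x) \<le>
            g x * indicator {s..<s + \<delta>} x + ennreal (f t) * indicator {s..<s + \<delta>} x"
        proof (cases "x \<in> {s..<s + \<delta>}")
          case True
          then have in1: "x \<in> {a<..<b}" "s' - s + x \<in> {a<..<b}" using as ss b by auto
          have "ennreal (f (s' - s + x)) \<le> ennreal (f x + f t)" using inc[OF True] by (rule ennreal_leI)
          also have "\<dots> = ennreal (f x) + ennreal (f t)"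
            using nonneg[OF in1(1)] nonneg[of t] tab by (intro ennreal_plus) auto
          finally show ?thesis using True in1 by (simp add: g_def)
        next
          case False
          then have "s' - s + x \<notin> {s'..<s' + \<delta>}" by auto
          then show ?thesis by simp
        qed
      qed
      also have "\<dots> = ennreal ?P + ennreal (f t) * ennreal \<delta>"
        by (subst nn_integral_add, (use g in measurable)[2], subst cell, (use as b ss in auto)[2])
           (use \<delta> in \<open>simp add: nn_integral_cmult_indicator emeasure_eq_measure\<close>)
      also have "\<dots> = ennreal (?P + f t * \<delta>)"
        using nonneg[of t] tab \<delta> by (simp add: ennreal_mult' )
      finally have "?P' \<le> ?P + f t * \<delta>"
        using nonneg[of t] tab \<delta>
        by (simp add: ennreal_plus[symmetric] ennreal_le_iff del: ennreal_plus)
      then have "\<kappa> * \<delta> \<le> f t * \<delta>" using \<kappa> by simp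
      then show ?thesis using \<delta> by simp
    qed
    have "ennreal 2 = ennreal \<kappa> * ennreal (2 / \<kappa>)" using \<kappa> by (simp add: ennreal_mult''[symmetric])
    also have "\<dots> = (\<integral>\<^sup>+x. ennreal \<kappa> * indicator {s' + \<delta><..<b} x \<partial>lborel)"
      using \<kappa> by (simp add: nn_integral_cmult_indicator b_def)
    also have "\<dots> \<le> (\<integral>\<^sup>+x. g x \<partial>lborel)"
    proof (rule nn_integral_mono)
      fix x :: real
      show "ennreal \<kappa> * indicator {s' + \<delta><..<b} x \<le> g x"
      proof (cases "x \<in> {s' + \<delta><..<b}")
        case True
        then show ?thesis using low[OF True] as \<delta> by (simp add: g_def ennreal_leI)
      qed simp
    qed
    also have "\<dots> = (\<integral>\<^sup>+x. ennreal (f x) \<partial>?leb)"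
      by (subst nn_integral_restrict_space) (auto simp: g_def[abs_def])
    also have "\<dots> = emeasure \<nu> (space \<nu>)"
    proof -
      have "{a<..<b} \<in> sets ?leb" using sets.top[of ?leb] by (simp add: space_restrict_space)
      then show ?thesis
        unfolding f using fm by (subst emeasure_density) (auto simp: space_restrict_space intro!: nn_integral_cong)
    qed
    also have "\<dots> \<le> 1"
    proof -
      have sp: "space \<nu> = {a<..<b}" by (simp add: \<nu>_def law_inside_def space_restrict_space)
      have "emeasure \<nu> {a<..<b} = emeasure (distr N ext_line (\<lambda>f. first_point R f {a..b})) (ereal ` {a<..<b})"
        unfolding \<nu>_def by (rule emeasure_law_inside) (auto simp: sets_restrict_space)
      also have "\<dots> \<le> 1"
        by (intro prob_space.emeasure_le_1 prob_space_distr loc.L_measurable ab)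
      finally show ?thesis unfolding sp .
    qed
    finally show False by simp
  qed
qed simp

end

subsection \<open>Monotonicity of point probabilities\<close>

context tv_law
begin

lemma in_sets_N: "A \<in> sets (cylindrical H) \<Longrightarrow> A \<in> sets N"
  by (simp add: sets_N)

text \<open>With points more than \<open>\<eta>\<close> apart, a point in a cell of width
  \<open>\<delta>\<close> is automatically the first one after any \<open>a\<close> close enough, so
  hitting the cell is a \<open>first_in\<close> event. A large distance is covered by many small
  steps.\<close>

lemma separated_hit_antimono:
  assumes R: "point_field H R"
    and sep: "\<And>f s t. f \<in> H \<Longrightarrow> s \<in> R f \<Longrightarrow> t \<in> R f \<Longrightarrow> s < t \<Longrightarrow> \<eta> < t - s"
    and \<delta>: "0 < \<delta>" "\<delta> < \<eta>" and "s \<le> s'"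
  shows "measure N {f \<in> H. R f \<inter> {s'..<s' + \<delta>} \<noteq> {}} \<le> measure N {f \<in> H. R f \<inter> {s..<s + \<delta>} \<noteq> {}}"
proof -
  have step: "measure N {f \<in> H. R f \<inter> {s'..<s' + \<delta>} \<noteq> {}} \<le> measure N {f \<in> H. R f \<inter> {s..<s + \<delta>} \<noteq> {}}"
    if ss: "s \<le> s'" "s' - s < \<eta> - \<delta>" for s s'
  proof -
    \<comment> \<open>Every point of the cells in question is less than \<open>\<eta>\<close> beyond
      \<open>a\<close>; having \<open>a < s\<close> then needs a step shorter than
      \<open>\<eta> - \<delta>\<close>.\<close>
    define a where "a = s' + \<delta> - \<eta>"
    have a: "a < s" using ss by (simp add: a_def)
    have eq: "first_in H R a t (t + \<delta>) = {f \<in> H. R f \<inter> {t..<t + \<delta>} \<noteq> {}}" if t: "t \<le> s'" for t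
    proof (intro set_eqI iffI)
      fix f assume "f \<in> first_in H R a t (t + \<delta>)"
      then show "f \<in> {f \<in> H. R f \<inter> {t..<t + \<delta>} \<noteq> {}}" by (auto simp: first_in_def)
    next
      fix f assume "f \<in> {f \<in> H. R f \<inter> {t..<t + \<delta>} \<noteq> {}}"
      then obtain x where x: "f \<in> H" "x \<in> R f" "t \<le> x" "x < t + \<delta>" by auto
      have "x \<le> y" if y: "y \<in> R f" "a \<le> y" for y
      proof (rule ccontr)
        assume "\<not> x \<le> y"
        then have "\<eta> < x - y" using sep[OF x(1) y(1) x(2)] by simp
        then show False using x t y by (simp add: a_def)
      qed
      then show "f \<in> first_in H R a t (t + \<delta>)" using x unfolding first_in_def by blast
    qed
    show ?thesis
      using first_in_antimono[OF R a ss(1) \<delta>(1)] unfolding eq[OF ss(1)] eq[OF order_refl] .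
  qed
  obtain n where n: "s' - s < real n * (\<eta> - \<delta>)"
    using reals_Archimedean3[of "\<eta> - \<delta>"] \<delta> by auto
  have n0: "0 < n"
  proof (rule ccontr)
    assume "\<not> 0 < n"
    then show False using n \<open>s \<le> s'\<close> by simp
  qed
  define d where "d = (s' - s) / real n"
  have d: "0 \<le> d" "d < \<eta> - \<delta>" using n n0 \<open>s \<le> s'\<close> by (auto simp: d_def field_simps)
  have "measure N {f \<in> H. R f \<inter> {s + real k * d..<s + real k * d + \<delta>} \<noteq> {}} \<le> measure N {f \<in> H. R f \<inter> {s..<s + \<delta>} \<noteq> {}}" for k
  proof (induction k)
    case (Suc k)
    have "s + real (Suc k) * d = (s + real k * d) + d" by (simp add: algebra_simps)
    then show ?case using step[of "s + real k * d" "s + real (Suc k) * d"] d Suc by simp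
  qed simp
  from this[of n] show ?thesis using n0 by (simp add: d_def)
qed

text \<open>Translates of the window to the left are hit with at least the same probability, but a
  unique point hits at most one of infinitely many disjoint translates.\<close>

lemma last_point_null:
  assumes S: "point_field H S" and "a < a'"
  shows "measure N {f \<in> H. last_point S f \<inter> {a..<a'} \<noteq> {}} = 0"
proof -
  define \<delta> where "\<delta> = a' - a"
  define E where "E k = {f \<in> H. last_point S f \<inter> {a - real k * \<delta>..<a - real k * \<delta> + \<delta>} \<noteq> {}}" for k
  note P = point_field_last_point[OF S]
  have \<delta>: "0 < \<delta>" "\<delta> < \<delta> + 1" using assms by (auto simp: \<delta>_def)
  have ge: "measure N (E 0) \<le> measure N (E k)" for k
    unfolding E_def
  proof (rule separated_hit_antimono[OF P _ \<delta>])
    fix f s t assume "s \<in> last_point S f" "t \<in> last_point S f" "s < t"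
    then show "\<delta> + 1 < t - s" using last_point_unique[of s S f t] by simp
  qed (use \<delta> in auto)
  have sets: "E k \<in> sets N" for k
    unfolding E_def by (rule in_sets_N[OF point_field_hit_half_open[OF P]])
  have disj: "E j \<inter> E k = {}" if "j < k" for j k
  proof (rule equals0I)
    fix f assume "f \<in> E j \<inter> E k"
    then obtain x y where x: "x \<in> last_point S f" "a - real j * \<delta> \<le> x"
      and y: "y \<in> last_point S f" "y < a - real k * \<delta> + \<delta>"
      by (auto simp: E_def)
    have "real (Suc j) * \<delta> \<le> real k * \<delta>" using that \<delta> by (intro mult_right_mono) auto
    then have "y < x" using x y by (simp add: algebra_simps)
    then show False using last_point_unique[OF x(1) y(1)] by simp
  qed
  have df: "disjoint_family_on E {..<n}" for n
    unfolding disjoint_family_on_def using disj by (metis Int_commute linorder_neqE_nat)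
  have "real n * measure N (E 0) \<le> 1" for n
  proof -
    have "real n * measure N (E 0) = (\<Sum>k<n. measure N (E 0))" by simp
    also have "\<dots> \<le> (\<Sum>k<n. measure N (E k))" by (intro sum_mono ge)
    also have "\<dots> = measure N (\<Union>k<n. E k)"
      by (rule finite_measure_finite_Union[symmetric]) (use sets df in auto)
    also have "\<dots> \<le> 1" by (rule prob_le_1)
    finally show ?thesis .
  qed
  then have "measure N (E 0) \<le> 0"
    using reals_Archimedean3[of "measure N (E 0)"] by (metis not_less)
  then have "measure N (E 0) = 0" using measure_nonneg[of N "E 0"] by simp
  then show ?thesis by (simp add: E_def \<delta>_def)
qed

text \<open>A first point at distance about \<open>i \<delta>\<close> after \<open>a\<close> is, up to one cell, the same as a point
  preceded by a gap of length \<open>i \<delta>\<close>; the latter notion does not refer to \<open>a\<close>.\<close>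

lemma first_in_compare:
  assumes S: "point_field H S" and "a \<le> a'" "0 < \<delta>"
  shows "measure N (first_in H S a' (a' + real (j + 2) * \<delta>) (a' + real (j + 2) * \<delta> + \<delta>))
    \<le> measure N (first_in H S a (a + real (j + 1) * \<delta>) (a + real (j + 1) * \<delta> + \<delta>))"
proof -
  \<comment> \<open>The gap spans \<open>j + 2\<close> cells while the comparison at
    \<open>a\<close> uses cell \<open>j + 1\<close>: an entry in
    \<open>[a + \<eta> - \<delta>, a + \<eta>)\<close> has a gap beginning before \<open>a\<close>,
    so it is the first point after \<open>a\<close>.\<close>
  define \<eta> where "\<eta> = real (j + 2) * \<delta>"
  have \<eta>: "0 < \<eta>" "\<delta> < \<eta>" using assms by (auto simp: \<eta>_def)
  have low: "a + real (j + 1) * \<delta> = a + \<eta> - \<delta>" by (simp add: \<eta>_def algebra_simps)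
  note E = point_field_entry[OF S \<eta>(1)]
  have "measure N (first_in H S a' (a' + \<eta>) (a' + \<eta> + \<delta>)) \<le> measure N {f \<in> H. entry \<eta> S f \<inter> {a' + \<eta>..<a' + \<eta> + \<delta>} \<noteq> {}}"
  proof (rule finite_measure_mono)
    show "first_in H S a' (a' + \<eta>) (a' + \<eta> + \<delta>) \<subseteq> {f \<in> H. entry \<eta> S f \<inter> {a' + \<eta>..<a' + \<eta> + \<delta>} \<noteq> {}}"
    proof
      fix f assume "f \<in> first_in H S a' (a' + \<eta>) (a' + \<eta> + \<delta>)"
      then obtain x where x: "f \<in> H" "x \<in> S f" "a' + \<eta> \<le> x" "x < a' + \<eta> + \<delta>"
        "\<And>y. y \<in> S f \<Longrightarrow> a' \<le> y \<Longrightarrow> x \<le> y" unfolding first_in_def by blast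
      have "S f \<inter> {x - \<eta>..<x} = {}"
      proof (rule equals0I)
        fix y assume "y \<in> S f \<inter> {x - \<eta>..<x}"
        then show False using x(5)[of y] x(3) by auto
      qed
      then have "x \<in> entry \<eta> S f \<inter> {a' + \<eta>..<a' + \<eta> + \<delta>}" using x by (auto simp: entry_def)
      then show "f \<in> {f \<in> H. entry \<eta> S f \<inter> {a' + \<eta>..<a' + \<eta> + \<delta>} \<noteq> {}}" using x(1) by blast
    qed
  qed (rule in_sets_N[OF point_field_hit_half_open[OF E]])
  also have "\<dots> \<le> measure N {f \<in> H. entry \<eta> S f \<inter> {a + \<eta> - \<delta>..<a + \<eta> - \<delta> + \<delta>} \<noteq> {}}"
    by (rule separated_hit_antimono[OF E entry_separated assms(3) \<eta>(2)]) (use assms in auto)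
  also have "\<dots> \<le> measure N (first_in H S a (a + \<eta> - \<delta>) (a + \<eta> - \<delta> + \<delta>))"
  proof (rule finite_measure_mono)
    show "{f \<in> H. entry \<eta> S f \<inter> {a + \<eta> - \<delta>..<a + \<eta> - \<delta> + \<delta>} \<noteq> {}} \<subseteq> first_in H S a (a + \<eta> - \<delta>) (a + \<eta> - \<delta> + \<delta>)"
    proof
      fix f assume "f \<in> {f \<in> H. entry \<eta> S f \<inter> {a + \<eta> - \<delta>..<a + \<eta> - \<delta> + \<delta>} \<noteq> {}}"
      then obtain t where t: "f \<in> H" "t \<in> S f" "S f \<inter> {t - \<eta>..<t} = {}" "a + \<eta> - \<delta> \<le> t" "t < a + \<eta> - \<delta> + \<delta>"
        by (auto simp: entry_def)
      have "t \<le> y" if y: "y \<in> S f" "a \<le> y" for y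
      proof (rule ccontr)
        assume "\<not> t \<le> y"
        then have "y \<in> S f \<inter> {t - \<eta>..<t}" using y t(5) by auto
        then show False using t(3) by auto
      qed
      then show "f \<in> first_in H S a (a + \<eta> - \<delta>) (a + \<eta> - \<delta> + \<delta>)"
        using t(1,2,4,5) unfolding first_in_def by blast
    qed
    show "first_in H S a (a + \<eta> - \<delta>) (a + \<eta> - \<delta> + \<delta>) \<in> sets N"
      by (rule first_in_sets[OF S]) (use \<eta> in simp)
  qed
  finally show ?thesis unfolding low \<eta>_def[symmetric] .
qed

definition later :: "((real \<Rightarrow> real) \<Rightarrow> real set) \<Rightarrow> real \<Rightarrow> real \<Rightarrow> (real \<Rightarrow> real) set" where
  "later S a w = {f \<in> H. \<exists>x\<in>S f. a + w \<le> x \<and> (\<forall>y\<in>S f. a \<le> y \<longrightarrow> x \<le> y)}"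

lemma later_eq_Union:
  assumes "0 < \<delta>"
  shows "later S a (real m * \<delta>) = (\<Union>j. first_in H S a (a + real (j + m) * \<delta>) (a + real (j + m) * \<delta> + \<delta>))"
proof (rule set_eqI)
  fix f
  show "f \<in> later S a (real m * \<delta>) \<longleftrightarrow>
    f \<in> (\<Union>j. first_in H S a (a + real (j + m) * \<delta>) (a + real (j + m) * \<delta> + \<delta>))"
  proof
    assume "f \<in> later S a (real m * \<delta>)"
    then obtain x where x: "f \<in> H" "x \<in> S f" "a + real m * \<delta> \<le> x" "\<forall>y\<in>S f. a \<le> y \<longrightarrow> x \<le> y"
      unfolding later_def by blast
    define j where "j = nat \<lfloor>(x - a) / \<delta> - real m\<rfloor>"
    have "0 \<le> (x - a) / \<delta> - real m" using x(3) assms by (simp add: field_simps)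
    then have "real j \<le> (x - a) / \<delta> - real m" "(x - a) / \<delta> - real m < real j + 1"
      unfolding j_def by linarith+
    then have "real (j + m) \<le> (x - a) / \<delta>" "(x - a) / \<delta> < real (j + m) + 1" by simp_all
    then have "real (j + m) * \<delta> \<le> x - a" "x - a < (real (j + m) + 1) * \<delta>"
      using assms by (simp_all only: pos_le_divide_eq pos_divide_less_eq)
    then have "a + real (j + m) * \<delta> \<le> x" "x < a + real (j + m) * \<delta> + \<delta>"
      by (simp_all add: algebra_simps)
    then show "f \<in> (\<Union>j. first_in H S a (a + real (j + m) * \<delta>) (a + real (j + m) * \<delta> + \<delta>))"
      using x(1,2,4) unfolding first_in_def by blast
  next
    assume "f \<in> (\<Union>j. first_in H S a (a + real (j + m) * \<delta>) (a + real (j + m) * \<delta> + \<delta>))"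
    then obtain j x where x: "f \<in> H" "x \<in> S f" "a + real (j + m) * \<delta> \<le> x" "\<forall>y\<in>S f. a \<le> y \<longrightarrow> x \<le> y"
      unfolding first_in_def by blast
    have "real m * \<delta> \<le> real (j + m) * \<delta>" using assms by (intro mult_right_mono) auto
    then have "a + real m * \<delta> \<le> x" using x(3) by simp
    then show "f \<in> later S a (real m * \<delta>)" using x(1,2,4) unfolding later_def by blast
  qed
qed

lemma emeasure_later:
  assumes S: "point_field H S" and \<delta>: "0 < \<delta>"
  shows "emeasure N (later S a (real m * \<delta>)) =
    (\<Sum>j. emeasure N (first_in H S a (a + real (j + m) * \<delta>) (a + real (j + m) * \<delta> + \<delta>)))"
  unfolding later_eq_Union[OF \<delta>]
proof (rule suminf_emeasure[symmetric])
  let ?F = "\<lambda>j. first_in H S a (a + real (j + m) * \<delta>) (a + real (j + m) * \<delta> + \<delta>)"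
  have pos: "0 \<le> real (j + m) * \<delta>" for j using \<delta> by simp
  show "range ?F \<subseteq> sets N"
    using first_in_sets[OF S] pos by auto
  have "?F j \<inter> ?F k = {}" if "j < k" for j k
  proof (rule equals0I)
    fix f assume "f \<in> ?F j \<inter> ?F k"
    then obtain x y where x: "x \<in> S f" "a + real (j + m) * \<delta> \<le> x" "x < a + real (j + m) * \<delta> + \<delta>"
      and y: "a + real (k + m) * \<delta> \<le> y" "\<forall>z\<in>S f. a \<le> z \<longrightarrow> y \<le> z"
      unfolding first_in_def by blast
    have "real (Suc j + m) * \<delta> \<le> real (k + m) * \<delta>" using that \<delta> by (intro mult_right_mono) auto
    then have "x < y" using x y by (simp add: algebra_simps)
    moreover have "y \<le> x" using y(2) x(1,2) pos[of j] by auto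
    ultimately show False by simp
  qed
  then show "disjoint_family ?F"
    unfolding disjoint_family_on_def by (metis Int_commute linorder_neqE_nat)
qed

lemma later_sets:
  assumes "point_field H S" "0 < w"
  shows "later S a w \<in> sets N"
proof -
  have "later S a (real 1 * w) \<in> sets N"
    unfolding later_eq_Union[OF assms(2)]
    by (rule sets.countable_UN) (use first_in_sets[OF assms(1)] assms(2) in auto)
  then show ?thesis by simp
qed

text \<open>Sums \<open>first_in_compare\<close> over all cells. The loss of one cell appears as
  \<open>2 * \<delta>\<close> against \<open>\<delta>\<close> and disappears as
  \<open>\<delta>\<close> tends to 0.\<close>

lemma later_compare:
  assumes S: "point_field H S" and "a \<le> a'" and \<delta>: "0 < \<delta>"
  shows "measure N (later S a' (2 * \<delta>)) \<le> measure N (later S a \<delta>)"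
proof -
  have "emeasure N (later S a' (real 2 * \<delta>)) \<le> emeasure N (later S a (real 1 * \<delta>))"
    unfolding emeasure_later[OF S \<delta>]
    by (intro suminf_le summableI) (use first_in_compare[OF S assms(2) \<delta>] in \<open>simp add: emeasure_eq_measure\<close>)
  then show ?thesis by (simp add: emeasure_eq_measure)
qed

text \<open>Either \<open>a\<close> belongs to the set, or the first point lies strictly after
  \<open>a\<close> (\<open>G\<close>), or there is no point from \<open>a\<close> on
  (\<open>Z\<close>). Neither \<open>G\<close> nor \<open>Z\<close> gains probability as
  \<open>a\<close> grows: \<open>G\<close> by \<open>later_compare\<close>, and \<open>Z\<close>
  because a set ending between \<open>a\<close> and \<open>a'\<close> has its last point there, a
  null event.\<close>

lemma point_probability_mono:
  assumes S: "point_field H S" and "a \<le> a'"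
  shows "measure N {f \<in> H. a \<in> S f} \<le> measure N {f \<in> H. a' \<in> S f}"
proof (cases "a = a'")
  case False
  then have aa: "a < a'" using assms by simp
  define G where "G a = {f \<in> H. a \<notin> S f \<and> S f \<inter> {a..} \<noteq> {}}" for a
  define Z where "Z a = {f \<in> H. S f \<inter> {a..} = {}}" for a
  have Z: "Z a \<in> sets N" for a
    unfolding Z_def by (rule in_sets_N[OF point_field_miss_closed_ray[OF S]])
  have P: "{f \<in> H. a \<in> S f} \<in> sets N" for a
    using in_sets_N[OF point_fieldD(4)[OF S, of a a]] by simp
  have G_eq: "G a = space N - ({f \<in> H. a \<in> S f} \<union> Z a)" for a
    by (auto simp: G_def Z_def)
  have G: "G a \<in> sets N" for a unfolding G_eq by (intro sets.compl_sets sets.Un P Z)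
  have total: "measure N {f \<in> H. a \<in> S f} = 1 - measure N (G a) - measure N (Z a)" for a
  proof -
    have "{f \<in> H. a \<in> S f} \<inter> Z a = {}" by (auto simp: Z_def)
    then have "measure N ({f \<in> H. a \<in> S f} \<union> Z a) = measure N {f \<in> H. a \<in> S f} + measure N (Z a)"
      using P Z by (intro finite_measure_Union) auto
    moreover have "measure N (G a) = 1 - measure N ({f \<in> H. a \<in> S f} \<union> Z a)"
      unfolding G_eq by (rule prob_compl) (use P Z in auto)
    ultimately show ?thesis by simp
  qed
  \<comment> \<open>The factor 2 makes \<open>later_compare\<close> applicable with
    \<open>1 / real (Suc n)\<close> as \<open>\<delta>\<close>.\<close>
  have GU: "G a = (\<Union>n. later S a (2 * (1 / real (Suc n))))" for a
  proof (rule set_eqI)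
    fix f
    show "f \<in> G a \<longleftrightarrow> f \<in> (\<Union>n. later S a (2 * (1 / real (Suc n))))"
    proof
      assume f: "f \<in> G a"
      then obtain z where z: "f \<in> H" "a \<notin> S f" "z \<in> S f" "a \<le> z" by (auto simp: G_def)
      from point_fieldD(1)[OF S z(1)]
      show "f \<in> (\<Union>n. later S a (2 * (1 / real (Suc n))))"
      proof (cases rule: first_point_cases[where R = S and f = f and a = a and b = z])
        case 1
        then show ?thesis using z by auto
      next
        case (2 x)
        have "x \<noteq> a" using 2(1) z(2) by auto
        then have "0 < (x - a) / 2" using 2 by simp
        from gap_below[OF this] obtain n where "0 \<le> (x - a) / 2 - 1 / real (Suc n)" ..
        then have "a + 2 * (1 / real (Suc n)) \<le> x" by simp
        then have "f \<in> later S a (2 * (1 / real (Suc n)))" using z(1) 2(1,4) unfolding later_def by blast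
        then show ?thesis by blast
      qed
    next
      assume "f \<in> (\<Union>n. later S a (2 * (1 / real (Suc n))))"
      then obtain n x where x: "f \<in> H" "x \<in> S f" "a + 2 * (1 / real (Suc n)) \<le> x" "\<forall>y\<in>S f. a \<le> y \<longrightarrow> x \<le> y"
        unfolding later_def by blast
      have "0 < 2 * (1 / real (Suc n))" by simp
      then have "a < x" using x(3) by linarith
      then have "a \<notin> S f" "x \<in> S f \<inter> {a..}" using x(2,4) by auto
      then show "f \<in> G a" using x(1) unfolding G_def by blast
    qed
  qed
  have "measure N (G a') \<le> measure N (G a)"
  proof (rule LIMSEQ_le_const2)
    show "(\<lambda>n. measure N (later S a' (2 * (1 / real (Suc n))))) \<longlonglongrightarrow> measure N (G a')"
      unfolding GU
    proof (rule finite_Lim_measure_incseq)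
      show "range (\<lambda>n. later S a' (2 * (1 / real (Suc n)))) \<subseteq> sets N"
        using later_sets[OF S] by auto
      show "incseq (\<lambda>n. later S a' (2 * (1 / real (Suc n))))"
      proof (rule incseq_SucI)
        fix n
        have le: "2 * (1 / real (Suc (Suc n))) \<le> 2 * (1 / real (Suc n))" by (simp add: field_simps)
        show "later S a' (2 * (1 / real (Suc n))) \<le> later S a' (2 * (1 / real (Suc (Suc n))))"
        proof
          fix f assume "f \<in> later S a' (2 * (1 / real (Suc n)))"
          then obtain x where x: "f \<in> H" "x \<in> S f" "a' + 2 * (1 / real (Suc n)) \<le> x" "\<forall>y\<in>S f. a' \<le> y \<longrightarrow> x \<le> y"
            unfolding later_def by blast
          have "a' + 2 * (1 / real (Suc (Suc n))) \<le> x" using x(3) le by linarith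
          then show "f \<in> later S a' (2 * (1 / real (Suc (Suc n))))" using x(1,2,4) unfolding later_def by blast
        qed
      qed
    qed
    have "measure N (later S a' (2 * (1 / real (Suc n)))) \<le> measure N (G a)" for n
    proof -
      have pos: "0 < 1 / real (Suc n)" by simp
      have "measure N (later S a' (2 * (1 / real (Suc n)))) \<le> measure N (later S a (1 / real (Suc n)))"
        by (rule later_compare[OF S assms(2) pos])
      also have "\<dots> \<le> measure N (G a)"
      proof (rule finite_measure_mono[OF _ G])
        show "later S a (1 / real (Suc n)) \<subseteq> G a"
        proof
          fix f assume "f \<in> later S a (1 / real (Suc n))"
          then obtain x where x: "f \<in> H" "x \<in> S f" "a + 1 / real (Suc n) \<le> x" "\<forall>y\<in>S f. a \<le> y \<longrightarrow> x \<le> y"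
            unfolding later_def by blast
          have "a < x" using x(3) pos by linarith
          then have "a \<notin> S f" "x \<in> S f \<inter> {a..}" using x(2,4) by auto
          then show "f \<in> G a" using x(1) unfolding G_def by blast
        qed
      qed
      finally show ?thesis .
    qed
    then show "\<exists>M. \<forall>n\<ge>M. measure N (later S a' (2 * (1 / real (Suc n)))) \<le> measure N (G a)" by blast
  qed
  moreover have "measure N (Z a') \<le> measure N (Z a)"
  proof -
    let ?E = "{f \<in> H. last_point S f \<inter> {a..<a'} \<noteq> {}}"
    have E: "?E \<in> sets N" by (rule in_sets_N[OF point_field_hit_half_open[OF point_field_last_point[OF S]]])
    have "Z a' \<subseteq> Z a \<union> ?E"
    proof
      fix f assume "f \<in> Z a'"
      then have f: "f \<in> H" "S f \<inter> {a'..} = {}" by (auto simp: Z_def)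
      show "f \<in> Z a \<union> ?E"
      proof (cases "S f \<inter> {a..} = {}")
        case True
        then show ?thesis using f by (auto simp: Z_def)
      next
        case False
        then obtain y where y: "y \<in> S f" "a \<le> y" by auto
        then have "y < a'" using f(2) by (auto simp: not_le[symmetric])
        have "S f \<inter> {a..a'} \<noteq> {}" using y \<open>y < a'\<close> by auto
        moreover have "S f \<inter> {a'<..} = {}" using f(2) by auto
        ultimately have "last_point S f \<inter> {a..a'} \<noteq> {}"
          using last_point_hit_iff[where S = S and f = f, OF point_fieldD(1)[OF S f(1)]] by blast
        then obtain t where t: "t \<in> last_point S f" "a \<le> t" "t \<le> a'" by auto
        moreover have "t \<noteq> a'" using t(1) f(2) by (auto simp: last_point_def)
        ultimately have "t \<in> last_point S f \<inter> {a..<a'}" by auto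
        then show ?thesis using f(1) by blast
      qed
    qed
    then have "measure N (Z a') \<le> measure N (Z a \<union> ?E)"
      using Z E by (intro finite_measure_mono) auto
    also have "\<dots> \<le> measure N (Z a) + measure N ?E"
      using Z E by (intro measure_Un_le) auto
    finally show ?thesis using last_point_null[OF S aa] by simp
  qed
  ultimately show ?thesis unfolding total by simp
qed simp

end

subsection \<open>Occupation times and the main equivalence\<close>

text \<open>A continuous function attains its supremum on a compact interval, so reaching level
  \<open>c\<close> means exceeding every smaller level, which countably many points can test.
  Parametrising \<open>[a, b]\<close> by \<open>[0, 1]\<close> covers \<open>a = b\<close> as well,
  where the rationals of \<open>[a, b]\<close> itself could be missing.\<close>

lemma level_hit_iff:
  fixes u :: "real \<Rightarrow> real"
  assumes lip: "\<And>s t. \<bar>u s - u t\<bar> \<le> \<bar>s - t\<bar>" and "a \<le> b"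
  shows "{t. c \<le> u t} \<inter> {a..b} \<noteq> {} \<longleftrightarrow>
    (\<forall>n. \<exists>r\<in>\<rat> \<inter> {0..1}. c - 1 / real (Suc n) < u (a + (b - a) * r))"
proof
  assume "{t. c \<le> u t} \<inter> {a..b} \<noteq> {}"
  then obtain t where t: "c \<le> u t" "a \<le> t" "t \<le> b" by auto
  obtain x where x: "0 \<le> x" "x \<le> 1" "t = a + (b - a) * x"
  proof (cases "a = b")
    case True
    then show ?thesis using that[of 0] t by simp
  next
    case False
    then show ?thesis using that[of "(t - a) / (b - a)"] t by (simp add: field_simps)
  qed
  show "\<forall>n. \<exists>r\<in>\<rat> \<inter> {0..1}. c - 1 / real (Suc n) < u (a + (b - a) * r)"
  proof
    fix n
    define e where "e = 1 / real (Suc n)"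
    have e: "0 < e" by (simp add: e_def)
    \<comment> \<open>The \<open>+ 1\<close> keeps the denominator positive when
      \<open>a = b\<close>.\<close>
    define d where "d = e / (b - a + 1)"
    have d: "0 < d" using e assms by (simp add: d_def)
    obtain r where r: "r \<in> \<rat>" "0 \<le> r" "r \<le> 1" "\<bar>x - r\<bar> < d"
    proof (cases "x = 1")
      case True
      then show ?thesis using that[of 1] d by simp
    next
      case False
      then have "x < min 1 (x + d)" using x d by simp
      from Rats_dense_in_real[OF this] obtain r where "r \<in> \<rat>" "x < r" "r < min 1 (x + d)" by blast
      then show ?thesis using that[of r] x by simp
    qed
    have "\<bar>u t - u (a + (b - a) * r)\<bar> \<le> \<bar>t - (a + (b - a) * r)\<bar>" by (rule lip)
    also have "\<dots> = (b - a) * \<bar>x - r\<bar>"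
    proof -
      have "t - (a + (b - a) * r) = (b - a) * (x - r)" by (simp add: x(3) algebra_simps)
      then show ?thesis using assms(2) by (simp add: abs_mult)
    qed
    also have "\<dots> \<le> (b - a) * d" using r assms(2) by (intro mult_left_mono) auto
    also have "\<dots> < (b - a + 1) * d" using d by simp
    also have "\<dots> = e" using assms(2) by (simp add: d_def)
    finally have "c - e < u (a + (b - a) * r)" using t(1) by linarith
    then show "\<exists>r\<in>\<rat> \<inter> {0..1}. c - 1 / real (Suc n) < u (a + (b - a) * r)"
      using r(1,2,3) by (auto simp: e_def)
  qed
next
  assume *: "\<forall>n. \<exists>r\<in>\<rat> \<inter> {0..1}. c - 1 / real (Suc n) < u (a + (b - a) * r)"
  have "continuous_on {a..b} u"
    unfolding continuous_on_iff
    by (intro ballI allI impI exI conjI, assumption)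
      (auto simp: dist_real_def intro: le_less_trans[OF lip])
  from continuous_attains_sup[OF compact_Icc _ this] assms(2)
  obtain t where t: "t \<in> {a..b}" "\<forall>y\<in>{a..b}. u y \<le> u t" by auto
  have "c \<le> u t"
  proof (rule ccontr)
    assume "\<not> c \<le> u t"
    then have "u t < c" by simp
    from gap_below[OF this] obtain n where n: "u t \<le> c - 1 / real (Suc n)" ..
    from spec[OF *, of n] obtain r where r: "r \<in> {0..1}" "c - 1 / real (Suc n) < u (a + (b - a) * r)" by blast
    have "0 \<le> (b - a) * r" "(b - a) * r \<le> (b - a) * 1"
      using r(1) assms(2) by (auto intro!: mult_left_mono mult_nonneg_nonneg simp del: mult_1_right)
    then have "a + (b - a) * r \<in> {a..b}" by simp
    then have "u (a + (b - a) * r) \<le> u t" using t(2) by blast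
    then show False using n r(2) by linarith
  qed
  then show "{t. c \<le> u t} \<inter> {a..b} \<noteq> {}" using t(1) by blast
qed

text \<open>The Lipschitz bound serves twice: it makes the level set closed, and through
  \<open>level_hit_iff\<close> it reduces hitting events to countably many times.\<close>

lemma point_field_level_set:
  assumes lip: "\<And>f s t. f \<in> H \<Longrightarrow> \<bar>u f s - u f t\<bar> \<le> \<bar>s - t\<bar>"
    and sh: "\<And>f c t. f \<in> H \<Longrightarrow> u (shift c f) t = u f (t + c)"
    and const: "\<And>f c. f \<in> H \<Longrightarrow> u (\<lambda>x. f x + c) = u f"
    and meas: "\<And>t. (\<lambda>f. u f t) \<in> borel_measurable (cylindrical H)"
  shows "point_field H (\<lambda>f. {t. c \<le> u f t})"
  unfolding point_field_def
proof (intro conjI ballI allI impI)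
  fix f assume f: "f \<in> H"
  have "continuous_on UNIV (u f)"
    unfolding continuous_on_iff
    by (intro ballI allI impI exI conjI, assumption)
      (auto simp: dist_real_def intro: le_less_trans[OF lip[OF f]])
  then show "closed {t. c \<le> u f t}" by (intro closed_Collect_le continuous_on_const)
  show "x \<in> {t. c \<le> u (shift d f) t} \<longleftrightarrow> x + d \<in> {t. c \<le> u f t}" for d x
    by (simp add: sh[OF f])
  show "{t. c \<le> u (\<lambda>x. f x + d) t} = {t. c \<le> u f t}" for d
    by (simp add: const[OF f])
next
  fix a b :: real assume "a \<le> b"
  have "{f \<in> H. {t. c \<le> u f t} \<inter> {a..b} \<noteq> {}} =
      {f \<in> H. \<forall>n. \<exists>r\<in>\<rat> \<inter> {0..1}. c - 1 / real (Suc n) < u f (a + (b - a) * r)}"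
    by (intro Collect_cong conj_cong refl level_hit_iff lip \<open>a \<le> b\<close>)
  also have "\<dots> = {f \<in> space (cylindrical H). \<forall>n. \<exists>r\<in>\<rat> \<inter> {0..1}. c - 1 / real (Suc n) < u f (a + (b - a) * r)}"
    by simp
  also have "\<dots> \<in> sets (cylindrical H)"
    by (intro sets.sets_Collect_countable_All sets.sets_Collect_countable_Ex' countable_Int1 countable_rat
        borel_measurable_less[OF borel_measurable_const meas])
  finally show "{f \<in> H. {t. c \<le> u f t} \<inter> {a..b} \<noteq> {}} \<in> sets (cylindrical H)" .
qed

lemma emeasure_lborel_translate:
  assumes "B \<in> sets borel"
  shows "emeasure lborel ((\<lambda>s. s + r) -` B) = emeasure lborel (B :: real set)"
proof -
  have "emeasure lborel B = emeasure (distr lborel borel ((+) r)) B" by (simp add: lborel_distr_plus)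
  also have "\<dots> = emeasure lborel ((+) r -` B \<inter> space lborel)"
    by (rule emeasure_distr) (use assms in auto)
  also have "(+) r -` B \<inter> space lborel = (\<lambda>s. s + r) -` B" by (auto simp: add.commute)
  finally show ?thesis by simp
qed

definition visits :: "(real \<Rightarrow> real) set \<Rightarrow> (real \<Rightarrow> real) \<Rightarrow> real set" where
  "visits A f = {s. recentre (shift s f) \<in> A}"

definition occupation :: "(real \<Rightarrow> real) set \<Rightarrow> real \<Rightarrow> (real \<Rightarrow> real) \<Rightarrow> real \<Rightarrow> real" where
  "occupation A h f t = measure lborel (visits A f \<inter> {t..t + h})"

lemma occupation_nonneg: "0 \<le> occupation A h f t"
  by (simp add: occupation_def)

lemma visits_shift: "s \<in> visits A (shift c f) \<longleftrightarrow> s + c \<in> visits A f"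
  by (simp add: visits_def shift_shift add.commute)

lemma visits_borel:
  assumes "LI_set H" "f \<in> H" "A \<in> sets (cylindrical H)"
  shows "visits A f \<in> sets borel"
proof -
  have "(\<lambda>s. recentre (shift s f)) \<in> borel \<rightarrow>\<^sub>M cylindrical H"
    by (rule measurable_recentre_shift[OF assms(1), of "\<lambda>_. f"]) (use assms in auto)
  from measurable_sets[OF this assms(3)] show ?thesis by (simp add: visits_def vimage_def)
qed

lemma emeasure_visits:
  assumes "LI_set H" "f \<in> H" "A \<in> sets (cylindrical H)"
  shows "emeasure lborel (visits A f \<inter> {x..y}) = ennreal (measure lborel (visits A f \<inter> {x..y}))"
proof (rule emeasure_eq_ennreal_measure)
  have "emeasure lborel (visits A f \<inter> {x..y}) \<le> emeasure lborel {x..y}"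
    by (rule emeasure_mono) auto
  also have "\<dots> < top" by (simp add: emeasure_lborel_Icc_eq)
  finally show "emeasure lborel (visits A f \<inter> {x..y}) \<noteq> top" by simp
qed

text \<open>The visits within the window are the section at \<open>f\<close> of a product-measurable
  set; joint measurability of evaluation enters here.\<close>

lemma occupation_measurable:
  assumes LI: "LI_set H" and A: "A \<in> sets (cylindrical H)"
  shows "(\<lambda>f. occupation A h f t) \<in> borel_measurable (cylindrical H)"
proof -
  have "(\<lambda>p. recentre (shift (snd p) (fst p))) \<in> cylindrical H \<Otimes>\<^sub>M lborel \<rightarrow>\<^sub>M cylindrical H"
    by (rule measurable_recentre_shift[OF LI]) auto
  from measurable_sets[OF this A]
  have "{p \<in> space (cylindrical H \<Otimes>\<^sub>M lborel). recentre (shift (snd p) (fst p)) \<in> A} \<in> sets (cylindrical H \<Otimes>\<^sub>M lborel)"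
    by (simp add: vimage_def Int_def conj_commute)
  then have Q: "{p \<in> space (cylindrical H \<Otimes>\<^sub>M lborel). recentre (shift (snd p) (fst p)) \<in> A} \<inter> (H \<times> {t..t + h}) \<in> sets (cylindrical H \<Otimes>\<^sub>M lborel)"
    (is "?Q \<in> _")
    using sets.top[of "cylindrical H"] by (intro sets.Int pair_measureI) auto
  have "(\<lambda>f. enn2real (emeasure lborel (Pair f -` ?Q))) \<in> borel_measurable (cylindrical H)"
    by (intro borel_measurable_enn2real lborel.measurable_emeasure_Pair Q)
  moreover have "Pair f -` ?Q = visits A f \<inter> {t..t + h}" if "f \<in> H" for f
    using that by (auto simp: visits_def space_pair_measure)
  ultimately show ?thesis
    by (subst measurable_cong[where g = "\<lambda>f. enn2real (emeasure lborel (Pair f -` ?Q))"])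
      (auto simp: occupation_def measure_def)
qed

text \<open>Sliding the window gains and loses at most an interval whose length is the
  displacement.\<close>

lemma occupation_lipschitz:
  assumes "LI_set H" "f \<in> H" "A \<in> sets (cylindrical H)" "0 < h"
  shows "\<bar>occupation A h f s - occupation A h f t\<bar> \<le> \<bar>s - t\<bar>"
proof -
  note V = visits_borel[OF assms(1-3)]
  have Icc: "{x..y} \<in> fmeasurable lborel" for x y :: real
    by (rule fmeasurableI) (auto simp: emeasure_lborel_Icc_eq)
  have W: "visits A f \<inter> {x..y} \<in> fmeasurable lborel" for x y
    by (rule fmeasurableI2[OF Icc[of x y]]) (use V in auto)
  have le: "\<bar>occupation A h f s - occupation A h f t\<bar> \<le> t - s" if "s \<le> t" for s t
  proof -
    have "occupation A h f t \<le> measure lborel ((visits A f \<inter> {s..s + h}) \<union> {s + h..t + h})"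
      unfolding occupation_def using that V
      by (intro measure_mono_fmeasurable fmeasurable.Un W Icc) auto
    also have "\<dots> \<le> occupation A h f s + measure lborel {s + h..t + h}"
      unfolding occupation_def using V by (intro measure_Un_le) auto
    also have "\<dots> = occupation A h f s + (t - s)" using that by simp
    finally have 1: "occupation A h f t \<le> occupation A h f s + (t - s)" .
    have "occupation A h f s \<le> measure lborel ((visits A f \<inter> {t..t + h}) \<union> {s..t})"
      unfolding occupation_def using that V
      by (intro measure_mono_fmeasurable fmeasurable.Un W Icc) auto
    also have "\<dots> \<le> occupation A h f t + measure lborel {s..t}"
      unfolding occupation_def using V by (intro measure_Un_le) auto
    also have "\<dots> = occupation A h f t + (t - s)" using that by simp
    finally show ?thesis using 1 by simp
  qed
  show ?thesis
    using le[of s t] le[of t s] by (cases "s \<le> t") auto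
qed

lemma point_field_occupation:
  assumes LI: "LI_set H" and A: "A \<in> sets (cylindrical H)" and h: "0 < h"
  shows "point_field H (\<lambda>f. {t. c \<le> occupation A h f t})"
proof (rule point_field_level_set)
  fix f assume f: "f \<in> H"
  show "\<bar>occupation A h f s - occupation A h f t\<bar> \<le> \<bar>s - t\<bar>" for s t
    by (rule occupation_lipschitz[OF LI f A h])
  show "occupation A h (shift d f) t = occupation A h f (t + d)" for d t
  proof -
    have B: "visits A f \<inter> {t + d..t + d + h} \<in> sets borel" using visits_borel[OF LI f A] by auto
    have "visits A (shift d f) \<inter> {t..t + h} = (\<lambda>s. s + d) -` (visits A f \<inter> {t + d..t + d + h})"
      using visits_shift[of _ A d f] by auto
    then have "emeasure lborel (visits A (shift d f) \<inter> {t..t + h}) = emeasure lborel (visits A f \<inter> {t + d..t + d + h})"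
      using emeasure_lborel_translate[OF B, of d] by simp
    then show ?thesis by (simp add: occupation_def measure_def)
  qed
  show "occupation A h (\<lambda>x. f x + d) = occupation A h f" for d
    by (simp add: occupation_def[abs_def] visits_def recentre_shift_add)
qed (rule occupation_measurable[OF LI A])

context path_law
begin

text \<open>The layer-cake formula, by exchanging the integrals over \<open>{(f, c). 0 < c \<le> V f}\<close>.\<close>

lemma nn_integral_tail:
  assumes V: "V \<in> borel_measurable N" and pos: "\<And>f. f \<in> H \<Longrightarrow> 0 \<le> V f"
  shows "(\<integral>\<^sup>+f. ennreal (V f) \<partial>N) = (\<integral>\<^sup>+c. emeasure N {f \<in> H. 0 < c \<and> c \<le> V f} \<partial>lborel)"
proof -
  interpret pair_sigma_finite N lborel ..
  let ?Q = "{p \<in> space (N \<Otimes>\<^sub>M lborel). 0 < snd p \<and> snd p \<le> V (fst p)}"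
  have Q: "?Q \<in> sets (N \<Otimes>\<^sub>M lborel)" using V by measurable
  have "(\<integral>\<^sup>+f. ennreal (V f) \<partial>N) = (\<integral>\<^sup>+f. emeasure lborel (Pair f -` ?Q) \<partial>N)"
  proof (rule nn_integral_cong)
    fix f assume f: "f \<in> space N"
    have "Pair f -` ?Q = {0<..V f}" using f by (auto simp: space_pair_measure)
    then show "ennreal (V f) = emeasure lborel (Pair f -` ?Q)" using pos f by simp
  qed
  also have "\<dots> = emeasure (N \<Otimes>\<^sub>M lborel) ?Q"
    by (rule lborel.emeasure_pair_measure_alt[OF Q, symmetric])
  also have "\<dots> = (\<integral>\<^sup>+c. emeasure N ((\<lambda>f. (f, c)) -` ?Q) \<partial>lborel)"
    by (rule emeasure_pair_measure_alt2[OF Q])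
  also have "\<dots> = (\<integral>\<^sup>+c. emeasure N {f \<in> H. 0 < c \<and> c \<le> V f} \<partial>lborel)"
    by (intro nn_integral_cong arg_cong2[where f = emeasure]) (auto simp: space_pair_measure)
  finally show ?thesis .
qed

lemma stationary_of_occupation_mono:
  assumes mono: "\<And>A h c a a'. A \<in> sets (cylindrical H) \<Longrightarrow> 0 < h \<Longrightarrow> a \<le> a' \<Longrightarrow>
    measure N {f \<in> H. c \<le> occupation A h f a} \<le> measure N {f \<in> H. c \<le> occupation A h f a'}"
  shows "increment_law H N b = increment_law H N 0"
proof -
  let ?C = "cylindrical H"
  define J where "J A x y = (\<integral>\<^sup>+f. emeasure lborel (visits A f \<inter> {x..y}) \<partial>N)" for A x y
  have occ: "emeasure lborel (visits A f \<inter> {a..a + h}) = ennreal (occupation A h f a)"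
    if "f \<in> H" "A \<in> sets ?C" for A f a h
    unfolding occupation_def by (rule emeasure_visits[OF LI that])
  have om: "(\<lambda>f. occupation A h f a) \<in> borel_measurable N" if "A \<in> sets ?C" for A h a
    unfolding measurable_N by (rule occupation_measurable[OF LI that])
  have J: "J A a (a + h) = (\<integral>\<^sup>+f. ennreal (occupation A h f a) \<partial>N)" if "A \<in> sets ?C" for A a h
    unfolding J_def by (rule nn_integral_cong) (use occ that in simp)
  have J_mono: "J A a (a + h) \<le> J A a' (a' + h)" if A: "A \<in> sets ?C" and "0 < h" "a \<le> a'" for A a a' h
  proof -
    have "emeasure N {f \<in> H. 0 < c \<and> c \<le> occupation A h f a} \<le> emeasure N {f \<in> H. 0 < c \<and> c \<le> occupation A h f a'}" for c
      using mono[OF that, of c] by (cases "0 < c") (simp_all add: emeasure_eq_measure)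
    then show ?thesis
      unfolding J[OF A] nn_integral_tail[OF om[OF A] occupation_nonneg] by (rule nn_integral_mono)
  qed
  have J_compl: "J A a (a + h) + J (H - A) a (a + h) = ennreal h" if A: "A \<in> sets ?C" and "0 < h" for A a h
  proof -
    have A': "H - A \<in> sets ?C" using sets.compl_sets[OF A] by simp
    have "ennreal (occupation A h f a) + ennreal (occupation (H - A) h f a) = ennreal h" if f: "f \<in> H" for f
    proof -
      have "visits (H - A) f = - visits A f"
        using recentre_in[OF LI shift_in[OF LI f]] by (auto simp: visits_def)
      then have "{a..a + h} = (visits A f \<inter> {a..a + h}) \<union> (visits (H - A) f \<inter> {a..a + h})"
        "(visits A f \<inter> {a..a + h}) \<inter> (visits (H - A) f \<inter> {a..a + h}) = {}" by auto
      then have "emeasure lborel (visits A f \<inter> {a..a + h}) + emeasure lborel (visits (H - A) f \<inter> {a..a + h}) = emeasure lborel {a..a + h}"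
        using visits_borel[OF LI f A] visits_borel[OF LI f A'] by (subst plus_emeasure) auto
      then show ?thesis using occ[OF f A] occ[OF f A'] \<open>0 < h\<close> by simp
    qed
    then have "(\<integral>\<^sup>+f. ennreal (occupation A h f a) + ennreal (occupation (H - A) h f a) \<partial>N) = (\<integral>\<^sup>+f. ennreal h \<partial>N)"
      by (intro nn_integral_cong) simp
    also have "\<dots> = ennreal h" using emeasure_space_1 by simp
    finally show ?thesis
      unfolding J[OF A] J[OF A'] using om[OF A] om[OF A'] by (subst (asm) nn_integral_add) auto
  qed
  \<comment> \<open>The mean for \<open>H - A\<close> increases too and the two means add up to
    \<open>h\<close>, so neither can increase strictly. Finiteness is checked because cancellation
    in \<open>ennreal\<close> needs it.\<close>
  have J_le: "J A a (a + h) = J A a' (a' + h)" if A: "A \<in> sets ?C" and h: "0 < h" and "a \<le> a'" for A a a' h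
  proof (rule antisym)
    show "J A a (a + h) \<le> J A a' (a' + h)" by (rule J_mono[OF that])
    have A': "H - A \<in> sets ?C" using sets.compl_sets[OF A] by simp
    have "J (H - A) a' (a' + h) + J A a' (a' + h) = J (H - A) a (a + h) + J A a (a + h)"
      using J_compl[OF A h] by (simp add: add.commute)
    also have "\<dots> \<le> J (H - A) a' (a' + h) + J A a (a + h)"
      by (rule add_mono[OF J_mono[OF A' h that(3)] order_refl])
    finally have "J (H - A) a' (a' + h) + J A a' (a' + h) \<le> J (H - A) a' (a' + h) + J A a (a + h)" .
    moreover have "J (H - A) a' (a' + h) \<noteq> top"
    proof
      assume "J (H - A) a' (a' + h) = top"
      then show False using J_compl[OF A h, of a'] by simp
    qed
    ultimately show "J A a' (a' + h) \<le> J A a (a + h)"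
      by (simp add: ennreal_add_left_cancel_le)
  qed
  have J_const: "J A x y = J A (x + r) (y + r)" if A: "A \<in> sets ?C" for A x y r
  proof (cases "x < y")
    case True
    then have pos: "0 < y - x" by simp
    have "J A a (a + (y - x)) = J A a' (a' + (y - x))" for a a'
    proof (cases "a \<le> a'")
      case True
      then show ?thesis by (rule J_le[OF A pos])
    next
      case False
      then have "a' \<le> a" by simp
      then show ?thesis by (rule J_le[OF A pos, symmetric])
    qed
    from this[of x "x + r"] show ?thesis by (simp add: algebra_simps)
  next
    case False
    have "emeasure lborel (visits A f \<inter> {u..v}) = 0" if "v \<le> u" for f u v
    proof -
      have "emeasure lborel (visits A f \<inter> {u..v}) \<le> emeasure lborel {u..v}" by (rule emeasure_mono) auto
      also have "\<dots> = 0" using that by (simp add: emeasure_lborel_Icc_eq)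
      finally show ?thesis by simp
    qed
    then show ?thesis using False by (simp add: J_def)
  qed
  interpret P: pair_sigma_finite lborel N ..
  \<comment> \<open>The time \<open>fst p\<close> is kept as a coordinate next to the path recentred
    at \<open>fst p + r\<close>; remembering it allows the shift to be undone.\<close>
  define T where "T r p = (fst p, recentre (shift (fst p + r) (snd p)))" for r :: real and p
  have Tm: "T r \<in> lborel \<Otimes>\<^sub>M N \<rightarrow>\<^sub>M borel \<Otimes>\<^sub>M ?C" for r
    unfolding T_def
  proof (rule measurable_Pair)
    have "snd \<in> lborel \<Otimes>\<^sub>M N \<rightarrow>\<^sub>M ?C"
      using measurable_snd[of lborel N] by (simp add: measurable_cong_sets[OF refl sets_N])
    then show "(\<lambda>p. recentre (shift (fst p + r) (snd p))) \<in> lborel \<Otimes>\<^sub>M N \<rightarrow>\<^sub>M ?C"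
      by (rule measurable_recentre_shift[OF LI]) measurable
  qed measurable
  define \<nu> where "\<nu> r = distr (lborel \<Otimes>\<^sub>M N) (borel \<Otimes>\<^sub>M ?C) (T r)" for r
  have spN: "space (lborel \<Otimes>\<^sub>M N) = UNIV \<times> H" by (simp add: space_pair_measure)
  have rect: "emeasure (\<nu> r) ({x..y} \<times> A) = J A (x + r) (y + r)" if A: "A \<in> sets ?C" for r x y A
  proof -
    have XA: "{x..y} \<times> A \<in> sets (borel \<Otimes>\<^sub>M ?C)" using A by auto
    let ?Q = "T r -` ({x..y} \<times> A) \<inter> space (lborel \<Otimes>\<^sub>M N)"
    have "emeasure (\<nu> r) ({x..y} \<times> A) = emeasure (lborel \<Otimes>\<^sub>M N) ?Q"
      unfolding \<nu>_def by (rule emeasure_distr[OF Tm XA])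
    also have "\<dots> = (\<integral>\<^sup>+f. emeasure lborel ((\<lambda>s. (s, f)) -` ?Q) \<partial>N)"
      by (rule P.emeasure_pair_measure_alt2[OF measurable_sets[OF Tm XA]])
    also have "\<dots> = J A (x + r) (y + r)"
      unfolding J_def
    proof (rule nn_integral_cong)
      fix f assume f: "f \<in> space N"
      have B: "visits A f \<inter> {x + r..y + r} \<in> sets borel" using visits_borel[OF LI _ A, of f] f by auto
      have "(\<lambda>s. (s, f)) -` ?Q = (\<lambda>s. s + r) -` (visits A f \<inter> {x + r..y + r})"
        using f by (auto simp: T_def spN visits_def)
      then show "emeasure lborel ((\<lambda>s. (s, f)) -` ?Q) = emeasure lborel (visits A f \<inter> {x + r..y + r})"
        using emeasure_lborel_translate[OF B, of r] by simp
    qed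
    finally show ?thesis .
  qed
  \<comment> \<open>Agreement on rectangles is enough; since Lebesgue measure is infinite, the
    strips \<open>?K\<close> supply the exhaustion by sets of finite mass.\<close>
  have "\<nu> b = \<nu> 0"
  proof (rule measure_eqI_generator_eq)
    let ?E = "{I \<times> A | I A. I \<in> range (\<lambda>(x, y). {x..y :: real}) \<and> A \<in> sets ?C}"
    let ?K = "\<lambda>i::nat. {- real i..real i} \<times> H"
    show "Int_stable ?E"
    proof (rule Int_stableI)
      fix P Q assume "P \<in> ?E" "Q \<in> ?E"
      then obtain x y A x' y' A' where *: "P = {x..y} \<times> A" "Q = {x'..y'} \<times> A'" "A \<in> sets ?C" "A' \<in> sets ?C" by auto
      then have 1: "P \<inter> Q = {max x x'..min y y'} \<times> (A \<inter> A')" by auto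
      have 2: "A \<inter> A' \<in> sets ?C" using * by auto
      have 3: "{max x x'..min y y'} \<in> range (\<lambda>(x, y). {x..y :: real})"
        by (rule image_eqI[of _ _ "(max x x', min y y')"]) auto
      show "P \<inter> Q \<in> ?E"
        by (rule CollectI, rule exI[of _ "{max x x'..min y y'}"], rule exI[of _ "A \<inter> A'"]) (intro conjI 1 2 3)
    qed
    show "?E \<subseteq> Pow (UNIV \<times> H)" using sets.sets_into_space[of _ ?C] by auto
    have Esets: "sets (borel \<Otimes>\<^sub>M ?C) = sigma_sets (UNIV \<times> H) ?E"
    proof -
      have "sets (borel \<Otimes>\<^sub>M ?C) = sets (sigma (space borel \<times> space ?C) ?E)"
      proof (rule sets_pair_eq[where Ca = "range (\<lambda>i::nat. {- real i..real i})" and Cb = "{H}"])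
        show "sets borel = sigma_sets (space borel) (range (\<lambda>(x, y). {x..y :: real}))"
          by (subst borel_eq_atLeastAtMost) (simp add: sets_measure_of)
        show "sets ?C = sigma_sets (space ?C) (sets ?C)" by (rule sets.sigma_sets_eq[symmetric])
        show "sets ?C \<subseteq> Pow (space ?C)" by (rule sets.space_closed)
        show "range (\<lambda>i::nat. {- real i..real i}) \<subseteq> range (\<lambda>(x, y). {x..y :: real})" by auto
        show "\<Union>(range (\<lambda>i::nat. {- real i..real i})) = space borel"
        proof (rule set_eqI)
          fix z :: real
          obtain i where "\<bar>z\<bar> \<le> real i" using real_arch_simple by blast
          then have "z \<in> {- real i..real i}" by auto
          then show "z \<in> \<Union>(range (\<lambda>i::nat. {- real i..real i})) \<longleftrightarrow> z \<in> space borel" by auto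
        qed
        show "{H} \<subseteq> sets ?C" using sets.top[of ?C] by simp
      qed auto
      also have "\<dots> = sigma_sets (UNIV \<times> H) ?E"
        using \<open>?E \<subseteq> Pow (UNIV \<times> H)\<close> by (subst sets_measure_of) auto
      finally show ?thesis .
    qed
    show "sets (\<nu> b) = sigma_sets (UNIV \<times> H) ?E" "sets (\<nu> 0) = sigma_sets (UNIV \<times> H) ?E"
      unfolding \<nu>_def using Esets by simp_all
    show "range ?K \<subseteq> ?E"
    proof clarify
      fix i :: nat
      show "\<exists>I A. {- real i..real i} \<times> H = I \<times> A \<and> I \<in> range (\<lambda>(x, y). {x..y :: real}) \<and> A \<in> sets ?C"
        using sets.top[of ?C] by (intro exI[of _ "{- real i..real i}"] exI[of _ H]) auto
    qed
    show "(\<Union>i. ?K i) = UNIV \<times> H"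
    proof (rule set_eqI)
      fix p :: "real \<times> (real \<Rightarrow> real)"
      obtain i where "\<bar>fst p\<bar> \<le> real i" using real_arch_simple by blast
      then have "fst p \<in> {- real i..real i}" by auto
      then show "p \<in> (\<Union>i. ?K i) \<longleftrightarrow> p \<in> UNIV \<times> H" by (cases p) auto
    qed
    show "emeasure (\<nu> b) (?K i) \<noteq> \<infinity>" for i
    proof -
      have "emeasure (\<nu> b) (?K i) = J H (- real i + b) (real i + b)"
        using rect sets.top[of ?C] by simp
      also have "\<dots> \<le> (\<integral>\<^sup>+f. ennreal (2 * real i) \<partial>N)"
        unfolding J_def
      proof (rule nn_integral_mono)
        fix f
        have "emeasure lborel (visits H f \<inter> {- real i + b..real i + b}) \<le> emeasure lborel {- real i + b..real i + b}"
          by (rule emeasure_mono) auto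
        then show "emeasure lborel (visits H f \<inter> {- real i + b..real i + b}) \<le> ennreal (2 * real i)" by simp
      qed
      also have "\<dots> < \<infinity>" using emeasure_space_1 by (simp add: ennreal_mult_less_top)
      finally show ?thesis by simp
    qed
    fix P assume "P \<in> ?E"
    then obtain x y A where P: "P = {x..y} \<times> A" "A \<in> sets ?C" by auto
    show "emeasure (\<nu> b) P = emeasure (\<nu> 0) P"
      unfolding P(1) rect[OF P(2)] using J_const[OF P(2), of x y b] by simp
  qed
  \<comment> \<open>After undoing the shift by \<open>fst p\<close> only the shift by
    \<open>r\<close> remains, whatever \<open>fst p\<close> is. Restricting the time to
    \<open>[0, 1]\<close> gives it mass 1, so the value is the law at \<open>r\<close> itself and
    not an average over times.\<close>
  have eval: "emeasure (increment_law H N r) A = emeasure (\<nu> r) {p \<in> space (borel \<Otimes>\<^sub>M ?C). fst p \<in> {0..1} \<and> recentre (shift (- fst p) (snd p)) \<in> A}"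
    if A: "A \<in> sets ?C" for r A
  proof -
    have "(\<lambda>p. recentre (shift (- fst p) (snd p))) \<in> borel \<Otimes>\<^sub>M ?C \<rightarrow>\<^sub>M ?C"
      by (rule measurable_recentre_shift[OF LI]) measurable
    from measurable_sets[OF this A]
    have "{p \<in> space (borel \<Otimes>\<^sub>M ?C). recentre (shift (- fst p) (snd p)) \<in> A} \<inter> ({0..1} \<times> H) \<in> sets (borel \<Otimes>\<^sub>M ?C)"
      using sets.top[of ?C] by (intro sets.Int pair_measureI) (auto simp: vimage_def Int_def conj_commute)
    moreover have "{p \<in> space (borel \<Otimes>\<^sub>M ?C). recentre (shift (- fst p) (snd p)) \<in> A} \<inter> ({0..1} \<times> H) =
        {p \<in> space (borel \<Otimes>\<^sub>M ?C). fst p \<in> {0..1} \<and> recentre (shift (- fst p) (snd p)) \<in> A}"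
      by (auto simp: space_pair_measure)
    ultimately have Q: "{p \<in> space (borel \<Otimes>\<^sub>M ?C). fst p \<in> {0..1} \<and> recentre (shift (- fst p) (snd p)) \<in> A} \<in> sets (borel \<Otimes>\<^sub>M ?C)"
      (is "?Q \<in> _") by simp
    have r: "(\<lambda>f. recentre (shift r f)) \<in> N \<rightarrow>\<^sub>M ?C"
      unfolding measurable_N by (rule measurable_recentre_shift_const[OF LI])
    let ?F = "(\<lambda>f. recentre (shift r f)) -` A \<inter> space N"
    have "T r -` ?Q \<inter> space (lborel \<Otimes>\<^sub>M N) = {0..1} \<times> ?F"
      using recentre_in[OF LI shift_in[OF LI]]
      by (auto simp: T_def space_pair_measure recentre_shift_recentre_shift)
    then have "emeasure (\<nu> r) ?Q = emeasure (lborel \<Otimes>\<^sub>M N) ({0..1 :: real} \<times> ?F)"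
      unfolding \<nu>_def emeasure_distr[OF Tm Q] by (rule arg_cong)
    also have "\<dots> = emeasure lborel {0..1::real} * emeasure N ?F"
      by (rule emeasure_pair_measure_Times) (use measurable_sets[OF r A] in auto)
    also have "\<dots> = emeasure (increment_law H N r) A"
      unfolding increment_law_def using emeasure_distr[OF r A] by simp
    finally show ?thesis by simp
  qed
  show ?thesis
  proof (rule measure_eqI)
    fix A assume "A \<in> sets (increment_law H N b)"
    then have "A \<in> sets ?C" by (simp add: increment_law_def)
    then show "emeasure (increment_law H N b) A = emeasure (increment_law H N 0) A"
      by (simp add: eval \<open>\<nu> b = \<nu> 0\<close>)
  qed (simp add: increment_law_def)
qed

text \<open>The first point on \<open>[a, a + \<Delta>]\<close> equals \<open>a\<close> exactly if
  \<open>a\<close> belongs to the set. The atom at 0 of the recentred law is thus the probability of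
  level \<open>c\<close> at time \<open>a\<close>, whatever the length \<open>\<Delta>\<close>; a
  single length suffices.\<close>

lemma stationary_of_shift_free:
  assumes \<Delta>: "0 < \<Delta>"
    and free: "\<And>L a a'. doubly_intrinsic_location H L \<Longrightarrow>
      distr N ext_line (\<lambda>f. L f {a..a + \<Delta>} - ereal a) = distr N ext_line (\<lambda>f. L f {a'..a' + \<Delta>} - ereal a')"
  shows "increment_law H N b = increment_law H N 0"
proof (rule stationary_of_occupation_mono)
  fix A and h c a a' :: real assume A: "A \<in> sets (cylindrical H)" and h: "0 < h"
  let ?S = "\<lambda>f. {t. c \<le> occupation A h f t}"
  note S = point_field_occupation[OF LI A h, of c]
  note dl = first_point_doubly_intrinsic[OF LI S]
  interpret path_law_location H N "first_point ?S" by unfold_locales (rule dl)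
  have "measure N {f \<in> H. c \<le> occupation A h f a} =
      measure (distr N ext_line (\<lambda>f. first_point ?S f {a..a + \<Delta>} - ereal a)) (ereal ` {0})" for a
  proof -
    have m: "(\<lambda>f. first_point ?S f {a..a + \<Delta>} - ereal a) \<in> N \<rightarrow>\<^sub>M ext_line"
      by (rule measurable_compose[OF L_measurable minus_ereal_ext_line]) (use \<Delta> in simp)
    have "first_point ?S f {a..a + \<Delta>} - ereal a \<in> ereal ` {0} \<longleftrightarrow> c \<le> occupation A h f a" if f: "f \<in> H" for f
      using point_fieldD(1)[OF S f]
    proof (cases rule: first_point_cases[where R = ?S and f = f and a = a and b = "a + \<Delta>"])
      case 1
      then show ?thesis using \<Delta> by auto
    next
      case (2 x)
      have "c \<le> occupation A h f a \<longleftrightarrow> x = a"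
        using 2(1,2) 2(4)[of a] by auto
      then show ?thesis unfolding 2(5) by auto
    qed
    then have "(\<lambda>f. first_point ?S f {a..a + \<Delta>} - ereal a) -` (ereal ` {0}) \<inter> space N = {f \<in> H. c \<le> occupation A h f a}"
      by auto
    then show ?thesis
      using measure_distr[OF m ereal_image_in_ext_line[of "{0}"]] by simp
  qed
  then show "measure N {f \<in> H. c \<le> occupation A h f a} \<le> measure N {f \<in> H. c \<le> occupation A h f a'}"
    using free[OF dl, of a a'] by simp
qed

end

lemma (in tv_law) stationary_of_TV: "increment_law H N b = increment_law H N 0"
proof (rule stationary_of_occupation_mono)
  fix A and h c a a' :: real assume *: "A \<in> sets (cylindrical H)" "0 < h" and "a \<le> a'"
  show "measure N {f \<in> H. c \<le> occupation A h f a} \<le> measure N {f \<in> H. c \<le> occupation A h f a'}"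
    using point_probability_mono[OF point_field_occupation[OF LI *, of c] \<open>a \<le> a'\<close>] by simp
qed

theorem theorem2p5:
  fixes M :: "'a measure" and X :: "real \<Rightarrow> 'a \<Rightarrow> real" and H :: "(real \<Rightarrow> real) set"
  assumes "prob_space M"
    and "LI_set H"
    and "\<And>t. X t \<in> borel_measurable M"
    and "AE \<omega> in M. (\<lambda>t. X t \<omega>) \<in> H"
  shows "(stationary_increments M X \<longleftrightarrow> (\<exists>\<Delta>>0. shift_free_laws M X H \<Delta>)) \<and>
         (stationary_increments M X \<longleftrightarrow> (\<forall>\<Delta>>0. shift_free_laws M X H \<Delta>)) \<and>
         (stationary_increments M X \<longleftrightarrow> TV_laws M X H)"
proof (rule path_law_reduction[OF assms])
  fix N assume N: "prob_space N" "sets N = sets (cylindrical H)"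
    and st: "stationary_increments M X \<longleftrightarrow> (\<forall>h. increment_law H N h = increment_law H N 0)"
    and law: "\<And>L I. doubly_intrinsic_location H L \<Longrightarrow> I \<in> intervals \<Longrightarrow>
      ext_law M (path_location H L X I) = distr N ext_line (\<lambda>f. L f I)"
    and law_minus: "\<And>L I c. doubly_intrinsic_location H L \<Longrightarrow> I \<in> intervals \<Longrightarrow>
      ext_law M (\<lambda>\<omega>. path_location H L X I \<omega> - ereal c) = distr N ext_line (\<lambda>f. L f I - ereal c)"
  interpret path_law H N by (rule path_law.intro[OF assms(2) N])
  have I: "{a..b} \<in> intervals" if "a < b" for a b :: real using that by (auto simp: intervals_def)
  have free: "shift_free_laws M X H \<Delta> \<longleftrightarrow> (\<forall>L. doubly_intrinsic_location H L \<longrightarrow> (\<forall>a a'.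
      distr N ext_line (\<lambda>f. L f {a..a + \<Delta>} - ereal a) = distr N ext_line (\<lambda>f. L f {a'..a' + \<Delta>} - ereal a')))"
    if "0 < \<Delta>" for \<Delta>
    unfolding shift_free_laws_def using that by (simp add: law_minus I)
  have 12: "shift_free_laws M X H \<Delta>" if "stationary_increments M X" "0 < \<Delta>" for \<Delta>
    unfolding free[OF that(2)]
  proof (intro allI impI)
    fix L and a a' :: real assume L: "doubly_intrinsic_location H L"
    have si: "increment_law H N h = increment_law H N 0" for h using st that(1) by blast
    interpret stationary_law H N L by unfold_locales (rule L, rule si)
    have "distr N ext_line (\<lambda>f. L f {a..a + \<Delta>} - ereal a) = distr N ext_line (\<lambda>f. L f {0..\<Delta>})" for a
      using law_shift[of 0 \<Delta> a] that(2) by (simp add: add.commute)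
    then show "distr N ext_line (\<lambda>f. L f {a..a + \<Delta>} - ereal a) = distr N ext_line (\<lambda>f. L f {a'..a' + \<Delta>} - ereal a')"
      by simp
  qed
  have 21: "stationary_increments M X" if "0 < \<Delta>" "shift_free_laws M X H \<Delta>" for \<Delta>
  proof -
    have "increment_law H N h = increment_law H N 0" for h
      by (rule stationary_of_shift_free[OF that(1)]) (use that(2) free[OF that(1)] in blast)
    then show ?thesis using st by blast
  qed
  have TV_iff: "TV_laws M X H \<longleftrightarrow> (\<forall>L a b. doubly_intrinsic_location H L \<and> a < b \<longrightarrow>
      (let \<nu> = law_inside (distr N ext_line (\<lambda>f. L f {a..b})) a b; leb = restrict_space lborel {a<..<b}
       in absolutely_continuous leb \<nu> \<and> (\<exists>f \<in> borel_measurable leb. \<nu> = density leb (\<lambda>x. ennreal (f x)) \<and>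
         regular_density f a b \<and> TV_constraints f a b)))"
    unfolding TV_laws_def by (simp add: law I Let_def cong: conj_cong imp_cong)
  have 13: "TV_laws M X H" if "stationary_increments M X"
    unfolding TV_iff Let_def
  proof (intro allI impI)
    fix L and a b :: real assume "doubly_intrinsic_location H L \<and> a < b"
    then have L: "doubly_intrinsic_location H L" and ab: "a < b" by auto
    have si: "increment_law H N h = increment_law H N 0" for h using st that by blast
    interpret stationary_law H N L by unfold_locales (rule L, rule si)
    let ?leb = "restrict_space lborel {a<..<b}" and ?\<nu> = "law_inside (distr N ext_line (\<lambda>f. L f {a..b})) a b"
    from law_inside_density[OF ab] obtain f where f: "f \<in> borel_measurable ?leb"
      "?\<nu> = density ?leb (\<lambda>x. ennreal (f x))" "regular_density f a b" "TV_constraints f a b" by blast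
    have "absolutely_continuous ?leb ?\<nu>"
      unfolding f(2) by (rule absolutely_continuousI_density) (use f(1) in measurable)
    then show "absolutely_continuous ?leb ?\<nu> \<and> (\<exists>f \<in> borel_measurable ?leb. ?\<nu> = density ?leb (\<lambda>x. ennreal (f x)) \<and>
         regular_density f a b \<and> TV_constraints f a b)" using f by blast
  qed
  have 31: "stationary_increments M X" if "TV_laws M X H"
  proof -
    interpret tv_law H N
    proof unfold_locales
      fix L and a b :: real assume "doubly_intrinsic_location H L" "a < b"
      then show "\<exists>f \<in> borel_measurable (restrict_space lborel {a<..<b}).
        law_inside (distr N ext_line (\<lambda>f. L f {a..b})) a b = density (restrict_space lborel {a<..<b}) (\<lambda>x. ennreal (f x)) \<and>
        regular_density f a b \<and> TV_constraints f a b"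
        using that unfolding TV_iff Let_def by blast
    qed
    show ?thesis unfolding st using stationary_of_TV by blast
  qed
  show ?thesis
  proof (intro conjI iffI)
    assume "stationary_increments M X"
    then have "(0 :: real) < 1 \<and> shift_free_laws M X H 1" using 12[of 1] by simp
    then show "\<exists>\<Delta>>0. shift_free_laws M X H \<Delta>" ..
  next
    assume "\<forall>\<Delta>>0. shift_free_laws M X H \<Delta>"
    then have "shift_free_laws M X H 1" using zero_less_one by blast
    then show "stationary_increments M X" by (rule 21[OF zero_less_one])
  qed (use 12 21 13 31 in blast)+
qed

end
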